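(* Let $\mathbb F\in\{\mathbb R,\mathbb C\}$, let $N\ge 3$, $N\ge\hat N\ge 2$, and let $\mathcal A,\mathcal B\in\mathbb F^{I_1\times\dots\times I_N}$. Assume that for each $n\in\{1,\dots,\hat N\}$ the matrix $\mathbf A_{(n^c;n)}$ has full column rank and that there exists a matrix $\mathbf M_n\in\mathbb F^{I_n\times I_n}$ such that $$\mathbf B_{(n^c;n)}=\mathbf A_{(n^c;n)}\mathbf M_n.$$ Then the following statements hold. 1. The matrices $\mathbf M_1,\dots,\mathbf M_{\hat N}$ have the same minimal polynomial $q(x)$. 2. Consider the factorization $q(x)=p_1(x)^{\mu_1}\cdots p_R(x)^{\mu_R}$ with distinct polynomials $p_r(x)$ that are irreducible over $\mathbb F$, and set $L_{nr}:=\dim\operatorname{Null}(p_r(\mathbf M_n)^{\mu_r})$, $1\le r\le R$, $1\le n\le\hat N$. For each $n=1,\dots,\hat N$ let $$\mathbf M_n=\mathbf S_n\operatorname{Bdiag}(\mathbf T_{n1},\dots,\mathbf T_{nR})\mathbf S_n^{-1},\quad \mathbf S_n=[\mathbf S_{n1}\ \dots\ \mathbf S_{nR}],\quad \mathbf S_{nr}\in\mathbb F^{I_n\times L_{nr}},$$ be the primary decomposition of $\mathbf M_n$, such that the minimal polynomials of $\mathbf T_{1r},\dots,\mathbf T_{\hat N r}$ are equal to $p_r(x)^{\mu_r}$ for each $r=1,\dots,R$. Then the tensor $$\mathcal D:=\mathcal A\bullet_1\mathbf S_1^T\cdots\bullet_{\hat N}\mathbf S_{\hat N}^T$$ is block-diagonal,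 $\mathcal D=\operatorname{Bdiag}(\mathcal D_1,\dots,\mathcal D_R)$ with $\mathcal D_r\in\mathbb F^{L_{1r}\times\dots\times L_{\hat N r}\times I_{\hat N+1}\times\dots\times I_N}$, and $$\mathcal D_r\bullet_1\mathbf T_{1r}^T=\dots=\mathcal D_r\bullet_{\hat N}\mathbf T_{\hat N r}^T,\qquad r=1,\dots,R.$$ 3. Let $\mathbf X^{(n)}:=\mathbf S_n^{-T}=[\mathbf X^{(n)}_1\ \dots\ \mathbf X^{(n)}_R]$ with $\mathbf X^{(n)}_r\in\mathbb F^{I_n\times L_{nr}}$, $n=1,\dots,\hat N$. Then the tensors $\mathcal A$ and $\mathcal B$ admit decompositions into ML rank-$(L_{1r},\dots,L_{\hat N r},\cdot,\dots,\cdot)$ terms which are connected as follows: $$\mathcal A=\sum_{r=1}^R\mathcal D_r\bullet_1\mathbf X^{(1)}_r\cdots\bullet_{\hat N}\mathbf X^{(\hat N)}_r=:\sum_{r=1}^R\mathcal A_r,$$ $$\mathcal B=\sum_{r=1}^R(\mathcal D_r\bullet_1\mathbf T_{1r}^T)\bullet_1\mathbf X^{(1)}_r\cdots\bullet_{\hat N}\mathbf X^{(\hat N)}_r=:\sum_{r=1}^R\mathcal B_r,$$ in which the tensors $\mathcal D_r$ satisfy the identities in statement 2. 4. Let $i,j\in\{1,\dots,\hat N\}$, $i\neq j$, and let $\mathbf A_{ij,k}\in\mathbb F^{I_i\times I_j}$, $k=1,\dots,(I_1\cdots I_N)/(I_iI_j)$, denote the $I_i\times I_j$ slices of $\mathcal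 A$, i.e. the matrices obtained from $\mathcal A$ by fixing all indices but the $i$th and the $j$th. If $I_i=I_j$ and if there exists a linear combination of the matrices $\mathbf A_{ij,k}$ that is nonsingular, then $\mathbf M_i$ is similar to $\mathbf M_j$. 5. If $\mathbf M_i$ is similar to $\mathbf M_j$ (where $i,j\in\{1,\dots,\hat N\}$), then $L_{ir}=L_{jr}$ for all $r$, and the matrices $\mathbf S_i$ and $\mathbf S_j$ in the primary decompositions in statement 2 can be chosen such that $\mathbf T_{ir}=\mathbf T_{jr}$ for all $r$. 6. If, for some $r$, there exists $n\in\{1,\dots,\hat N\}$ such that the matrix $\mathbf T_{nr}$ is a scalar multiple of the identity matrix, i.e., if $\mathbf T_{nr}=\lambda_r\mathbf I_{L_{nr}}$, then $\mathcal B_r=\lambda_r\mathcal A_r$. 7. If for each $r$ there exists $n_r\in\{1,\dots,\hat N\}$ such that $\mathbf T_{n_rr}=\lambda_r\mathbf I_{L_{n_rr}}$, then $\mathcal A$ and $\mathcal B$ consist of the same ML rank-$(L_{1r},\dots,L_{\hat N r},\cdot,\dots,\cdot)$ terms, possibly differently scaled.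
   Context: Mode-$n$ matrix representation: for $\mathcal A\in\mathbb F^{I_1\times\dots\times I_N}$, $\mathbf A_{(n^c;n)}\in\mathbb F^{\frac{I_1\cdots I_N}{I_n}\times I_n}$ is the matrix whose entry in row $1+\sum_{k\ne n}(i_k-1)\prod_{l<k,\,l\ne n}I_l$ and column $i_n$ is the $(i_1,\dots,i_N)$th entry of $\mathcal A$. Mode-$n$ product: for a tensor $\mathcal D$ whose $n$th dimension is $L_n$ and $\mathbf X\in\mathbb F^{I_n\times L_n}$, $\mathcal D\bullet_n\mathbf X$ is the tensor $\mathcal C$ with $n$th dimension $I_n$ (other dimensions unchanged) determined by $\mathbf C_{(n^c;n)}=\mathbf D_{(n^c;n)}\mathbf X^T$, i.e. all mode-$n$ fibers of $\mathcal D$ are multiplied by $\mathbf X$. Successive products are taken from left to right. ML rank: a tensor $\mathcal A$ of order $N$ is ML (multilinear) rank-$(L_1,\dots,L_{\hat N},\cdot,\dots,\cdot)$ if $\operatorname{rank}\mathbf A_{(n^c;n)}=L_n$ for $n=1,\dots,\hat N$ (no condition for $n>\hat N$). The minimal polynomial of a matrix is the polynomial over $\mathbb F$ of least degree with leading coefficient $1$ that annihilates it. Primary decomposition: if the minimal polynomial of $\mathbf M\in\mathbb F^{I\times I}$ is $q=p_1^{\mu_1}\cdots p_R^{\mu_R}$ with distinct irreducible $p_r$, a primary decomposition of $\mathbf M$ is a factorization $\mathbf M=\mathbf S\operatorname{Bdiag}(\mathbf T_1,\dots,\mathbf T_R)\mathbf S^{-1}$, $\mathbf S=[\mathbf S_1\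 \dots\ \mathbf S_R]$ nonsingular, where the columns of $\mathbf S_r$ form a basis of the $\mathbf M$-invariant subspace $\operatorname{Null}(p_r(\mathbf M)^{\mu_r})$ and $\mathbf M\mathbf S_r=\mathbf S_r\mathbf T_r$. Block-diagonal tensor: suppose $L_{n1}+\dots+L_{nR}=I_n$ for $n=1,\dots,\hat N$, and partition $\{1,\dots,I_n\}$ into consecutive blocks $V_{n1},\dots,V_{nR}$ of lengths $L_{n1},\dots,L_{nR}$. A tensor $\mathcal D\in\mathbb F^{I_1\times\dots\times I_N}$ is block-diagonal, written $\mathcal D=\operatorname{Bdiag}(\mathcal D_1,\dots,\mathcal D_R)$, if its $(i_1,\dots,i_N)$th entry is $0$ whenever $(i_1,\dots,i_{\hat N})\notin\bigcup_{r=1}^R(V_{1r}\times\dots\times V_{\hat N r})$; its diagonal blocks are $\mathcal D_r:=\mathcal D(V_{1r},\dots,V_{\hat N r},:,\dots,:)$. For matrices, $\operatorname{Bdiag}(\cdot)$ denotes a block-diagonal matrix with the given diagonal blocks; $\mathbf I_L$ is the $L\times L$ identity; ${}^T$ is the (non-conjugate) transpose, and ${}^{-T}$ the inverse of the transpose.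
   Formalization: In statement 3 the terms B_r are shown to have exact ML rank (L_{1r},…) only if some T_{nr} is nonsingular, and mode-n ranks at most L_{nr} always; as stated the claim fails for B = 0, where M_n = 0 and B_1 = 0. *)

theory Defs
  imports
    "HOL-Computational_Algebra.Polynomial_Factorial"
    "Jordan_Normal_Form.Matrix_Kernel"
    "Jordan_Normal_Form.DL_Rank"
    "Jordan_Normal_Form.Gauss_Jordan_Elimination"
begin

text \<open>Indices are 0-based throughout: modes are \<open>0, \<dots>, N - 1\<close>, the blocks are
  \<open>r = 0, \<dots>, R - 1\<close>, and the entries of the multi-indices start at \<open>0\<close>.\<close>

section \<open>The fields of real and of complex numbers\<close>

text \<open>Up to isomorphism, the only instances are \<^typ>\<open>real\<close> and \<^typ>\<open>complex\<close>.\<close>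

class real_or_complex = real_field +
  assumes real_or_complex:
    "(\<forall>x. \<exists>a. x = a *\<^sub>R 1) \<or>
     (\<exists>i. i * i = - 1 \<and> (\<forall>x. \<exists>a b. x = a *\<^sub>R 1 + b *\<^sub>R i))"

instance real :: real_or_complex
  by standard simp

instance complex :: real_or_complex
proof
  have "x = Re x *\<^sub>R 1 + Im x *\<^sub>R \<i>" for x
    by (simp add: complex_eq_iff)
  then show "(\<forall>x::complex. \<exists>a. x = a *\<^sub>R 1) \<or>
     (\<exists>i::complex. i * i = - 1 \<and> (\<forall>x. \<exists>a b. x = a *\<^sub>R 1 + b *\<^sub>R i))"
    by (intro disjI2 exI[of _ \<i>]) (auto intro!: exI)
qed


section \<open>Matrices\<close>

definition mat_rank :: "'a::field mat \<Rightarrow> nat" where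
  "mat_rank A = vec_space.rank (dim_row A) A"

definition full_column_rank :: "'a::field mat \<Rightarrow> bool" where
  "full_column_rank A \<longleftrightarrow> mat_rank A = dim_col A"

text \<open>Only meaningful for invertible matrices.\<close>

definition inv_mat :: "'a::field mat \<Rightarrow> 'a mat" where
  "inv_mat A = the (mat_inverse A)"

text \<open>The value of a polynomial at a square matrix, by the Horner scheme, as in the
  definition of \<^const>\<open>poly\<close>.\<close>

definition poly_mat :: "'a::comm_ring_1 poly \<Rightarrow> 'a mat \<Rightarrow> 'a mat" where
  "poly_mat p M =
     fold_coeffs (\<lambda>a X. a \<cdot>\<^sub>m 1\<^sub>m (dim_row M) + M * X) p (0\<^sub>m (dim_row M) (dim_row M))"

definition minimal_polynomial :: "'a::field mat \<Rightarrow> 'a poly \<Rightarrow> bool" where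
  "minimal_polynomial M q \<longleftrightarrow>
     lead_coeff q = 1 \<and> poly_mat q M = 0\<^sub>m (dim_row M) (dim_row M) \<and>
     (\<forall>f. lead_coeff f = 1 \<and> poly_mat f M = 0\<^sub>m (dim_row M) (dim_row M) \<longrightarrow> degree q \<le> degree f)"

text \<open>The \<open>r\<close>th of the consecutive blocks of lengths \<open>L 0, L 1, \<dots>\<close>.\<close>

definition offset :: "(nat \<Rightarrow> nat) \<Rightarrow> nat \<Rightarrow> nat" where
  "offset L r = (\<Sum>s<r. L s)"

definition block_range :: "(nat \<Rightarrow> nat) \<Rightarrow> nat \<Rightarrow> nat set" where
  "block_range L r = {offset L r ..< offset L r + L r}"

definition col_block :: "'a mat \<Rightarrow> (nat \<Rightarrow> nat) \<Rightarrow> nat \<Rightarrow> 'a mat" where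
  "col_block X L r = mat (dim_row X) (L r) (\<lambda>(i, j). X $$ (i, offset L r + j))"

definition irreducible_factorization ::
  "'a::field poly \<Rightarrow> nat \<Rightarrow> (nat \<Rightarrow> 'a poly) \<Rightarrow> (nat \<Rightarrow> nat) \<Rightarrow> bool" where
  "irreducible_factorization q R p \<mu> \<longleftrightarrow>
     q = (\<Prod>r<R. p r ^ \<mu> r) \<and> inj_on p {..<R} \<and>
     (\<forall>r<R. irreducible (p r) \<and> lead_coeff (p r) = 1 \<and> 0 < \<mu> r)"

text \<open>\<open>S\<close> is partitioned into \<open>S = [S\<^sub>0 \<dots> S\<^sub>R\<^sub>-\<^sub>1]\<close> with \<open>S\<^sub>r = col_block S L r\<close>; to be used when
  the minimal polynomial of \<open>M\<close> is \<open>\<Prod>r<R. p r ^ \<mu> r\<close>.\<close>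

definition primary_decomposition ::
  "'a::field mat \<Rightarrow> nat \<Rightarrow> (nat \<Rightarrow> 'a poly) \<Rightarrow> (nat \<Rightarrow> nat) \<Rightarrow> (nat \<Rightarrow> nat)
     \<Rightarrow> 'a mat \<Rightarrow> (nat \<Rightarrow> 'a mat) \<Rightarrow> bool" where
  "primary_decomposition M R p \<mu> L S T \<longleftrightarrow>
     square_mat M \<and> S \<in> carrier_mat (dim_row M) (dim_row M) \<and> invertible_mat S \<and>
     (\<Sum>r<R. L r) = dim_row M \<and>
     M = S * diag_block_mat (map T [0..<R]) * inv_mat S \<and>
     (\<forall>r<R. T r \<in> carrier_mat (L r) (L r) \<and>
            M * col_block S L r = col_block S L r * T r \<and>
            distinct (cols (col_block S L r)) \<and>
            kernel.basis (dim_row M) (poly_mat (p r) M ^\<^sub>m \<mu> r) (set (cols (col_block S L r))))"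


section \<open>Tensors\<close>

definition tensor_indices :: "nat list \<Rightarrow> nat list set" where
  "tensor_indices ds = {ix. length ix = length ds \<and> (\<forall>k<length ds. ix ! k < ds ! k)}"

text \<open>A tensor consists of its list of dimensions and its entries, where, as for the type of
  matrices, the entries at indices that are out of range are normalised so that equality of
  tensors is equality of the dimensions and of all entries in range.\<close>

typedef 'a tensor =
  "{(ds :: nat list, f :: nat list \<Rightarrow> 'a). \<forall>ix. ix \<notin> tensor_indices ds \<longrightarrow> f ix = undefined}"
  by (rule exI[of _ "([], \<lambda>_. undefined)"]) simp

setup_lifting type_definition_tensor

lift_definition dims :: "'a tensor \<Rightarrow> nat list" is fst .

lift_definition entry :: "'a tensor \<Rightarrow> nat list \<Rightarrow> 'a" is snd .

lift_definition tensor :: "nat list \<Rightarrow> (nat list \<Rightarrow> 'a) \<Rightarrow> 'a tensor" is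
  "\<lambda>ds f. (ds, \<lambda>ix. if ix \<in> tensor_indices ds then f ix else undefined)"
  by simp

lemma dims_tensor [simp]: "dims (tensor ds f) = ds"
  by transfer simp

lemma entry_tensor [simp]: "ix \<in> tensor_indices ds \<Longrightarrow> entry (tensor ds f) ix = f ix"
  by transfer simp

lemma tensor_eqI:
  assumes "dims A = dims B" "\<And>ix. ix \<in> tensor_indices (dims B) \<Longrightarrow> entry A ix = entry B ix"
  shows "A = B"
  using assms by transfer (auto simp: fun_eq_iff, metis)

definition carrier_tensor :: "nat list \<Rightarrow> 'a tensor set" where
  "carrier_tensor ds = {A. dims A = ds}"

definition tensor_sum :: "nat list \<Rightarrow> nat \<Rightarrow> (nat \<Rightarrow> 'a::comm_monoid_add tensor) \<Rightarrow> 'a tensor" where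
  "tensor_sum ds R F = tensor ds (\<lambda>ix. \<Sum>r<R. entry (F r) ix)"

definition smult_tensor :: "'a::times \<Rightarrow> 'a tensor \<Rightarrow> 'a tensor" where
  "smult_tensor c A = tensor (dims A) (\<lambda>ix. c * entry A ix)"

text \<open>The row of the mode-\<open>n\<close> matrix representation that belongs to a multi-index.\<close>

definition row_pos :: "nat \<Rightarrow> nat list \<Rightarrow> nat list \<Rightarrow> nat" where
  "row_pos n ds ix = (\<Sum>k\<in>{..<length ds} - {n}. ix ! k * (\<Prod>l\<in>{..<k} - {n}. ds ! l))"

definition mode_mat :: "nat \<Rightarrow> 'a tensor \<Rightarrow> 'a mat" where
  "mode_mat n A =
     mat (\<Prod>k\<in>{..<length (dims A)} - {n}. dims A ! k) (dims A ! n)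
       (\<lambda>(i, j). entry A (THE ix. ix \<in> tensor_indices (dims A) \<and> row_pos n (dims A) ix = i \<and> ix ! n = j))"

text \<open>All mode-\<open>n\<close> fibers of \<open>D\<close> are multiplied by \<open>X\<close>.\<close>

definition mode_prod :: "nat \<Rightarrow> 'a::comm_semiring_0 tensor \<Rightarrow> 'a mat \<Rightarrow> 'a tensor" where
  "mode_prod n D X =
     tensor ((dims D)[n := dim_row X])
       (\<lambda>ix. \<Sum>l<dims D ! n. X $$ (ix ! n, l) * entry D (ix[n := l]))"

text \<open>Products in the first \<open>K\<close> modes, from left to right.\<close>

definition mode_prods :: "nat \<Rightarrow> 'a::comm_semiring_0 tensor \<Rightarrow> (nat \<Rightarrow> 'a mat) \<Rightarrow> 'a tensor" where
  "mode_prods K D X = fold (\<lambda>n C. mode_prod n C (X n)) [0..<K] D"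

definition has_ml_rank :: "nat \<Rightarrow> (nat \<Rightarrow> nat) \<Rightarrow> 'a::field tensor \<Rightarrow> bool" where
  "has_ml_rank K L A \<longleftrightarrow> (\<forall>n<K. mat_rank (mode_mat n A) = L n)"

text \<open>Mode \<open>n < K\<close> is partitioned into \<open>R\<close> blocks of the lengths \<open>L n 0, \<dots>, L n (R - 1)\<close>.\<close>

definition block_diagonal :: "nat \<Rightarrow> nat \<Rightarrow> (nat \<Rightarrow> nat \<Rightarrow> nat) \<Rightarrow> 'a::zero tensor \<Rightarrow> bool" where
  "block_diagonal K R L D \<longleftrightarrow>
     (\<forall>n<K. (\<Sum>r<R. L n r) = dims D ! n) \<and>
     (\<forall>ix\<in>tensor_indices (dims D).
        (\<nexists>r. r < R \<and> (\<forall>n<K. ix ! n \<in> block_range (L n) r)) \<longrightarrow> entry D ix = 0)"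

definition diagonal_block :: "nat \<Rightarrow> (nat \<Rightarrow> nat \<Rightarrow> nat) \<Rightarrow> nat \<Rightarrow> 'a tensor \<Rightarrow> 'a tensor" where
  "diagonal_block K L r D =
     tensor (map (\<lambda>n. if n < K then L n r else dims D ! n) [0..<length (dims D)])
       (\<lambda>ix. entry D (map (\<lambda>n. if n < K then offset (L n) r + ix ! n else ix ! n) [0..<length (dims D)]))"

text \<open>The slice in the modes \<open>i\<close> and \<open>j\<close> in which the other indices are fixed as in \<open>ix\<close>;
  the entries \<open>i\<close> and \<open>j\<close> of \<open>ix\<close> are irrelevant, so the multi-indices that are zero there
  enumerate the slices.\<close>

definition slice :: "nat \<Rightarrow> nat \<Rightarrow> nat list \<Rightarrow> 'a tensor \<Rightarrow> 'a mat" where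
  "slice i j ix A = mat (dims A ! i) (dims A ! j) (\<lambda>(a, b). entry A (ix[i := a, j := b]))"

definition slice_combination ::
  "nat \<Rightarrow> nat \<Rightarrow> (nat list \<Rightarrow> 'a::comm_semiring_1) \<Rightarrow> 'a tensor \<Rightarrow> 'a mat" where
  "slice_combination i j c A =
     mat (dims A ! i) (dims A ! j)
       (\<lambda>(a, b). \<Sum>ix | ix \<in> tensor_indices (dims A) \<and> ix ! i = 0 \<and> ix ! j = 0.
          c ix * slice i j ix A $$ (a, b))"


subsection \<open>The row positions enumerate the rows of the mode matrices\<close>

definition mixed_radix :: "nat list \<Rightarrow> nat list \<Rightarrow> nat" where
  "mixed_radix ds ix = (\<Sum>k<length ds. ix ! k * (\<Prod>l<k. ds ! l))"

lemma mixed_radix_Cons: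
  "mixed_radix (d # ds) (i # ix) = i + d * mixed_radix ds ix"
  unfolding mixed_radix_def
  by (simp add: sum.lessThan_Suc_shift prod.lessThan_Suc_shift sum_distrib_left ac_simps
      del: sum.lessThan_Suc prod.lessThan_Suc)

lemma tensor_indices_Nil [simp]: "tensor_indices [] = {[]}"
  by (auto simp: tensor_indices_def)

lemma tensor_indices_Cons:
  "ix \<in> tensor_indices (d # ds) \<longleftrightarrow> (\<exists>i js. ix = i # js \<and> i < d \<and> js \<in> tensor_indices ds)"
  by (cases ix) (auto simp: tensor_indices_def nth_Cons less_Suc_eq_0_disj split: nat.splits)

lemma mixed_radix_ex1:
  "x < prod_list ds \<Longrightarrow> \<exists>!ix. ix \<in> tensor_indices ds \<and> mixed_radix ds ix = x"
proof (induction ds arbitrary: x)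
  case Nil
  then show ?case by (auto simp: mixed_radix_def)
next
  case (Cons d ds)
  then have d: "d > 0" by (cases d) auto
  have "x div d < prod_list ds"
    using Cons.prems d by (simp add: less_mult_imp_div_less mult.commute)
  from Cons.IH[OF this] obtain js where js: "js \<in> tensor_indices ds" "mixed_radix ds js = x div d"
    and uni: "\<And>js'. js' \<in> tensor_indices ds \<Longrightarrow> mixed_radix ds js' = x div d \<Longrightarrow> js' = js" by blast
  show ?case
  proof (rule ex1I[of _ "(x mod d) # js"])
    show "x mod d # js \<in> tensor_indices (d # ds) \<and> mixed_radix (d # ds) (x mod d # js) = x"
      using js d by (simp add: tensor_indices_Cons mixed_radix_Cons)
  next
    fix ix assume *: "ix \<in> tensor_indices (d # ds) \<and> mixed_radix (d # ds) ix = x"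
    then obtain i js' where ix: "ix = i # js'" "i < d" "js' \<in> tensor_indices ds"
      by (auto simp: tensor_indices_Cons)
    with * have x: "x = i + d * mixed_radix ds js'" by (simp add: mixed_radix_Cons)
    then have "mixed_radix ds js' = x div d" "i = x mod d" using ix(2) by auto
    with ix uni show "ix = x mod d # js" by simp
  qed
qed

lemma mixed_radix_less: "ix \<in> tensor_indices ds \<Longrightarrow> mixed_radix ds ix < prod_list ds"
proof (induction ds arbitrary: ix)
  case Nil
  then show ?case by (auto simp: mixed_radix_def)
next
  case (Cons d ds)
  then obtain i js where ix: "ix = i # js" "i < d" "js \<in> tensor_indices ds"
    by (auto simp: tensor_indices_Cons)
  have "Suc (mixed_radix ds js) \<le> prod_list ds" using Cons.IH ix(3) by (simp add: Suc_le_eq)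
  then have "d * Suc (mixed_radix ds js) \<le> d * prod_list ds" by (rule mult_le_mono2)
  then show ?case using ix by (simp add: mixed_radix_Cons)
qed

lemma row_pos_mixed_radix:
  assumes "length ix = length ds" "n < length ds"
  shows "row_pos n ds ix = mixed_radix (ds[n := 1]) (ix[n := 0])"
proof -
  have P: "(\<Prod>l\<in>{..<k} - {n}. ds ! l) = (\<Prod>l<k. ds[n := 1] ! l)" if "k < length ds" for k
  proof -
    have "(\<Prod>l\<in>{..<k} - {n}. ds ! l) = (\<Prod>l\<in>{..<k} - {n}. ds[n := 1] ! l)"
      by (rule prod.cong) auto
    also have "\<dots> = (\<Prod>l<k. ds[n := 1] ! l)"
      using assms by (intro prod.mono_neutral_left) auto
    finally show ?thesis .
  qed
  have "row_pos n ds ix = (\<Sum>k\<in>{..<length ds} - {n}. ix[n := 0] ! k * (\<Prod>l<k. ds[n := 1] ! l))"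
    unfolding row_pos_def by (rule sum.cong) (auto simp: P)
  also have "\<dots> = mixed_radix (ds[n := 1]) (ix[n := 0])"
    unfolding mixed_radix_def using assms by (intro sum.mono_neutral_left) auto
  finally show ?thesis .
qed

lemma row_pos_bound:
  assumes "n < length ds"
  shows "(\<Prod>k\<in>{..<length ds} - {n}. ds ! k) = prod_list (ds[n := 1])"
proof -
  have "(\<Prod>k\<in>{..<length ds} - {n}. ds ! k) = (\<Prod>k\<in>{..<length ds} - {n}. ds[n := 1] ! k)"
    by (rule prod.cong) auto
  also have "\<dots> = (\<Prod>k<length ds. ds[n := 1] ! k)"
    using assms by (intro prod.mono_neutral_left) auto
  finally show ?thesis
    by (simp add: prod.list_conv_set_nth atLeast0LessThan)
qed

lemma tensor_indices_update:
  assumes "ix \<in> tensor_indices ds" "n < length ds" "j < d"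
  shows "ix[n := j] \<in> tensor_indices (ds[n := d])"
  using assms by (auto simp: tensor_indices_def nth_list_update)

lemma row_pos_ex1:
  assumes n: "n < length ds" and i: "i < (\<Prod>k\<in>{..<length ds} - {n}. ds ! k)" and j: "j < ds ! n"
  shows "\<exists>!ix. ix \<in> tensor_indices ds \<and> row_pos n ds ix = i \<and> ix ! n = j"
proof -
  from mixed_radix_ex1[OF i[unfolded row_pos_bound[OF n]]] obtain js where
    js: "js \<in> tensor_indices (ds[n := 1])" "mixed_radix (ds[n := 1]) js = i"
    and uni: "\<And>js'. js' \<in> tensor_indices (ds[n := 1]) \<Longrightarrow> mixed_radix (ds[n := 1]) js' = i \<Longrightarrow> js' = js"
    by blast
  from js n have "js ! n < 1" by (auto simp: tensor_indices_def)
  then have js0: "js[n := 0] = js" by (metis less_one list_update_id)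
  have len: "length js = length ds" using js by (simp add: tensor_indices_def)
  show ?thesis
  proof (rule ex1I[of _ "js[n := j]"])
    have "js[n := j] \<in> tensor_indices ds"
      using tensor_indices_update[OF js(1), of n j "ds ! n"] n j by simp
    then show "js[n := j] \<in> tensor_indices ds \<and> row_pos n ds (js[n := j]) = i \<and> js[n := j] ! n = j"
      using n len js js0 by (simp add: row_pos_mixed_radix)
  next
    fix ix assume *: "ix \<in> tensor_indices ds \<and> row_pos n ds ix = i \<and> ix ! n = j"
    then have l: "length ix = length ds" by (simp add: tensor_indices_def)
    have "ix[n := 0] = js"
      using * n l by (intro uni) (auto simp: row_pos_mixed_radix intro: tensor_indices_update)
    then show "ix = js[n := j]" using * by (metis list_update_id list_update_overwrite)
  qed
qed

lemma row_pos_less: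
  assumes "n < length ds" "ix \<in> tensor_indices ds"
  shows "row_pos n ds ix < (\<Prod>k\<in>{..<length ds} - {n}. ds ! k)"
proof -
  have "ix[n := 0] \<in> tensor_indices (ds[n := 1])"
    using assms by (intro tensor_indices_update) auto
  from mixed_radix_less[OF this] show ?thesis
    using assms by (simp add: row_pos_mixed_radix row_pos_bound tensor_indices_def)
qed

lemma mode_mat_entry:
  assumes "n < length (dims A)" "ix \<in> tensor_indices (dims A)"
  shows "mode_mat n A $$ (row_pos n (dims A) ix, ix ! n) = entry A ix"
proof -
  have j: "ix ! n < dims A ! n" using assms by (auto simp: tensor_indices_def)
  note i = row_pos_less[OF assms]
  have "(THE js. js \<in> tensor_indices (dims A) \<and> row_pos n (dims A) js = row_pos n (dims A) ix
      \<and> js ! n = ix ! n) = ix"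
    using row_pos_ex1[OF assms(1) i j] assms(2) by (intro the1_equality) auto
  then show ?thesis using i j by (simp add: mode_mat_def)
qed

lemma row_pos_update:
  "row_pos n (ds[n := d]) (ix[n := j]) = row_pos n ds ix"
proof -
  have "(\<Prod>l\<in>{..<k} - {n}. ds[n := d] ! l) = (\<Prod>l\<in>{..<k} - {n}. ds ! l)" for k
    by (rule prod.cong) auto
  then show ?thesis unfolding row_pos_def by (intro sum.cong) auto
qed

text \<open>The mode product is the tensor that is determined by its mode-\<open>n\<close> matrix representation.\<close>

lemma mode_mat_mode_prod:
  assumes n: "n < length (dims D)" and X: "X \<in> carrier_mat d (dims D ! n)"
  shows "mode_mat n (mode_prod n D X) = mode_mat n D * transpose_mat X"
proof (rule eq_matI)
  have P: "(\<Prod>k\<in>{..<length (dims D)} - {n}. (dims D)[n := d] ! k) =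
      (\<Prod>k\<in>{..<length (dims D)} - {n}. dims D ! k)"
    by (rule prod.cong) auto
  show dr: "dim_row (mode_mat n (mode_prod n D X)) = dim_row (mode_mat n D * transpose_mat X)"
    using X P by (simp add: mode_mat_def mode_prod_def)
  show dc: "dim_col (mode_mat n (mode_prod n D X)) = dim_col (mode_mat n D * transpose_mat X)"
    using X n by (simp add: mode_mat_def mode_prod_def)
  fix i j assume "i < dim_row (mode_mat n D * transpose_mat X)" "j < dim_col (mode_mat n D * transpose_mat X)"
  then have i: "i < (\<Prod>k\<in>{..<length (dims D)} - {n}. dims D ! k)" and j: "j < d"
    using X by (auto simp: mode_mat_def)
  have "i < (\<Prod>k\<in>{..<length ((dims D)[n := d])} - {n}. (dims D)[n := d] ! k)"
    using i P by simp
  from row_pos_ex1[OF _ this, of j] obtain ix where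
    is1: "ix \<in> tensor_indices ((dims D)[n := d])" "row_pos n ((dims D)[n := d]) ix = i" "ix ! n = j"
    using n j by auto
  have dm: "dims (mode_prod n D X) = (dims D)[n := d]" using X by (simp add: mode_prod_def)
  have "mode_mat n (mode_prod n D X) $$ (i, j) = entry (mode_prod n D X) ix"
    using mode_mat_entry[of n "mode_prod n D X" ix] n is1 dm by simp
  also have "\<dots> = (\<Sum>l<dims D ! n. X $$ (j, l) * entry D (ix[n := l]))"
    using is1 X by (simp add: mode_prod_def)
  also have "\<dots> = (\<Sum>l<dims D ! n. mode_mat n D $$ (i, l) * X $$ (j, l))"
  proof (rule sum.cong)
    fix l assume l: "l \<in> {..<dims D ! n}"
    have "ix[n := l] \<in> tensor_indices (dims D)"
      using tensor_indices_update[OF is1(1), of n l "dims D ! n"] n l by simp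
    from mode_mat_entry[OF n this]
    have "mode_mat n D $$ (row_pos n (dims D) (ix[n := l]), l) = entry D (ix[n := l])"
      using is1 n by (simp add: tensor_indices_def)
    moreover have "row_pos n (dims D) (ix[n := l]) = i"
      using row_pos_update[of n "(dims D)[n := d]" "dims D ! n" ix l] is1 by simp
    ultimately show "X $$ (j, l) * entry D (ix[n := l]) = mode_mat n D $$ (i, l) * X $$ (j, l)"
      by (simp add: mult.commute)
  qed simp
  also have "\<dots> = (mode_mat n D * transpose_mat X) $$ (i, j)"
    using i j X by (simp add: scalar_prod_def mode_mat_def atLeast0LessThan)
  finally show "mode_mat n (mode_prod n D X) $$ (i, j) = (mode_mat n D * transpose_mat X) $$ (i, j)" .
qed

end

theory Submission
  imports Defs "Jordan_Normal_Form.Jordan_Normal_Form_Existence"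
begin

text \<open>
  The hypothesis says that \<open>A \<bullet>\<^sub>n M\<^sub>n\<^sup>T = B\<close> for every \<open>n\<close>. Since products in different modes
  commute, \<open>A \<bullet>\<^sub>n f(M\<^sub>n)\<^sup>T\<close> does not depend on \<open>n\<close> for any polynomial \<open>f\<close>, and since the mode
  matrices have full column rank, \<open>f\<close> annihilates either all \<open>M\<^sub>n\<close> or none. If \<open>f\<^sub>r\<close> is congruent to \<open>1\<close>
  modulo \<open>p\<^sub>r\<^sup>\<mu>\<close> and to \<open>0\<close> modulo the other primary factors, then \<open>f\<^sub>r(M\<^sub>n)\<close> is the projection onto
  the \<open>r\<close>th primary component, and applying it in one mode amounts to applying it in all modes.
  Hence the \<open>r\<close>th term of the decomposition is \<open>A\<^sub>r = A \<bullet>\<^sub>n f\<^sub>r(M\<^sub>n)\<^sup>T\<close>, with any \<open>n\<close>, and likewise for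
  \<open>B\<close>; all the statements about the terms follow. For the slices, \<open>M\<^sub>i\<^sup>T C = C M\<^sub>j\<close> for every
  combination \<open>C\<close>, and a matrix is similar to its transpose.\<close>

section \<open>Polynomials of matrices\<close>

text \<open>Index blocks would force computations with multi-indices everywhere. They are avoided by
  inclusion matrices \<open>P_r\<close>: cutting out a block is a mode product with
  \<open>P_r^T\<close>, so the \<open>D_r\<close> and the terms \<open>A_r\<close>,
  \<open>B_r\<close> are mode products of \<open>A\<close> or \<open>B\<close>, and the comparisons
  become matrix identities in a single mode. With \<open>U_r = S_n P_r\<close> and
  \<open>V_r = P_r^T S_n^-1\<close> these are \<open>V_r U_r = 1\<close>,
  \<open>M_n U_r = U_r T_r\<close> and \<open>f_r(M_n) = U_r V_r\<close>. Block-diagonality is the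
  independence of the mode, seen in the coordinates given by the \<open>S_n\<close>: clearing
  everything outside block \<open>r\<close> gives the same tensor in every mode, so an entry whose
  indices lie in different blocks is both kept and cleared. The mode-\<open>n\<close> matrix of
  \<open>B_r\<close> factors through \<open>T_nr\<close>, hence its rank drops when
  \<open>T_nr\<close> is singular, which happens exactly for \<open>p_r = x\<close>. This is why the
  rank of \<open>B_r\<close> is exact for invertible \<open>T_nr\<close> and bounded in general.
  Similarity to the transpose comes from the Jordan normal form over the complex numbers, so the
  real case needs a descent.\<close>

lemma poly_mat_0 [simp]: "poly_mat 0 M = 0\<^sub>m (dim_row M) (dim_row M)"
  by (simp add: poly_mat_def)

lemma poly_mat_pCons:
  assumes M: "M \<in> carrier_mat n n"
  shows "poly_mat (pCons a p) M = a \<cdot>\<^sub>m 1\<^sub>m n + M * poly_mat p M"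
proof (cases "p = 0 \<and> a = 0")
  case True
  then show ?thesis using M by auto
next
  case False
  then show ?thesis using M by (auto simp: poly_mat_def)
qed

lemma poly_mat_carrier:
  assumes M: "M \<in> carrier_mat n n"
  shows "poly_mat p M \<in> carrier_mat n n"
proof (induction p)
  case 0
  then show ?case using M by simp
next
  case (pCons a p)
  then show ?case using M by (simp add: poly_mat_pCons[OF M])
qed

lemma poly_mat_add:
  assumes M: "M \<in> carrier_mat n n"
  shows "poly_mat (p + q) M = poly_mat p M + poly_mat q M"
proof (induction p arbitrary: q)
  case 0
  then show ?case using M poly_mat_carrier[OF M, of q] by (simp add: left_add_zero_mat)
next
  case (pCons a p)
  note car = poly_mat_carrier[OF M]
  obtain b q' where q: "q = pCons b q'" by (cases q) auto
  have "poly_mat (pCons a p + q) M = (a + b) \<cdot>\<^sub>m 1\<^sub>m n + M * (poly_mat p M + poly_mat q' M)"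
    by (simp add: q poly_mat_pCons[OF M] pCons.IH)
  also have "M * (poly_mat p M + poly_mat q' M) = M * poly_mat p M + M * poly_mat q' M"
    by (rule mult_add_distrib_mat[OF M car car])
  also have "(a + b) \<cdot>\<^sub>m 1\<^sub>m n + (M * poly_mat p M + M * poly_mat q' M) =
      (a \<cdot>\<^sub>m 1\<^sub>m n + M * poly_mat p M) + (b \<cdot>\<^sub>m 1\<^sub>m n + M * poly_mat q' M)"
    using M car[of p] car[of q'] by (intro eq_matI) (auto simp: algebra_simps)
  finally show ?case by (simp add: q poly_mat_pCons[OF M])
qed

lemma poly_mat_1 [simp]: "M \<in> carrier_mat n n \<Longrightarrow> poly_mat 1 M = 1\<^sub>m n"
  unfolding one_pCons by (subst poly_mat_pCons) auto

lemma poly_mat_smult: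
  assumes M: "M \<in> carrier_mat n n"
  shows "poly_mat (smult c p) M = c \<cdot>\<^sub>m poly_mat p M"
proof (induction p)
  case 0
  then show ?case using M by simp
next
  case (pCons a p)
  note car = poly_mat_carrier[OF M]
  have "poly_mat (smult c (pCons a p)) M = (c * a) \<cdot>\<^sub>m 1\<^sub>m n + M * (c \<cdot>\<^sub>m poly_mat p M)"
    by (simp add: poly_mat_pCons[OF M] pCons.IH)
  also have "\<dots> = c \<cdot>\<^sub>m (a \<cdot>\<^sub>m 1\<^sub>m n + M * poly_mat p M)"
    unfolding mult_smult_distrib[OF M car]
    using M car[of p] by (intro eq_matI) (auto simp: algebra_simps)
  finally show ?case by (simp add: poly_mat_pCons[OF M])
qed

text \<open>The intertwiner \<open>S\<close> may have any shape. With \<open>S = M\<close> this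
  shows that polynomials of \<open>M\<close> commute with \<open>M\<close>; with \<open>S\<close> a
  basis of an invariant subspace it restricts \<open>p(M)\<close> to that subspace; with
  \<open>S\<close> invertible it carries \<open>p\<close> across a similarity.\<close>

lemma poly_mat_intertwine:
  assumes M: "M \<in> carrier_mat n n" and T: "T \<in> carrier_mat m m" and S: "S \<in> carrier_mat n m"
    and eq: "M * S = S * T"
  shows "poly_mat p M * S = S * poly_mat p T"
proof (induction p)
  case 0
  then show ?case using M T S by simp
next
  case (pCons a p)
  note carM = poly_mat_carrier[OF M, of p] and carT = poly_mat_carrier[OF T, of p]
  have "poly_mat (pCons a p) M * S = (a \<cdot>\<^sub>m 1\<^sub>m n) * S + M * poly_mat p M * S"
    unfolding poly_mat_pCons[OF M] using M S carM by (intro add_mult_distrib_mat) auto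
  also have "M * poly_mat p M * S = M * (S * poly_mat p T)"
    by (simp add: assoc_mult_mat[OF M carM S] pCons.IH)
  also have "\<dots> = S * T * poly_mat p T"
    by (simp add: assoc_mult_mat[OF M S carT, symmetric] eq)
  also have "\<dots> = S * (T * poly_mat p T)" by (rule assoc_mult_mat[OF S T carT])
  also have "(a \<cdot>\<^sub>m 1\<^sub>m n) * S = S * (a \<cdot>\<^sub>m 1\<^sub>m m)"
    using S by (simp add: mult_smult_assoc_mat[of _ n n _ m] mult_smult_distrib[of _ n m _ m])
  also have "S * (a \<cdot>\<^sub>m 1\<^sub>m m) + S * (T * poly_mat p T) = S * poly_mat (pCons a p) T"
    unfolding poly_mat_pCons[OF T] using S T carT by (intro mult_add_distrib_mat[symmetric]) auto
  finally show ?case .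
qed

lemma poly_mat_commute:
  assumes M: "M \<in> carrier_mat n n"
  shows "poly_mat p M * M = M * poly_mat p M"
  by (rule poly_mat_intertwine[OF M M M refl])

lemma poly_mat_mult:
  assumes M: "M \<in> carrier_mat n n"
  shows "poly_mat (p * q) M = poly_mat p M * poly_mat q M"
proof (induction p)
  case 0
  then show ?case using M poly_mat_carrier[OF M, of q] by simp
next
  case (pCons a p)
  note car = poly_mat_carrier[OF M]
  have z: "0 \<cdot>\<^sub>m 1\<^sub>m n + X = X" if "X \<in> carrier_mat n n" for X :: "'a mat"
    using that by (intro eq_matI) auto
  have "poly_mat (pCons a p * q) M = a \<cdot>\<^sub>m poly_mat q M + M * (poly_mat p M * poly_mat q M)"
    using M car[of p] car[of q]
    by (simp add: poly_mat_add[OF M] poly_mat_smult[OF M] poly_mat_pCons[OF M, of 0] pCons.IH z)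
  also have "M * (poly_mat p M * poly_mat q M) = M * poly_mat p M * poly_mat q M"
    by (rule assoc_mult_mat[OF M car car, symmetric])
  also have "a \<cdot>\<^sub>m poly_mat q M = (a \<cdot>\<^sub>m 1\<^sub>m n) * poly_mat q M"
    using car[of q] by (simp add: mult_smult_assoc_mat[of _ n n _ n])
  also have "\<dots> + M * poly_mat p M * poly_mat q M = poly_mat (pCons a p) M * poly_mat q M"
    unfolding poly_mat_pCons[OF M] using M car[of p] car[of q]
    by (intro add_mult_distrib_mat[symmetric]) auto
  finally show ?case .
qed

lemma poly_mat_power:
  assumes M: "M \<in> carrier_mat n n"
  shows "poly_mat (p ^ k) M = poly_mat p M ^\<^sub>m k"
proof (induction k)
  case 0
  then show ?case using M poly_mat_carrier[OF M, of p] by simp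
next
  case (Suc k)
  then show ?case by (simp add: power_Suc2 poly_mat_mult[OF M] del: power_Suc)
qed

lemma poly_mat_diff:
  assumes M: "M \<in> carrier_mat n n"
  shows "poly_mat (p - q) M = poly_mat p M - poly_mat q M"
proof -
  have "poly_mat p M = poly_mat (p - q) M + poly_mat q M"
    using poly_mat_add[OF M, of "p - q" q] by simp
  then show ?thesis
    using poly_mat_carrier[OF M, of "p - q"] poly_mat_carrier[OF M, of q]
    by (intro eq_matI) auto
qed

lemma poly_mat_dvd_zero:
  assumes M: "M \<in> carrier_mat n n" and "p dvd q" "poly_mat p M = 0\<^sub>m n n"
  shows "poly_mat q M = 0\<^sub>m n n"
proof -
  obtain h where "q = p * h" using assms(2) by blast
  then show ?thesis
    using assms(3) poly_mat_carrier[OF M, of h] by (simp add: poly_mat_mult[OF M])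
qed

text \<open>The bound \<open>d\<close> may exceed the degree: the induction lowers it by one, and
  the search for an annihilating polynomial fixes the number of coefficients in advance.\<close>

lemma poly_mat_index:
  assumes M: "M \<in> carrier_mat n n" and ij: "i < n" "j < n" and "degree p \<le> d"
  shows "poly_mat p M $$ (i, j) = (\<Sum>k\<le>d. coeff p k * (M ^\<^sub>m k) $$ (i, j))"
  using ij \<open>degree p \<le> d\<close>
proof (induction p arbitrary: i j d)
  case 0
  then show ?case using M by simp
next
  case (pCons a p)
  note car = poly_mat_carrier[OF M, of p]
  have pw: "M ^\<^sub>m k \<in> carrier_mat n n" for k using M by simp
  have "(\<Sum>k\<le>d. coeff (pCons a p) k * (M ^\<^sub>m k) $$ (i, j)) =
      a * (1\<^sub>m n) $$ (i, j) + (\<Sum>k\<le>d - 1. coeff p k * (M ^\<^sub>m Suc k) $$ (i, j))"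
  proof (cases d)
    case 0
    \<comment> \<open>With \<open>p = 0\<close> the shifted sum vanishes, although
      \<open>d - 1\<close> truncates to \<open>0\<close> and leaves the term for
      \<open>k = 0\<close>.\<close>
    then have "p = 0" using pCons.prems by (auto split: if_splits)
    then show ?thesis using M 0 by simp
  next
    case (Suc d')
    then show ?thesis using M by (simp only: sum.atMost_Suc_shift) simp
  qed
  also have "(\<Sum>k\<le>d - 1. coeff p k * (M ^\<^sub>m Suc k) $$ (i, j)) =
      (\<Sum>k\<le>d - 1. \<Sum>l<n. coeff p k * (M ^\<^sub>m k) $$ (i, l) * M $$ (l, j))"
    using pw M pCons.prems(1,2)
    by (intro sum.cong) (simp_all add: scalar_prod_def sum_distrib_left mult.assoc lessThan_atLeast0
      carrier_matD[OF pw])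
  also have "\<dots> = (\<Sum>l<n. (\<Sum>k\<le>d - 1. coeff p k * (M ^\<^sub>m k) $$ (i, l)) * M $$ (l, j))"
    by (subst sum.swap) (simp add: sum_distrib_right)
  also have "\<dots> = (\<Sum>l<n. poly_mat p M $$ (i, l) * M $$ (l, j))"
    using pCons.prems pCons.IH[of i _ "d - 1"] by (intro sum.cong) (auto split: if_splits)
  also have "\<dots> = (poly_mat p M * M) $$ (i, j)"
    using M car pCons.prems(1,2) by (simp add: scalar_prod_def lessThan_atLeast0)
  finally show ?case
    using car M pCons.prems(1,2) by (simp add: poly_mat_pCons[OF M] poly_mat_commute[OF M])
qed

section \<open>Minimal polynomials and their factors\<close>

text \<open>The \<open>n * n + 1\<close> powers \<open>M^0, ..., M^(n * n)\<close> lie in a space of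
  dimension \<open>n * n\<close>. They are the columns of \<open>Q\<close>, with entry
  \<open>(i, j)\<close> in row \<open>i * n + j\<close>; an additional zero row makes
  \<open>Q\<close> square and singular, and a vector in its kernel consists of the coefficients of
  an annihilating polynomial.\<close>

lemma annihilating_poly_exists:
  assumes M: "(M :: 'a :: field mat) \<in> carrier_mat n n"
  shows "\<exists>f. f \<noteq> 0 \<and> poly_mat f M = 0\<^sub>m n n"
proof -
  define d where "d = n * n"
  define Q where "Q = mat (Suc d) (Suc d)
    (\<lambda>(r, k). if r < d then (M ^\<^sub>m k) $$ (r div n, r mod n) else 0)"
  have Q: "Q \<in> carrier_mat (Suc d) (Suc d)" by (simp add: Q_def)
  then have QT: "transpose_mat Q \<in> carrier_mat (Suc d) (Suc d)" by simp
  have "transpose_mat Q *\<^sub>v unit_vec (Suc d) d = 0\<^sub>v (Suc d)"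
    by (intro eq_vecI) (auto simp: Q_def)
  moreover have "unit_vec (Suc d) d \<noteq> (0\<^sub>v (Suc d) :: 'a vec)"
    by (rule unit_vec_nonzero) simp
  ultimately have "det (transpose_mat Q) = 0"
    unfolding det_0_iff_vec_prod_zero_field[OF QT] by (intro exI[of _ "unit_vec (Suc d) d"]) simp
  then have "det Q = 0" using det_transpose[OF Q] by simp
  then obtain v where v: "v \<in> carrier_vec (Suc d)" "v \<noteq> 0\<^sub>v (Suc d)" "Q *\<^sub>v v = 0\<^sub>v (Suc d)"
    unfolding det_0_iff_vec_prod_zero_field[OF Q] by blast
  define f where "f = (\<Sum>k\<le>d. monom (v $ k) k)"
  have cf: "coeff f k = (if k \<le> d then v $ k else 0)" for k
    by (simp add: f_def coeff_sum)
  have "degree f \<le> d" by (rule degree_le) (simp add: cf)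
  have "f \<noteq> 0"
  proof
    assume "f = 0"
    then have "v $ k = 0" if "k \<le> d" for k using cf[of k] that by simp
    then have "v = 0\<^sub>v (Suc d)" using v(1) by (intro eq_vecI) auto
    with v(2) show False by simp
  qed
  moreover have "poly_mat f M = 0\<^sub>m n n"
  proof (rule eq_matI)
    fix i j assume "i < dim_row (0\<^sub>m n n :: 'a mat)" "j < dim_col (0\<^sub>m n n :: 'a mat)"
    then have ij: "i < n" "j < n" by auto
    let ?r = "i * n + j"
    have "Suc i * n \<le> n * n" using ij by (intro mult_le_mono1) simp
    then have r: "?r < d" using ij by (simp add: d_def)
    have "0 = (Q *\<^sub>v v) $ ?r" using v(3) r by simp
    also have "\<dots> = (\<Sum>k\<le>d. Q $$ (?r, k) * v $ k)"
      using r Q v(1) by (simp add: scalar_prod_def atLeast0LessThan lessThan_Suc_atMost)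
    also have "\<dots> = (\<Sum>k\<le>d. coeff f k * (M ^\<^sub>m k) $$ (i, j))"
      using r ij by (intro sum.cong) (auto simp: Q_def cf)
    also have "\<dots> = poly_mat f M $$ (i, j)"
      by (rule poly_mat_index[OF M ij \<open>degree f \<le> d\<close>, symmetric])
    finally show "poly_mat f M $$ (i, j) = 0\<^sub>m n n $$ (i, j)" using ij by simp
  qed (use poly_mat_carrier[OF M, of f] in auto)
  ultimately show ?thesis by blast
qed

lemma minimal_polynomial_exists:
  assumes M: "(M :: 'a :: field mat) \<in> carrier_mat n n"
  shows "\<exists>q. minimal_polynomial M q"
proof -
  let ?P = "\<lambda>q. lead_coeff q = 1 \<and> poly_mat q M = 0\<^sub>m n n"
  obtain f where f: "f \<noteq> 0" "poly_mat f M = 0\<^sub>m n n"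
    using annihilating_poly_exists[OF M] by blast
  then have "?P (smult (inverse (lead_coeff f)) f)"
    by (auto simp: poly_mat_smult[OF M])
  then obtain q where "?P q" "\<forall>g. ?P g \<longrightarrow> degree q \<le> degree g"
    using ex_has_least_nat[of ?P _ degree] by blast
  then show ?thesis using M unfolding minimal_polynomial_def by auto
qed

text \<open>For the divisibility: a nonzero remainder of \<open>f\<close> modulo \<open>q\<close>
  would annihilate \<open>M\<close> as well and, made monic, would have smaller degree than
  \<open>q\<close>.\<close>

lemma minimal_polynomialD:
  assumes M: "(M :: 'a :: field mat) \<in> carrier_mat n n" and q: "minimal_polynomial M q"
  shows "poly_mat q M = 0\<^sub>m n n" "lead_coeff q = 1"
    "\<And>f. poly_mat f M = 0\<^sub>m n n \<Longrightarrow> q dvd f"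
proof -
  show qM: "poly_mat q M = 0\<^sub>m n n" and "lead_coeff q = 1"
    using q M unfolding minimal_polynomial_def by auto
  fix f assume f: "poly_mat f M = 0\<^sub>m n n"
  define r where "r = f mod q"
  have "poly_mat (f div q * q) M = 0\<^sub>m n n"
    using poly_mat_dvd_zero[OF M _ qM] by simp
  then have rM: "poly_mat r M = 0\<^sub>m n n"
    using f unfolding r_def minus_div_mult_eq_mod[symmetric] by (simp add: poly_mat_diff[OF M])
  have "r = 0"
  proof (rule ccontr)
    assume r: "r \<noteq> 0"
    have "q \<noteq> 0" using \<open>lead_coeff q = 1\<close> by auto
    then have "degree r < degree q" using degree_mod_less[of q f] r by (simp add: r_def)
    moreover define g where "g = smult (inverse (lead_coeff r)) r"
    have "poly_mat g M = 0\<^sub>m n n" "lead_coeff g = 1"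
      using r rM by (simp_all add: g_def poly_mat_smult[OF M])
    then have "degree q \<le> degree g"
      using q M unfolding minimal_polynomial_def by auto
    then have "degree q \<le> degree r" using r by (simp add: g_def)
    ultimately show False using r by simp
  qed
  then show "q dvd f" unfolding r_def by (simp add: mod_eq_0_iff_dvd)
qed

lemma minimal_polynomialI:
  assumes M: "(M :: 'a :: field mat) \<in> carrier_mat n n" and q: "lead_coeff q = 1" "poly_mat q M = 0\<^sub>m n n"
    and "\<And>f. poly_mat f M = 0\<^sub>m n n \<Longrightarrow> q dvd f"
  shows "minimal_polynomial M q"
  unfolding minimal_polynomial_def using assms
  by (auto intro!: dvd_imp_degree_le)

section \<open>Comaximal polynomials and Chinese remaindering\<close>

definition comaximal :: "'a::comm_ring_1 \<Rightarrow> 'a \<Rightarrow> bool" where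
  "comaximal a b \<longleftrightarrow> (\<exists>u v. u * a + v * b = 1)"

lemma comaximal_sym: "comaximal a b \<Longrightarrow> comaximal b a"
  unfolding comaximal_def by (metis add.commute)

lemma comaximal_mult:
  assumes "comaximal a b" "comaximal a c"
  shows "comaximal a (b * c)"
proof -
  obtain u v u' v' where "u * a + v * b = 1" "u' * a + v' * c = 1"
    using assms unfolding comaximal_def by blast
  then have "1 = (u * a + v * b) * (u' * a + v' * c)" by simp
  also have "\<dots> = (u * u' * a + u * v' * c + v * b * u') * a + (v * v') * (b * c)"
    by (simp add: algebra_simps)
  finally show ?thesis unfolding comaximal_def by metis
qed

lemma comaximal_prod:
  "(\<And>s. s \<in> A \<Longrightarrow> comaximal a (f s)) \<Longrightarrow> comaximal a (\<Prod>s\<in>A. f s)"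
proof (induction A rule: infinite_finite_induct)
  case (insert s A)
  then show ?case by (simp add: comaximal_mult)
qed (auto simp: comaximal_def intro: exI[of _ 0] exI[of _ 1])

lemma comaximal_power: "comaximal a b \<Longrightarrow> comaximal a (b ^ k)"
  using comaximal_prod[of "{..<k}" a "\<lambda>_. b"] by simp

text \<open>Multiply \<open>u * a + v * b = 1\<close> by \<open>c\<close>: both summands become
  multiples of \<open>a * b\<close>.\<close>

lemma comaximal_mult_dvd:
  assumes "comaximal a b" "a dvd c" "b dvd c"
  shows "a * b dvd c"
proof -
  obtain u v where uv: "u * a + v * b = 1" using assms(1) unfolding comaximal_def by blast
  have "c = u * a * c + v * b * c" using uv by (metis distrib_right mult_1)
  moreover have "a * b dvd u * a * c" using assms(3) by (simp add: mult.assoc mult_dvd_mono)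
  moreover have "a * b dvd v * b * c"
    using mult_dvd_mono[OF dvd_refl[of b] assms(2)] by (simp add: mult.assoc mult.commute[of a])
  ultimately show ?thesis by (metis dvd_add)
qed

lemma comaximal_prod_dvd:
  assumes "finite A" "\<And>s t. s \<in> A \<Longrightarrow> t \<in> A \<Longrightarrow> s \<noteq> t \<Longrightarrow> comaximal (f s) (f t)"
    and "\<And>s. s \<in> A \<Longrightarrow> f s dvd c"
  shows "(\<Prod>s\<in>A. f s) dvd c"
  using assms
proof (induction A rule: finite_induct)
  case (insert s A)
  have "comaximal (f s) (\<Prod>s\<in>A. f s)"
    using insert by (intro comaximal_prod) auto
  then have "f s * (\<Prod>s\<in>A. f s) dvd c"
    using insert by (intro comaximal_mult_dvd) auto
  then show ?case using insert by simp
qed simp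

text \<open>Euclid's algorithm: the pair \<open>b\<close>, \<open>a mod b\<close> has the same
  common divisors, and its Bezout coefficients yield those of \<open>a\<close>, \<open>b\<close>.
  The measure places \<open>b = 0\<close> below the nonzero constants, whose degree is also
  \<open>0\<close>.\<close>

lemma comaximal_polyI:
  fixes a b :: "'a::field poly"
  assumes "\<And>c. c dvd a \<Longrightarrow> c dvd b \<Longrightarrow> is_unit c"
  shows "comaximal a b"
  using assms
proof (induction "if b = 0 then 0 else Suc (degree b)" arbitrary: a b rule: less_induct)
  case less
  show ?case
  proof (cases "b = 0")
    case True
    then have "is_unit a" using less.prems[of a] by simp
    then show ?thesis unfolding comaximal_def by (metis True dvd_def mult.commute add.right_neutral mult_zero_right)
  next
    case False
    have "(if a mod b = 0 then 0 else Suc (degree (a mod b))) < Suc (degree b)"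
      using degree_mod_less[OF False, of a] by auto
    moreover have "is_unit c" if "c dvd b" "c dvd a mod b" for c
      using less.prems[of c] that by (simp add: dvd_mod_iff)
    ultimately have "comaximal b (a mod b)"
      using False by (intro less.hyps) auto
    then obtain u v where "u * b + v * (a mod b) = 1" unfolding comaximal_def by blast
    then have "v * a + (u - v * (a div b)) * b = 1"
      by (simp add: minus_div_mult_eq_mod[symmetric] algebra_simps)
    then show ?thesis unfolding comaximal_def by blast
  qed
qed

text \<open>A common divisor of \<open>p r\<close> and \<open>p s\<close> that is not a unit is
  associated to both; then they divide each other and, being monic, coincide. Comaximality passes to
  powers.\<close>

lemma irreducible_factorization_comaximal:
  fixes p :: "nat \<Rightarrow> 'a::field poly"
  assumes "irreducible_factorization q R p \<mu>" "r < R" "s < R" "r \<noteq> s"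
  shows "comaximal (p r ^ \<mu> r) (p s ^ \<mu> s)"
proof -
  have irr: "irreducible (p r)" "irreducible (p s)" "lead_coeff (p r) = 1" "lead_coeff (p s) = 1"
    and ne: "p r \<noteq> p s"
    using assms unfolding irreducible_factorization_def by (auto dest: inj_onD)
  have "comaximal (p r) (p s)"
  proof (rule comaximal_polyI)
    fix c assume c: "c dvd p r" "c dvd p s"
    show "is_unit c"
    proof (rule ccontr)
      assume nu: "\<not> is_unit c"
      have "p r dvd c" using irr(1) c(1) nu by (metis irreducibleD')
      then have "p r dvd p s" using c(2) by (rule dvd_trans)
      moreover have "p s dvd c" using irr(2) c(2) nu by (metis irreducibleD')
      then have "p s dvd p r" using c(1) by (rule dvd_trans)
      ultimately have "p r = p s" using irr(3,4) by (intro poly_dvd_antisym) auto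
      with ne show False by simp
    qed
  qed
  then show ?thesis by (metis comaximal_power comaximal_sym)
qed

text \<open>The values \<open>f r (M)\<close> are the projections onto the primary components of \<open>M\<close>.\<close>

lemma irreducible_factorization_idempotents:
  fixes p :: "nat \<Rightarrow> 'a::field poly"
  assumes fac: "irreducible_factorization q R p \<mu>"
  obtains f where "\<And>r. r < R \<Longrightarrow> p r ^ \<mu> r dvd f r - 1"
    "\<And>r s. r < R \<Longrightarrow> s < R \<Longrightarrow> r \<noteq> s \<Longrightarrow> p s ^ \<mu> s dvd f r"
    "q dvd (\<Sum>r<R. f r) - 1"
proof -
  note co = irreducible_factorization_comaximal[OF fac]
  have "\<exists>g. p r ^ \<mu> r dvd g - 1 \<and> (\<forall>s<R. r \<noteq> s \<longrightarrow> p s ^ \<mu> s dvd g)" if "r < R" for r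
  proof -
    \<comment> \<open>The summand \<open>v * ?h\<close> of the Bezout identity solves the
      congruences.\<close>
    let ?h = "\<Prod>s\<in>{..<R} - {r}. p s ^ \<mu> s"
    have "comaximal (p r ^ \<mu> r) ?h" using co that by (intro comaximal_prod) auto
    then obtain u v where uv: "u * p r ^ \<mu> r + v * ?h = 1" unfolding comaximal_def by blast
    have "v * ?h - 1 = - u * p r ^ \<mu> r" using uv by (simp add: algebra_simps)
    then have "p r ^ \<mu> r dvd v * ?h - 1" by simp
    moreover have "p s ^ \<mu> s dvd v * ?h" if "s < R" "r \<noteq> s" for s
    proof -
      have "p s ^ \<mu> s dvd ?h" using that by (intro dvd_prodI) auto
      then show ?thesis by simp
    qed
    ultimately show ?thesis by blast
  qed
  then obtain f where f: "\<And>r. r < R \<Longrightarrow> p r ^ \<mu> r dvd f r - 1"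
    "\<And>r s. r < R \<Longrightarrow> s < R \<Longrightarrow> r \<noteq> s \<Longrightarrow> p s ^ \<mu> s dvd f r" by metis
  have "(\<Prod>s<R. p s ^ \<mu> s) dvd (\<Sum>r<R. f r) - 1"
  proof (rule comaximal_prod_dvd)
    fix s assume "s \<in> {..<R}"
    then have s: "s < R" by simp
    \<comment> \<open>Modulo the \<open>s\<close>th factor every summand other than
      \<open>f s\<close> vanishes, and \<open>f s\<close> is \<open>1\<close>.\<close>
    have "(\<Sum>r<R. f r) - 1 = (f s - 1) + (\<Sum>r\<in>{..<R} - {s}. f r)"
      using s by (subst sum.remove[of _ s]) auto
    moreover have "p s ^ \<mu> s dvd (\<Sum>r\<in>{..<R} - {s}. f r)" using f(2) s by (intro dvd_sum) auto
    ultimately show "p s ^ \<mu> s dvd (\<Sum>r<R. f r) - 1" using f(1)[OF s] by (metis dvd_add)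
  qed (use co in auto)
  moreover have "q = (\<Prod>s<R. p s ^ \<mu> s)" using fac unfolding irreducible_factorization_def by simp
  ultimately show thesis using f that by metis
qed

section \<open>Similarity to the transpose\<close>

text \<open>\<open>invertible_mat\<close> does not prescribe the shape of the inverse; it is read
  off from the two products. Then \<open>A\<close> is a unit of the matrix ring, where
  \<open>mat_inverse\<close> succeeds.\<close>

lemma inv_mat:
  assumes A: "(A :: 'a::field mat) \<in> carrier_mat n n" and "invertible_mat A"
  shows "inv_mat A \<in> carrier_mat n n" "A * inv_mat A = 1\<^sub>m n" "inv_mat A * A = 1\<^sub>m n"
proof -
  from assms obtain B where B: "A * B = 1\<^sub>m n" "B * A = 1\<^sub>m (dim_row B)"
    unfolding invertible_mat_def inverts_mat_def by auto
  have "dim_row B = n" using arg_cong[OF B(2), of dim_col] A by simp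
  moreover have "dim_col B = n" using arg_cong[OF B(1), of dim_col] A by simp
  ultimately have "A \<in> Units (ring_mat TYPE('a) n ())"
    using A B unfolding Units_def ring_mat_def by auto
  then have "mat_inverse A \<noteq> None" using mat_inverse(1)[OF A, of "()"] by blast
  then obtain C where "mat_inverse A = Some C" by blast
  with mat_inverse(2)[OF A this]
  show "inv_mat A \<in> carrier_mat n n" "A * inv_mat A = 1\<^sub>m n" "inv_mat A * A = 1\<^sub>m n"
    unfolding inv_mat_def by auto
qed

lemma invertible_matI:
  assumes "A \<in> carrier_mat n n" "B \<in> carrier_mat n n" "A * B = 1\<^sub>m n" "B * A = 1\<^sub>m n"
  shows "invertible_mat A"
  using assms unfolding invertible_mat_def inverts_mat_def by auto

lemma invertible_mat_iff_det:
  assumes A: "(A :: 'a::field mat) \<in> carrier_mat n n"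
  shows "invertible_mat A \<longleftrightarrow> det A \<noteq> 0"
proof
  assume "invertible_mat A"
  from det_mult[OF A inv_mat(1)[OF A this]] inv_mat(2)[OF A this] show "det A \<noteq> 0" by auto
next
  assume "det A \<noteq> 0"
  from det_non_zero_imp_unit[OF A this, of "()"] show "invertible_mat A"
    unfolding Units_def ring_mat_def by (auto intro: invertible_matI[OF A])
qed

lemma similar_mat_intertwine:
  assumes A: "(A :: 'a::field mat) \<in> carrier_mat n n" and B: "B \<in> carrier_mat n n"
    and C: "C \<in> carrier_mat n n" "invertible_mat C" and eq: "A * C = C * B"
  shows "similar_mat A B"
proof (rule similar_matI)
  note i = inv_mat[OF C]
  show "{A, B, C, inv_mat C} \<subseteq> carrier_mat n n" using A B C i by auto
  show "C * inv_mat C = 1\<^sub>m n" "inv_mat C * C = 1\<^sub>m n" by fact+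
  have "C * B * inv_mat C = A * (C * inv_mat C)"
    unfolding eq[symmetric] by (rule assoc_mult_mat[OF A C(1) i(1)])
  then show "A = C * B * inv_mat C" using A i by simp
qed

text \<open>\<open>W\<close> is the exchange matrix: it reverses the rows from the left and the
  columns from the right, and it is its own inverse. Reversing both orders moves the superdiagonal
  of a Jordan block to the subdiagonal.\<close>

lemma similar_mat_jordan_block_transpose:
  "similar_mat (transpose_mat (jordan_block n a)) (jordan_block n (a :: 'a::field))"
proof -
  define W :: "'a mat" where "W = mat n n (\<lambda>(i, j). if j = n - 1 - i then 1 else 0)"
  have W: "W \<in> carrier_mat n n" by (simp add: W_def)
  have WX: "W * X = mat n n (\<lambda>(i, j). X $$ (n - 1 - i, j))" if "X \<in> carrier_mat n n" for X
  proof (rule eq_matI)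
    fix i j assume "i < dim_row (mat n n (\<lambda>(i, j). X $$ (n - 1 - i, j)))"
      "j < dim_col (mat n n (\<lambda>(i, j). X $$ (n - 1 - i, j)))"
    then have ij: "i < n" "j < n" by auto
    have "(W * X) $$ (i, j) = (\<Sum>k\<in>{0..<n}. (if k = n - 1 - i then X $$ (k, j) else 0))"
      using ij that
      by (simp add: W_def scalar_prod_def if_distrib[of "\<lambda>x. _ * x"] if_distrib[of "\<lambda>x. x * _"] cong: if_cong)
    then show "(W * X) $$ (i, j) = mat n n (\<lambda>(i, j). X $$ (n - 1 - i, j)) $$ (i, j)"
      using ij by simp
  qed (use W that in auto)
  have XW: "X * W = mat n n (\<lambda>(i, j). X $$ (i, n - 1 - j))" if "X \<in> carrier_mat n n" for X
  proof (rule eq_matI)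
    fix i j assume "i < dim_row (mat n n (\<lambda>(i, j). X $$ (i, n - 1 - j)))"
      "j < dim_col (mat n n (\<lambda>(i, j). X $$ (i, n - 1 - j)))"
    then have ij: "i < n" "j < n" by auto
    have "(X * W) $$ (i, j) = (\<Sum>k\<in>{0..<n}. X $$ (i, k) * (if j = n - 1 - k then 1 else 0))"
      using ij that by (simp add: W_def scalar_prod_def)
    also have "\<dots> = (\<Sum>k\<in>{0..<n}. (if k = n - 1 - j then X $$ (i, k) else 0))"
      using ij by (intro sum.cong) auto
    finally show "(X * W) $$ (i, j) = mat n n (\<lambda>(i, j). X $$ (i, n - 1 - j)) $$ (i, j)"
      using ij by simp
  qed (use W that in auto)
  have WW: "W * W = 1\<^sub>m n"
    unfolding WX[OF W] by (rule eq_matI) (auto simp: W_def)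
  show ?thesis
  proof (rule similar_mat_intertwine[OF _ _ W])
    show "invertible_mat W" by (rule invertible_matI[OF W W WW WW])
    show "transpose_mat (jordan_block n a) * W = W * jordan_block n a"
      by (subst WX, simp, subst XW, simp, rule eq_matI) auto
  qed auto
qed

lemma similar_mat_jordan_matrix_transpose:
  "similar_mat (transpose_mat (jordan_matrix n_as)) (jordan_matrix (n_as :: (nat \<times> 'a::field) list))"
proof (induction n_as)
  case Nil
  show ?case by (rule similar_mat_intertwine[of _ 0 _ "1\<^sub>m 0"])
    (auto simp: jordan_matrix_def intro: invertible_matI[of "1\<^sub>m 0" 0 "1\<^sub>m 0"])
next
  case (Cons na n_as)
  obtain n a where na: "na = (n, a)" by (cases na)
  show ?case unfolding na jordan_matrix_Cons
    by (subst transpose_four_block_mat)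
      (auto intro!: similar_mat_four_block_0_0 similar_mat_jordan_block_transpose Cons)
qed

lemma similar_mat_transpose:
  assumes "similar_mat A (B :: 'a::field mat)"
  shows "similar_mat (transpose_mat A) (transpose_mat B)"
proof -
  from similar_matD[OF assms] obtain n P Q where
    car: "A \<in> carrier_mat n n" "B \<in> carrier_mat n n" "P \<in> carrier_mat n n" "Q \<in> carrier_mat n n"
    and PQ: "P * Q = 1\<^sub>m n" "Q * P = 1\<^sub>m n" and A: "A = P * B * Q" by auto
  show ?thesis
  proof (rule similar_matI)
    show "{transpose_mat A, transpose_mat B, transpose_mat Q, transpose_mat P} \<subseteq> carrier_mat n n"
      using car by auto
    show "transpose_mat Q * transpose_mat P = 1\<^sub>m n" "transpose_mat P * transpose_mat Q = 1\<^sub>m n"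
      using car PQ by (simp_all add: transpose_mult[symmetric])
    have "transpose_mat A = transpose_mat Q * transpose_mat (P * B)"
      unfolding A using car by (intro transpose_mult) auto
    also have "transpose_mat (P * B) = transpose_mat B * transpose_mat P"
      using car by (intro transpose_mult) auto
    finally show "transpose_mat A = transpose_mat Q * transpose_mat B * transpose_mat P"
      using car by (simp add: assoc_mult_mat[of _ n n _ n _ n])
  qed
qed

section \<open>From the complex numbers to the reals, and to every field of the class\<close>

lemma similar_mat_transpose_complex:
  assumes A: "(A :: complex mat) \<in> carrier_mat n n"
  shows "similar_mat (transpose_mat A) A"
proof -
  from char_poly_factorized[OF A] obtain as where "char_poly A = (\<Prod>a\<leftarrow>as. [:- a, 1:])" by blast
  from jordan_nf_exists[OF A this] obtain n_as where "similar_mat A (jordan_matrix n_as)"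
    unfolding jordan_nf_def by blast
  then show ?thesis
    by (meson similar_mat_transpose similar_mat_trans similar_mat_sym
        similar_mat_jordan_matrix_transpose)
qed

text \<open>If \<open>C\<close> intertwines the two real matrices over the complex numbers, then so does
  \<open>X + t Y\<close> with \<open>C = X + \<i> Y\<close>, and \<open>det (X + t Y)\<close>, a polynomial in \<open>t\<close> that does not vanish
  at \<open>t = \<i>\<close>, does not vanish at some real \<open>t\<close>.\<close>

lemma similar_mat_complex_imp_real:
  assumes A: "A \<in> carrier_mat n n" and B: "B \<in> carrier_mat n n"
    and sim: "similar_mat (map_mat complex_of_real A) (map_mat complex_of_real B)"
  shows "similar_mat A B"
proof -
  let ?c = complex_of_real
  obtain C D where C: "C \<in> carrier_mat n n" and D: "D \<in> carrier_mat n n"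
    and CD: "C * D = 1\<^sub>m n" "D * C = 1\<^sub>m n" and eq: "map_mat ?c A = C * map_mat ?c B * D"
    using sim A unfolding similar_mat_def similar_mat_wit_def by (auto simp: Let_def)
  have inv: "invertible_mat C" by (rule invertible_matI[OF C D CD])
  have "map_mat ?c A * C = C * map_mat ?c B * (D * C)"
    unfolding eq using B C D by (intro assoc_mult_mat[of _ n n _ n _ n]) auto
  then have comm: "map_mat ?c A * C = C * map_mat ?c B" using B C CD by simp
  define X where "X = map_mat Re C"
  define Y where "Y = map_mat Im C"
  have X: "X \<in> carrier_mat n n" and Y: "Y \<in> carrier_mat n n" using C by (auto simp: X_def Y_def)
  have ent: "(\<Sum>k<n. ?c (A $$ (i, k)) * C $$ (k, j)) = (\<Sum>k<n. C $$ (i, k) * ?c (B $$ (k, j)))"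
    if "i < n" "j < n" for i j
    using arg_cong[OF comm, of "\<lambda>Z. Z $$ (i, j)"] that A B C
    by (simp add: scalar_prod_def lessThan_atLeast0)
  \<comment> \<open>\<open>A\<close> and \<open>B\<close> are real, so the real and the imaginary
    part of \<open>C\<close> intertwine them separately.\<close>
  have AX: "A * X = X * B"
  proof (rule eq_matI)
    fix i j assume "i < dim_row (X * B)" "j < dim_col (X * B)"
    then have ij: "i < n" "j < n" using X B by auto
    from arg_cong[OF ent[OF this], of Re] show "(A * X) $$ (i, j) = (X * B) $$ (i, j)"
      using A B C X ij by (simp add: scalar_prod_def X_def lessThan_atLeast0)
  qed (use A B X in auto)
  have AY: "A * Y = Y * B"
  proof (rule eq_matI)
    fix i j assume "i < dim_row (Y * B)" "j < dim_col (Y * B)"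
    then have ij: "i < n" "j < n" using Y B by auto
    from arg_cong[OF ent[OF this], of Im] show "(A * Y) $$ (i, j) = (Y * B) $$ (i, j)"
      using A B C Y ij by (simp add: scalar_prod_def Y_def lessThan_atLeast0)
  qed (use A B Y in auto)
  \<comment> \<open>\<open>P\<close> is the polynomial matrix with value \<open>X + t Y\<close> at
    \<open>t\<close>. Evaluation at \<open>\<i>\<close>, after embedding the coefficients, and
    evaluation at a real \<open>t\<close> are ring homomorphisms, so both commute with the
    determinant.\<close>
  define P where "P = mat n n (\<lambda>ij. [:X $$ ij, Y $$ ij:])"
  interpret c: map_poly_comm_ring_hom ?c by unfold_locales
  interpret i: comm_ring_hom "\<lambda>p. poly (map_poly ?c p) \<i>"
    by unfold_locales (simp_all add: c.hom_add c.hom_mult)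
  have "map_mat (\<lambda>p. poly (map_poly ?c p) \<i>) P = C"
    using C by (intro eq_matI) (auto simp: P_def X_def Y_def complex_eq_iff of_real_hom.map_poly_pCons_hom)
  then have "poly (map_poly ?c (det P)) \<i> = det C" by (metis i.hom_det)
  then have "det P \<noteq> 0" using inv invertible_mat_iff_det[OF C] by auto
  then have "finite {t. poly (det P) t = 0}" by (rule poly_roots_finite)
  then have "{t. poly (det P) t = 0} \<noteq> UNIV" using infinite_UNIV_char_0 by metis
  then obtain t where t: "poly (det P) t \<noteq> 0" by blast
  have t_hom: "comm_ring_hom (\<lambda>p. poly p t)" by unfold_locales auto
  have "map_mat (\<lambda>p. poly p t) P = X + t \<cdot>\<^sub>m Y"
    using X Y by (intro eq_matI) (auto simp: P_def)
  then have "det (X + t \<cdot>\<^sub>m Y) \<noteq> 0" using t by (metis comm_ring_hom.hom_det[OF t_hom])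
  moreover have Z: "X + t \<cdot>\<^sub>m Y \<in> carrier_mat n n" using X Y by simp
  ultimately have inv: "invertible_mat (X + t \<cdot>\<^sub>m Y)" using invertible_mat_iff_det by blast
  have "A * (X + t \<cdot>\<^sub>m Y) = A * X + t \<cdot>\<^sub>m (A * Y)"
    using A X Y by (simp add: mult_add_distrib_mat[of _ n n] mult_smult_distrib[of _ n n])
  also have "\<dots> = (X + t \<cdot>\<^sub>m Y) * B"
    unfolding AX AY using B X Y
    by (simp add: add_mult_distrib_mat[of _ n n] mult_smult_assoc_mat[of _ n n])
  finally show ?thesis by (rule similar_mat_intertwine[OF A B Z inv])
qed

lemma similar_mat_transpose_real:
  assumes A: "(A :: real mat) \<in> carrier_mat n n"
  shows "similar_mat (transpose_mat A) A"
proof (rule similar_mat_complex_imp_real)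
  have "map_mat complex_of_real (transpose_mat A) = transpose_mat (map_mat complex_of_real A)"
    by (rule eq_matI) auto
  then show "similar_mat (map_mat complex_of_real (transpose_mat A)) (map_mat complex_of_real A)"
    using A by (simp add: similar_mat_transpose_complex)
qed (use A in auto)

text \<open>A right inverse of \<open>h\<close> lifts \<open>A\<close> entrywise to a matrix
  \<open>B\<close>. The lifting need not respect the ring operations, because it is the similarity
  of \<open>B\<close> to its transpose that is mapped back, and this by \<open>h\<close>.\<close>

lemma similar_mat_transpose_surj_hom:
  fixes h :: "'b::field \<Rightarrow> 'a::field" and A :: "'a mat"
  assumes "semiring_hom h" "surj h"
    and sim: "\<And>B :: 'b mat. B \<in> carrier_mat n n \<Longrightarrow> similar_mat (transpose_mat B) B"
    and A: "A \<in> carrier_mat n n"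
  shows "similar_mat (transpose_mat A) A"
proof -
  interpret semiring_hom h by fact
  define B where "B = map_mat (inv_into UNIV h) A"
  have B: "B \<in> carrier_mat n n" using A by (simp add: B_def)
  have hB: "map_mat h B = A"
    using A by (intro eq_matI) (auto simp: B_def surj_f_inv_f[OF \<open>surj h\<close>])
  obtain P Q where PQ: "P \<in> carrier_mat n n" "Q \<in> carrier_mat n n"
    "P * Q = 1\<^sub>m n" "Q * P = 1\<^sub>m n" and eq: "transpose_mat B = P * B * Q"
    using sim[OF B] B unfolding similar_mat_def similar_mat_wit_def by (auto simp: Let_def)
  have PQc: "P * B \<in> carrier_mat n n" using PQ B by simp
  show ?thesis
  proof (rule similar_matI)
    show "{transpose_mat A, A, map_mat h P, map_mat h Q} \<subseteq> carrier_mat n n" using PQ A by auto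
    show "map_mat h P * map_mat h Q = 1\<^sub>m n" "map_mat h Q * map_mat h P = 1\<^sub>m n"
      using PQ by (simp_all add: mat_hom_mult[symmetric] mat_hom_one)
    have "transpose_mat A = map_mat h (transpose_mat B)"
      unfolding hB[symmetric] by (rule eq_matI) auto
    also have "\<dots> = map_mat h P * A * map_mat h Q"
      unfolding eq mat_hom_mult[OF PQc PQ(2)] mat_hom_mult[OF PQ(1) B] hB ..
    finally show "transpose_mat A = map_mat h P * A * map_mat h Q" .
  qed
qed

text \<open>The class axiom provides a surjective homomorphism onto the field:
  \<open>of_real\<close> in the first case, and \<open>h z = Re z + Im z * i\<close> with the given
  root \<open>i\<close> of \<open>- 1\<close> in the second.\<close>

lemma similar_mat_transpose_self:
  fixes A :: "'a::real_or_complex mat"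
  assumes A: "A \<in> carrier_mat n n"
  shows "similar_mat (transpose_mat A) A"
  using real_or_complex
proof
  assume "\<forall>x::'a. \<exists>a. x = a *\<^sub>R 1"
  then have "surj (of_real :: real \<Rightarrow> 'a)" by (auto simp: surj_def of_real_def)
  moreover have "semiring_hom (of_real :: real \<Rightarrow> 'a)" by unfold_locales auto
  ultimately show ?thesis using similar_mat_transpose_real A
    by (intro similar_mat_transpose_surj_hom[of of_real n A]) auto
next
  assume "\<exists>i::'a. i * i = - 1 \<and> (\<forall>x. \<exists>a b. x = a *\<^sub>R 1 + b *\<^sub>R i)"
  then obtain i :: 'a where i: "i * i = - 1" and ex: "\<And>x. \<exists>a b. x = a *\<^sub>R 1 + b *\<^sub>R i" by blast
  define h where "h z = of_real (Re z) + of_real (Im z) * i" for z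
  have "h (Complex a b) = a *\<^sub>R 1 + b *\<^sub>R i" for a b
    by (simp add: h_def scaleR_conv_of_real)
  then have "surj h" using ex unfolding surj_def by metis
  moreover have "semiring_hom h"
  proof
    fix x y
    have "h x * h y = of_real (Re x * Re y) + of_real (Im x * Im y) * (i * i)
      + of_real (Re x * Im y + Im x * Re y) * i" by (simp add: h_def algebra_simps)
    then show "h (x * y) = h x * h y" by (simp add: i h_def algebra_simps)
  qed (auto simp: h_def algebra_simps)
  ultimately show ?thesis using similar_mat_transpose_complex A
    by (intro similar_mat_transpose_surj_hom[of h n A]) auto
qed

section \<open>Block partitions\<close>

lemma offset_Suc [simp]: "offset L (Suc r) = offset L r + L r"
  by (simp add: offset_def)

lemma offset_mono: "r \<le> s \<Longrightarrow> offset L r \<le> offset L s"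
  unfolding offset_def by (rule sum_mono2) auto

lemma offset_add_less:
  assumes "r < R" "a < L r"
  shows "offset L r + a < offset L R"
  using offset_mono[of "Suc r" R L] assms by simp

lemma offset_add_inj:
  assumes "offset L r + a = offset L s + b" "a < L r" "b < L s"
  shows "r = s" "a = b"
proof -
  show "r = s"
    using offset_add_less[of r s a L] offset_add_less[of s r b L] assms
    by (metis add_leD1 leD linorder_neqE_nat order_refl)
  with assms show "a = b" by simp
qed

lemma offset_add_exists:
  assumes "j < offset L R"
  obtains r b where "r < R" "b < L r" "j = offset L r + b"
  using assms
proof (induction R arbitrary: thesis)
  case 0
  then show ?case by (simp add: offset_def)
next
  case (Suc R)
  show ?case
  proof (cases "j < offset L R")
    case True
    then show ?thesis using Suc by (metis less_SucI)
  next
    case False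
    then show ?thesis using Suc.prems by (intro Suc.prems(1)[of R "j - offset L R"]) auto
  qed
qed

text \<open>The inclusion of the coordinates of block \<open>r\<close>. Multiplying by it from the
  right selects the columns of the block, its transpose selects rows from the left, and the product
  of it with its transpose is the coordinate projection onto the block.\<close>

definition block_embed :: "nat \<Rightarrow> (nat \<Rightarrow> nat) \<Rightarrow> nat \<Rightarrow> 'a::zero_neq_one mat" where
  "block_embed n L r = mat n (L r) (\<lambda>(i, j). if i = offset L r + j then 1 else 0)"

lemma block_embed_carrier [simp]: "block_embed n L r \<in> carrier_mat n (L r)"
  by (simp add: block_embed_def)

lemma dim_block_embed [simp]:
  "dim_row (block_embed n L r) = n" "dim_col (block_embed n L r) = L r"
  by (simp_all add: block_embed_def)

lemma mult_block_embed_index: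
  assumes X: "(X :: 'a::semiring_1 mat) \<in> carrier_mat m (offset L R)" and "r < R" "i < m" "j < L r"
  shows "(X * block_embed (offset L R) L r) $$ (i, j) = X $$ (i, offset L r + j)"
proof -
  have "(X * block_embed (offset L R) L r) $$ (i, j) =
      (\<Sum>k\<in>{0..<offset L R}. if k = offset L r + j then X $$ (i, k) else 0)"
    using offset_add_less[of r R j L] assms
    by (simp add: block_embed_def scalar_prod_def if_distrib[of "\<lambda>x. _ * x"] cong: if_cong)
  also have "\<dots> = X $$ (i, offset L r + j)"
    using offset_add_less[of r R j L] assms by simp
  finally show ?thesis .
qed

lemma col_block_eq:
  assumes X: "(X :: 'a::semiring_1 mat) \<in> carrier_mat m (offset L R)" and "r < R"
  shows "col_block X L r = X * block_embed (offset L R) L r"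
  using assms by (intro eq_matI) (auto simp: col_block_def mult_block_embed_index simp del: index_mult_mat(1))

lemma block_embed_orthogonal:
  assumes "r < R" "s < R"
  shows "transpose_mat (block_embed (offset L R) L r) * block_embed (offset L R) L s =
    (if r = s then 1\<^sub>m (L s) else 0\<^sub>m (L r) (L s) :: 'a::semiring_1 mat)"
proof (rule eq_matI)
  fix i j assume "i < dim_row (if r = s then 1\<^sub>m (L s) else 0\<^sub>m (L r) (L s) :: 'a mat)"
    "j < dim_col (if r = s then 1\<^sub>m (L s) else 0\<^sub>m (L r) (L s) :: 'a mat)"
  then have ij: "i < L r" "j < L s" by (auto split: if_splits)
  have "(transpose_mat (block_embed (offset L R) L r) * block_embed (offset L R) L s) $$ (i, j) =
      (if offset L s + j = offset L r + i then 1 else 0 :: 'a)"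
    using assms ij offset_add_less[of s R j L]
    by (subst mult_block_embed_index[of _ "L r"]) (auto simp: block_embed_def)
  then show "(transpose_mat (block_embed (offset L R) L r) * block_embed (offset L R) L s) $$ (i, j) =
      (if r = s then 1\<^sub>m (L s) else 0\<^sub>m (L r) (L s) :: 'a mat) $$ (i, j)"
    using ij offset_add_inj[of L s j r i] by auto
qed auto

lemma eq_mat_blocksI:
  assumes X: "(X :: 'a::semiring_1 mat) \<in> carrier_mat m (offset L R)" and Y: "Y \<in> carrier_mat m (offset L R)"
    and eq: "\<And>r. r < R \<Longrightarrow> X * block_embed (offset L R) L r = Y * block_embed (offset L R) L r"
  shows "X = Y"
proof (rule eq_matI)
  fix i j assume "i < dim_row Y" "j < dim_col Y"
  then have i: "i < m" and "j < offset L R" using Y by auto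
  then obtain r b where rb: "r < R" "b < L r" "j = offset L r + b"
    using offset_add_exists by metis
  show "X $$ (i, j) = Y $$ (i, j)"
    using arg_cong[OF eq[OF rb(1)], of "\<lambda>Z. Z $$ (i, b)"] rb i
    by (simp add: mult_block_embed_index[OF X] mult_block_embed_index[OF Y])
qed (use X Y in auto)

lemma diag_block_mat_carrier:
  assumes "\<And>r. r < R \<Longrightarrow> T r \<in> carrier_mat (L r) (L r)"
  shows "diag_block_mat (map T [0..<R]) \<in> carrier_mat (offset L R) (offset L R)"
  using assms
proof (induction R)
  case 0
  then show ?case by (simp add: offset_def)
next
  case (Suc R)
  then show ?case by (auto simp: diag_block_mat_last Let_def)
qed

lemma diag_block_mat_index:
  assumes "\<And>r. r < R \<Longrightarrow> T r \<in> carrier_mat (L r) (L r)"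
    and "r < R" "s < R" "a < L r" "b < L s"
  shows "diag_block_mat (map T [0..<R]) $$ (offset L r + a, offset L s + b) =
    (if r = s then T r $$ (a, b) else 0)"
  using assms
proof (induction R)
  case (Suc R)
  let ?D = "diag_block_mat (map T [0..<R])"
  have D: "?D \<in> carrier_mat (offset L R) (offset L R)" and TR: "T R \<in> carrier_mat (L R) (L R)"
    using Suc.prems(1) diag_block_mat_carrier[of R T L] by auto
  have eq: "diag_block_mat (map T [0..<Suc R]) =
      four_block_mat ?D (0\<^sub>m (offset L R) (L R)) (0\<^sub>m (L R) (offset L R)) (T R)"
    using D TR by (simp add: diag_block_mat_last Let_def)
  have r: "offset L r + a < offset L R \<longleftrightarrow> r < R"
    using offset_add_less[of r R a L] Suc.prems(2,4) by (auto simp: less_Suc_eq)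
  have s: "offset L s + b < offset L R \<longleftrightarrow> s < R"
    using offset_add_less[of s R b L] Suc.prems(3,5) by (auto simp: less_Suc_eq)
  have bd: "offset L r + a < offset L R + L R" "offset L s + b < offset L R + L R"
    using offset_add_less[of r "Suc R" a L] offset_add_less[of s "Suc R" b L] Suc.prems by auto
  show ?case unfolding eq 
    using bd Suc r s by (auto simp: less_Suc_eq carrier_matD[OF D] carrier_matD[OF TR])
qed simp

text \<open>The form in which the block-diagonal structure enters equations between block columns:
  multiplied by \<open>S\<close> from the left, it compares a block column of \<open>S * D\<close>,
  where \<open>D\<close> is the block-diagonal matrix, with the block column of \<open>S\<close>
  times \<open>T s\<close>.\<close>

lemma diag_block_mat_mult_embed:
  assumes T: "\<And>r. r < R \<Longrightarrow> T r \<in> carrier_mat (L r) (L r)" and "s < R"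
  shows "diag_block_mat (map T [0..<R]) * block_embed (offset L R) L s =
    block_embed (offset L R) L s * (T s :: 'a::semiring_1 mat)"
proof (rule eq_matI)
  note D = diag_block_mat_carrier[of R T L, OF T]
  note Ts = T[OF \<open>s < R\<close>]
  fix i j assume "i < dim_row (block_embed (offset L R) L s * T s)"
    "j < dim_col (block_embed (offset L R) L s * T s)"
  then have i: "i < offset L R" and j: "j < L s" using Ts by auto
  then obtain r a where ra: "r < R" "a < L r" "i = offset L r + a" using offset_add_exists by metis
  have "(block_embed (offset L R) L s * T s) $$ (i, j) =
      (\<Sum>k\<in>{0..<L s}. if i = offset L s + k then T s $$ (k, j) else 0)"
    using i j Ts by (auto simp: block_embed_def scalar_prod_def intro!: sum.cong)
  also have "\<dots> = (\<Sum>k\<in>{0..<L s}. if k = a then (if r = s then T s $$ (a, j) else 0) else 0)"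
    using ra offset_add_inj[of L r a s] by (intro sum.cong) auto
  also have "\<dots> = (if r = s then T s $$ (a, j) else 0)" using ra by auto
  also have "\<dots> = (diag_block_mat (map T [0..<R]) * block_embed (offset L R) L s) $$ (i, j)"
    using ra j \<open>s < R\<close> i mult_block_embed_index[OF D \<open>s < R\<close> i j]
    by (simp add: diag_block_mat_index[of R T L, OF T])
  finally show "(diag_block_mat (map T [0..<R]) * block_embed (offset L R) L s) $$ (i, j) =
    (block_embed (offset L R) L s * T s) $$ (i, j)" by simp
qed (use diag_block_mat_carrier[of R T L, OF T] T[OF \<open>s < R\<close>] in auto)

section \<open>Products of tensors and matrices\<close>

lemma dims_mode_prod [simp]: "dims (mode_prod n D X) = (dims D)[n := dim_row X]"
  by (simp add: mode_prod_def)

lemma entry_mode_prod: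
  "ix \<in> tensor_indices ((dims D)[n := dim_row X]) \<Longrightarrow>
    entry (mode_prod n D X) ix = (\<Sum>l<dims D ! n. X $$ (ix ! n, l) * entry D (ix[n := l]))"
  by (simp add: mode_prod_def)

lemma tensor_indices_fiber:
  assumes "ix \<in> tensor_indices (ds[n := d])" "n < length ds" "l < ds ! n"
  shows "ix[n := l] \<in> tensor_indices ds"
  using tensor_indices_update[OF assms(1), of n l "ds ! n"] assms by simp

lemma mode_prod_commute:
  fixes D :: "'a::comm_semiring_0 tensor"
  assumes "m \<noteq> n" "m < length (dims D)" "n < length (dims D)"
  shows "mode_prod m (mode_prod n D Y) X = mode_prod n (mode_prod m D X) Y"
proof (rule tensor_eqI)
  show "dims (mode_prod m (mode_prod n D Y) X) = dims (mode_prod n (mode_prod m D X) Y)"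
    using assms by (simp add: list_update_swap)
  fix ix assume "ix \<in> tensor_indices (dims (mode_prod n (mode_prod m D X) Y))"
  then have ix: "ix \<in> tensor_indices ((dims D)[m := dim_row X, n := dim_row Y])"
    and ix': "ix \<in> tensor_indices ((dims D)[n := dim_row Y, m := dim_row X])"
    using assms by (simp_all add: list_update_swap)
  have len: "length ix = length (dims D)" using ix by (simp add: tensor_indices_def)
  have "entry (mode_prod m (mode_prod n D Y) X) ix =
      (\<Sum>l<dims D ! m. X $$ (ix ! m, l) * entry (mode_prod n D Y) (ix[m := l]))"
    using ix' assms by (subst entry_mode_prod) auto
  also have "\<dots> = (\<Sum>l<dims D ! m. \<Sum>k<dims D ! n. X $$ (ix ! m, l) * (Y $$ (ix ! n, k) * entry D (ix[m := l, n := k])))"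
    using assms ix' len
    by (intro sum.cong) (auto simp: sum_distrib_left entry_mode_prod tensor_indices_fiber)
  also have "\<dots> = (\<Sum>k<dims D ! n. \<Sum>l<dims D ! m. Y $$ (ix ! n, k) * (X $$ (ix ! m, l) * entry D (ix[n := k, m := l])))"
    using assms by (subst sum.swap) (auto simp: list_update_swap mult.left_commute intro!: sum.cong)
  also have "\<dots> = (\<Sum>k<dims D ! n. Y $$ (ix ! n, k) * entry (mode_prod m D X) (ix[n := k]))"
    using assms ix len
    by (intro sum.cong) (auto simp: sum_distrib_left entry_mode_prod tensor_indices_fiber)
  also have "\<dots> = entry (mode_prod n (mode_prod m D X) Y) ix"
    using ix assms by (subst entry_mode_prod) auto
  finally show "entry (mode_prod m (mode_prod n D Y) X) ix = entry (mode_prod n (mode_prod m D X) Y) ix" .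
qed

lemma mode_prod_assoc:
  fixes D :: "'a::comm_semiring_0 tensor"
  assumes n: "n < length (dims D)" and dr: "dim_row X = dim_col Y" and dc: "dim_col X = dims D ! n"
  shows "mode_prod n (mode_prod n D X) Y = mode_prod n D (Y * X)"
proof (rule tensor_eqI)
  show "dims (mode_prod n (mode_prod n D X) Y) = dims (mode_prod n D (Y * X))" by simp
  fix ix assume "ix \<in> tensor_indices (dims (mode_prod n D (Y * X)))"
  then have ix: "ix \<in> tensor_indices ((dims D)[n := dim_row Y])" by simp
  then have ixn: "ix ! n < dim_row Y" and len: "length ix = length (dims D)"
    using n by (auto simp: tensor_indices_def)
  have ix': "ix[n := l] \<in> tensor_indices ((dims D)[n := dim_row X])" if "l < dim_row X" for l
    using tensor_indices_update[OF ix, of n l "dim_row X"] n that by simp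
  have "entry (mode_prod n (mode_prod n D X) Y) ix =
      (\<Sum>l<dim_row X. Y $$ (ix ! n, l) * entry (mode_prod n D X) (ix[n := l]))"
    using ix n by (subst entry_mode_prod) auto
  also have "\<dots> = (\<Sum>l<dim_row X. \<Sum>k<dims D ! n. Y $$ (ix ! n, l) * X $$ (l, k) * entry D (ix[n := k]))"
    using ix' n len by (intro sum.cong) (auto simp: entry_mode_prod sum_distrib_left mult.assoc)
  also have "\<dots> = (\<Sum>k<dims D ! n. (Y * X) $$ (ix ! n, k) * entry D (ix[n := k]))"
    using ixn dr dc by (subst sum.swap) (simp add: scalar_prod_def sum_distrib_right lessThan_atLeast0)
  also have "\<dots> = entry (mode_prod n D (Y * X)) ix"
    using ix n by (subst entry_mode_prod) auto
  finally show "entry (mode_prod n (mode_prod n D X) Y) ix = entry (mode_prod n D (Y * X)) ix" .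
qed

lemma mode_prod_one:
  fixes D :: "'a::comm_semiring_1 tensor"
  assumes n: "n < length (dims D)"
  shows "mode_prod n D (1\<^sub>m (dims D ! n)) = D"
proof (rule tensor_eqI)
  fix ix assume ix: "ix \<in> tensor_indices (dims D)"
  then have "ix ! n < dims D ! n" using n by (auto simp: tensor_indices_def)
  then have "(\<Sum>l<dims D ! n. 1\<^sub>m (dims D ! n) $$ (ix ! n, l) * entry D (ix[n := l])) =
      (\<Sum>l<dims D ! n. if l = ix ! n then entry D ix else 0)"
    by (intro sum.cong) auto
  also have "\<dots> = entry D ix" using \<open>ix ! n < dims D ! n\<close> by simp
  finally show "entry (mode_prod n D (1\<^sub>m (dims D ! n))) ix = entry D ix"
    using ix by (simp add: entry_mode_prod)
qed simp

lemma mode_prod_smult: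
  fixes D :: "'a::comm_semiring_0 tensor"
  assumes n: "n < length (dims D)" and dc: "dim_col X = dims D ! n"
  shows "mode_prod n D (c \<cdot>\<^sub>m X) = smult_tensor c (mode_prod n D X)"
proof (rule tensor_eqI)
  fix ix assume "ix \<in> tensor_indices (dims (smult_tensor c (mode_prod n D X)))"
  then have ix: "ix \<in> tensor_indices ((dims D)[n := dim_row X])" by (simp add: smult_tensor_def)
  then have "ix ! n < dim_row X" using n by (auto simp: tensor_indices_def)
  then show "entry (mode_prod n D (c \<cdot>\<^sub>m X)) ix = entry (smult_tensor c (mode_prod n D X)) ix"
    using ix dc by (simp add: smult_tensor_def entry_mode_prod sum_distrib_left mult.assoc)
qed (simp add: smult_tensor_def)

lemma entry_mode_prod_add:
  fixes D :: "'a::comm_semiring_0 tensor"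
  assumes n: "n < length (dims D)" and X: "X \<in> carrier_mat d (dims D ! n)" and Y: "Y \<in> carrier_mat d (dims D ! n)"
    and ix: "ix \<in> tensor_indices ((dims D)[n := d])"
  shows "entry (mode_prod n D (X + Y)) ix = entry (mode_prod n D X) ix + entry (mode_prod n D Y) ix"
proof -
  have "ix ! n < d" using ix n by (auto simp: tensor_indices_def)
  then show ?thesis using X Y ix by (simp add: entry_mode_prod distrib_right sum.distrib)
qed

lemma mode_mat_inj:
  assumes "dims A = dims B" "n < length (dims A)" "mode_mat n A = mode_mat n B"
  shows "A = B"
  using assms by (intro tensor_eqI) (metis mode_mat_entry)+

text \<open>Moves the coupling from mode matrices to tensors, where different modes can be compared
  directly and products in them interchanged.\<close>

lemma mode_prod_eq_iff_mode_mat: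
  fixes A :: "'a::comm_semiring_0 tensor"
  assumes n: "n < length (dims A)" and M: "M \<in> carrier_mat (dims A ! n) (dims A ! n)"
    and B: "dims B = dims A"
  shows "B = mode_prod n A (transpose_mat M) \<longleftrightarrow> mode_mat n B = mode_mat n A * M"
proof -
  have "mode_mat n (mode_prod n A (transpose_mat M)) = mode_mat n A * M"
    using mode_mat_mode_prod[OF n, of "transpose_mat M" "dims A ! n"] M by simp
  moreover have "dims (mode_prod n A (transpose_mat M)) = dims A" using M by simp
  ultimately show ?thesis using mode_mat_inj[of B "mode_prod n A (transpose_mat M)" n] n B by auto
qed

section \<open>Products in several modes, and diagonal blocks as such products\<close>

lemma mode_prods_0 [simp]: "mode_prods 0 D X = D"
  by (simp add: mode_prods_def)

lemma mode_prods_Suc [simp]: "mode_prods (Suc K) D X = mode_prod K (mode_prods K D X) (X K)"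
  by (simp add: mode_prods_def)

lemma length_dims_mode_prods [simp]: "length (dims (mode_prods K D X)) = length (dims D)"
  by (induction K) auto

lemma dims_mode_prods:
  "K \<le> length (dims D) \<Longrightarrow> n < length (dims D) \<Longrightarrow>
    dims (mode_prods K D X) ! n = (if n < K then dim_row (X n) else dims D ! n)"
  by (induction K) (auto simp: nth_list_update less_Suc_eq)

lemma mode_prods_cong:
  "(\<And>n. n < K \<Longrightarrow> X n = Y n) \<Longrightarrow> mode_prods K D X = mode_prods K D Y"
  by (induction K) auto

lemma mode_prods_mode_prod_outside:
  fixes D :: "'a::comm_semiring_0 tensor"
  assumes "K \<le> n" "n < length (dims D)"
  shows "mode_prods K (mode_prod n D Y) X = mode_prod n (mode_prods K D X) Y"
  using assms by (induction K) (auto intro: mode_prod_commute)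

text \<open>The additional product commutes past the later modes until it meets the factor of its
  own mode. Applied last, it multiplies that factor from the left; applied first, as in
  \<open>mode_prods_mode_prod\<close>, from the right.\<close>

lemma mode_prod_mode_prods:
  fixes D :: "'a::comm_semiring_0 tensor"
  assumes "n < K" "K \<le> length (dims D)" "dim_col (X n) = dims D ! n" "dim_col Y = dim_row (X n)"
  shows "mode_prod n (mode_prods K D X) Y = mode_prods K D (X(n := Y * X n))"
  using assms
proof (induction K)
  case (Suc K)
  show ?case
  proof (cases "n = K")
    case True
    have eq: "mode_prods K D (X(K := Y * X K)) = mode_prods K D X" by (rule mode_prods_cong) simp
    show ?thesis unfolding True mode_prods_Suc fun_upd_same eq
      using Suc.prems True by (simp add: mode_prod_assoc dims_mode_prods)
  next
    case False
    then have "mode_prod n (mode_prod K (mode_prods K D X) (X K)) Y =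
        mode_prod K (mode_prod n (mode_prods K D X) Y) (X K)"
      using Suc.prems by (intro mode_prod_commute) auto
    then show ?thesis using Suc False by simp
  qed
qed simp

lemma mode_prods_mode_prod:
  fixes D :: "'a::comm_semiring_0 tensor"
  assumes "n < K" "K \<le> length (dims D)" "dim_col (X n) = dim_row Y" "dim_col Y = dims D ! n"
  shows "mode_prods K (mode_prod n D Y) X = mode_prods K D (X(n := X n * Y))"
  using assms
proof (induction K)
  case (Suc K)
  show ?case
  proof (cases "n = K")
    case True
    have eq: "mode_prods K D (X(K := X K * Y)) = mode_prods K D X" by (rule mode_prods_cong) simp
    show ?thesis unfolding True mode_prods_Suc fun_upd_same eq
      using Suc.prems True
      by (simp add: mode_prods_mode_prod_outside mode_prod_assoc dims_mode_prods)
  next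
    case False
    then show ?thesis using Suc by simp
  qed
qed simp

lemma mode_prods_mode_prods:
  fixes D :: "'a::comm_semiring_0 tensor"
  assumes "K \<le> length (dims D)"
    and "\<And>n. n < K \<Longrightarrow> dim_col (X n) = dim_row (Y n)" "\<And>n. n < K \<Longrightarrow> dim_col (Y n) = dims D ! n"
  shows "mode_prods K (mode_prods K D Y) X = mode_prods K D (\<lambda>n. X n * Y n)"
  using assms
  by (induction K) (simp_all add: mode_prods_mode_prod_outside mode_prod_assoc dims_mode_prods)

text \<open>Each transposed inclusion shifts one index by the offset of the block, so the modes can
  be cut one after the other: the induction passes through the tensors that are cut in the first
  \<open>K\<close> modes only. Afterwards blocks are handled by matrix algebra alone.\<close>

lemma diagonal_block_eq_mode_prods:
  fixes D :: "'a::comm_semiring_1 tensor"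
  assumes "K \<le> length (dims D)" and "r < R" and "\<And>n. n < K \<Longrightarrow> offset (L n) R = dims D ! n"
  shows "diagonal_block K L r D = mode_prods K D (\<lambda>n. transpose_mat (block_embed (dims D ! n) (L n) r))"
  using assms
proof (induction K)
  case 0
  show ?case
    by (rule tensor_eqI) (auto simp: diagonal_block_def map_nth tensor_indices_def intro!: nth_equalityI
        arg_cong[of _ _ "entry D"])
next
  case (Suc K)
  let ?N = "length (dims D)"
  let ?X = "transpose_mat (block_embed (dims D ! K) (L K) r) :: 'a mat"
  let ?D = "diagonal_block K L r D"
  have dims: "dims (diagonal_block K' L r D) = map (\<lambda>n. if n < K' then L n r else dims D ! n) [0..<?N]" for K'
    by (simp add: diagonal_block_def)
  have upd: "dims (diagonal_block (Suc K) L r D) = (dims ?D)[K := L K r]"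
    unfolding dims using Suc.prems(1)
    by (intro nth_equalityI) (auto simp: nth_list_update less_Suc_eq)
  have DK: "dims ?D ! K = dims D ! K" using Suc.prems(1) by (simp add: dims)
  have "diagonal_block (Suc K) L r D = mode_prod K ?D ?X"
  proof (rule tensor_eqI)
    show "dims (diagonal_block (Suc K) L r D) = dims (mode_prod K ?D ?X)" by (simp add: upd)
    fix ix assume "ix \<in> tensor_indices (dims (mode_prod K ?D ?X))"
    then have ix: "ix \<in> tensor_indices ((dims ?D)[K := L K r])" by simp
    have ixS: "ix \<in> tensor_indices (dims (diagonal_block (Suc K) L r D))" using ix by (simp only: upd)
    have len: "length ix = ?N" using ix by (simp add: tensor_indices_def dims)
    have "K < length ((dims ?D)[K := L K r])" using Suc.prems(1) by (simp add: dims)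
    then have "ix ! K < (dims ?D)[K := L K r] ! K" using ix unfolding tensor_indices_def by blast
    then have "ix ! K < L K r" using Suc.prems(1) by (simp add: dims)
    then have lt: "offset (L K) r + ix ! K < dims D ! K"
      using offset_add_less[of r R "ix ! K" "L K"] Suc.prems by simp
    have "entry (mode_prod K ?D ?X) ix = (\<Sum>l<dims D ! K. ?X $$ (ix ! K, l) * entry ?D (ix[K := l]))"
      using ix by (simp add: entry_mode_prod DK)
    also have "\<dots> = (\<Sum>l<dims D ! K. if l = offset (L K) r + ix ! K then entry ?D (ix[K := l]) else 0)"
      using \<open>ix ! K < L K r\<close> by (intro sum.cong) (auto simp: block_embed_def)
    also have "\<dots> = entry ?D (ix[K := offset (L K) r + ix ! K])" using lt by simp
    also have "\<dots> = entry D (map (\<lambda>n. if n < K then offset (L n) r + ix[K := offset (L K) r + ix ! K] ! n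
        else ix[K := offset (L K) r + ix ! K] ! n) [0..<?N])"
      unfolding diagonal_block_def
    proof (rule entry_tensor)
      have "K < length (dims ?D)" "offset (L K) r + ix ! K < dims ?D ! K"
        using Suc.prems(1) lt by (simp_all only: DK, simp add: dims)
      then show "ix[K := offset (L K) r + ix ! K]
        \<in> tensor_indices (map (\<lambda>n. if n < K then L n r else dims D ! n) [0..<?N])"
        using tensor_indices_fiber[OF ix] unfolding dims by blast
    qed
    also have "\<dots> = entry (diagonal_block (Suc K) L r D) ix"
      using ixS unfolding diagonal_block_def dims_tensor
      using len Suc.prems(1)
      by (subst entry_tensor) (auto intro!: arg_cong[of _ _ "entry D"] simp: nth_list_update less_Suc_eq
        simp del: upt_Suc)
    finally show "entry (diagonal_block (Suc K) L r D) ix = entry (mode_prod K ?D ?X) ix" by simp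
  qed
  then show ?case using Suc by simp
qed

section \<open>Polynomials of matrices applied in one mode or in all modes\<close>

lemma mode_prod_transpose_mult:
  fixes D :: "'a::comm_semiring_0 tensor"
  assumes "n < length (dims D)" "X \<in> carrier_mat (dims D ! n) k" "Y \<in> carrier_mat k l"
  shows "mode_prod n (mode_prod n D (transpose_mat X)) (transpose_mat Y) =
    mode_prod n D (transpose_mat (X * Y))"
  using assms by (simp add: mode_prod_assoc transpose_mult[of _ _ k])

text \<open>Products in different modes commute, so the equality passes from \<open>M\<close> and \<open>M'\<close> to their powers.\<close>

lemma mode_prod_poly_mat_eq:
  fixes A :: "'a::comm_ring_1 tensor"
  assumes m: "m < length (dims A)" "M \<in> carrier_mat (dims A ! m) (dims A ! m)"
    and n: "n < length (dims A)" "M' \<in> carrier_mat (dims A ! n) (dims A ! n)"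
    and "m \<noteq> n"
    and eq: "mode_prod m A (transpose_mat M) = mode_prod n A (transpose_mat M')"
  shows "mode_prod m A (transpose_mat (poly_mat f M)) = mode_prod n A (transpose_mat (poly_mat f M'))"
proof (induction f)
  case 0
  show ?case
  proof (rule tensor_eqI)
    have dims0: "dims (mode_prod k A (transpose_mat (0\<^sub>m (dims A ! k) (dims A ! k)))) = dims A" for k
      by simp
    then show "dims (mode_prod m A (transpose_mat (poly_mat 0 M))) = dims (mode_prod n A (transpose_mat (poly_mat 0 M')))"
      using m n by simp
    have 0: "entry (mode_prod k A (transpose_mat (0\<^sub>m (dims A ! k) (dims A ! k)))) ix = 0"
      if "k < length (dims A)" "ix \<in> tensor_indices (dims A)" for k ix
      using that by (subst entry_mode_prod) (auto simp: tensor_indices_def)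
    fix ix assume "ix \<in> tensor_indices (dims (mode_prod n A (transpose_mat (poly_mat 0 M'))))"
    then have "ix \<in> tensor_indices (dims A)" using n by simp
    then show "entry (mode_prod m A (transpose_mat (poly_mat 0 M))) ix = entry (mode_prod n A (transpose_mat (poly_mat 0 M'))) ix"
      using 0[OF m(1)] 0[OF n(1)] m n by simp
  qed
next
  case (pCons a f)
  let ?G = "poly_mat f M" and ?G' = "poly_mat f M'"
  note G = poly_mat_carrier[OF m(2), of f] and G' = poly_mat_carrier[OF n(2), of f]
  \<comment> \<open>Move \<open>M\<close> to mode \<open>n\<close> by \<open>eq\<close>, interchange
    the two modes, and move the remaining factor \<open>?G\<close> by the induction
    hypothesis.\<close>
  have "mode_prod m A (transpose_mat (M * ?G)) = mode_prod m (mode_prod n A (transpose_mat M')) (transpose_mat ?G)"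
    using m(1,2) G by (simp add: mode_prod_transpose_mult[symmetric] eq)
  also have "\<dots> = mode_prod n (mode_prod m A (transpose_mat ?G)) (transpose_mat M')"
    using m n \<open>m \<noteq> n\<close> by (intro mode_prod_commute)
  also have "\<dots> = mode_prod n A (transpose_mat (?G' * M'))"
    using n(1,2) G' by (simp add: mode_prod_transpose_mult pCons.IH)
  also have "?G' * M' = M' * ?G'" by (rule poly_mat_commute[OF n(2)])
  finally have step: "mode_prod m A (transpose_mat (M * ?G)) = mode_prod n A (transpose_mat (M' * ?G'))" .
  \<comment> \<open>The constant term contributes \<open>a * entry A ix\<close> whatever the mode,
    so it agrees on both sides.\<close>
  have split: "entry (mode_prod k A (transpose_mat (poly_mat (pCons a f) Z))) ix =
      a * entry A ix + entry (mode_prod k A (transpose_mat (Z * poly_mat f Z))) ix"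
    if k: "k < length (dims A)" and Z: "Z \<in> carrier_mat (dims A ! k) (dims A ! k)"
      and ix: "ix \<in> tensor_indices (dims A)" for k Z ix
  proof -
    note H = poly_mat_carrier[OF Z, of f]
    have tr: "transpose_mat (poly_mat (pCons a f) Z) = a \<cdot>\<^sub>m 1\<^sub>m (dims A ! k) + transpose_mat (Z * poly_mat f Z)"
      unfolding poly_mat_pCons[OF Z] using Z H by (intro eq_matI) auto
    have "mode_prod k A (a \<cdot>\<^sub>m 1\<^sub>m (dims A ! k)) = smult_tensor a A"
      using k by (simp add: mode_prod_smult mode_prod_one)
    then show ?thesis
      unfolding tr using k Z H ix
      by (subst entry_mode_prod_add[of _ _ _ "dims A ! k"]) (auto simp: smult_tensor_def)
  qed
  show ?case
  proof (rule tensor_eqI)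
    show "dims (mode_prod m A (transpose_mat (poly_mat (pCons a f) M))) =
        dims (mode_prod n A (transpose_mat (poly_mat (pCons a f) M')))"
      using poly_mat_carrier[OF m(2), of "pCons a f"] poly_mat_carrier[OF n(2), of "pCons a f"] by simp
    fix ix assume "ix \<in> tensor_indices (dims (mode_prod n A (transpose_mat (poly_mat (pCons a f) M'))))"
    then have "ix \<in> tensor_indices (dims A)" using poly_mat_carrier[OF n(2), of "pCons a f"] by simp
    then show "entry (mode_prod m A (transpose_mat (poly_mat (pCons a f) M))) ix =
        entry (mode_prod n A (transpose_mat (poly_mat (pCons a f) M'))) ix"
      using split[OF m] split[OF n] step by simp
  qed
qed

text \<open>Suppose that the modes before \<open>k\<close> have collapsed to one product. By
  \<open>eq\<close> it can be rewritten as the product with \<open>F k\<close> in mode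
  \<open>k\<close>, and there the next factor is absorbed by idempotence.\<close>

lemma mode_prods_idempotent:
  fixes A :: "'a::comm_ring_1 tensor"
  assumes "0 < K" "K \<le> length (dims A)"
    and F: "\<And>n. n < K \<Longrightarrow> F n \<in> carrier_mat (dims A ! n) (dims A ! n)"
    and idem: "\<And>n. n < K \<Longrightarrow> F n * F n = F n"
    and eq: "\<And>m n. m < K \<Longrightarrow> n < K \<Longrightarrow>
      mode_prod m A (transpose_mat (F m)) = mode_prod n A (transpose_mat (F n))"
    and "n < K"
  shows "mode_prods K A (\<lambda>n. transpose_mat (F n)) = mode_prod n A (transpose_mat (F n))"
proof -
  have "mode_prods k A (\<lambda>n. transpose_mat (F n)) = mode_prod 0 A (transpose_mat (F 0))"
    if "0 < k" "k \<le> K" for k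
    using that
  proof (induction k)
    case (Suc k)
    show ?case
    proof (cases "k = 0")
      case False
      have e: "mode_prod 0 A (transpose_mat (F 0)) = mode_prod k A (transpose_mat (F k))"
        using Suc.prems by (intro eq) auto
      have IH: "mode_prods k A (\<lambda>n. transpose_mat (F n)) = mode_prod 0 A (transpose_mat (F 0))"
        using False Suc by simp
      have "mode_prods (Suc k) A (\<lambda>n. transpose_mat (F n)) =
          mode_prod k (mode_prod k A (transpose_mat (F k))) (transpose_mat (F k))"
        by (simp only: mode_prods_Suc IH e)
      also have "\<dots> = mode_prod k A (transpose_mat (F k))"
        using mode_prod_transpose_mult[of k A "F k" _ "F k"] F[of k] idem[of k] Suc.prems assms(2) by simp
      also have "\<dots> = mode_prod 0 A (transpose_mat (F 0))" by (rule e[symmetric])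
      finally show ?thesis .
    qed simp
  qed simp
  from this[of K] eq[of 0 n] show ?thesis using assms(1,6) by (metis order_refl)
qed

section \<open>Full column rank and bases of kernels\<close>

lemma mat_rank_mult_le:
  assumes G: "G \<in> carrier_mat m k" and Y: "Y \<in> carrier_mat k n"
  shows "mat_rank (G * Y) \<le> mat_rank G"
proof -
  interpret V: vec_space "TYPE('a)" m .
  have GY: "G * Y \<in> carrier_mat m n" using G Y by simp
  have sub: "V.span (set (cols (G * Y))) \<subseteq> V.span (set (cols G))"
  proof -
    have "V.col_space (G * Y) \<subseteq> V.col_space G"
      unfolding V.col_space_eq[OF GY] V.col_space_eq[OF G]
      using G Y by (auto intro!: bexI[of _ "Y *\<^sub>v _"] assoc_mult_mat_vec[symmetric])
    then show ?thesis unfolding V.col_space_def .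
  qed
  have subs: "VectorSpace.subspace class_ring (V.span (set (cols X))) V.V" if "X \<in> carrier_mat m l" for X l
    using that by (metis V.span_is_subspace cols_dim carrier_matD(1))
  have "V.rank (G * Y) \<le> V.rank G"
    unfolding V.rank_def
    using vectorspace.subspace_dim[OF V.subspace_is_vs[OF subs[OF G]]
        V.nested_subspaces[OF subs[OF G] subs[OF GY] sub]
        V.fin_dim_span_cols[OF G]] V.fin_dim_span_cols[OF GY] by simp
  then show ?thesis unfolding mat_rank_def using G by simp
qed

text \<open>The rank sees only the set of columns: a maximal independent subset has \<open>n\<close>
  elements, so the \<open>n\<close> columns cannot repeat. The results on independent columns speak
  about this set and therefore need distinctness.\<close>

lemma full_column_rank_distinct:
  assumes A: "A \<in> carrier_mat m n" and "full_column_rank A"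
  shows "distinct (cols A)"
proof -
  interpret V: vec_space "TYPE('a)" m .
  have rk: "V.rank A = n" using assms by (simp add: full_column_rank_def mat_rank_def)
  obtain S where S: "maximal S (\<lambda>T. T \<subseteq> set (cols A) \<and> V.lin_indpt T)"
    using maximal_exists[of "(\<lambda>T. T \<subseteq> set (cols A) \<and> V.lin_indpt T)" "card (set (cols A))" "{}"]
    by (meson List.finite_set card_mono empty_iff empty_subsetI V.finite_lin_indpt2 rev_finite_subset)
  then have "card S \<le> card (set (cols A))" by (simp add: card_mono maximal_def)
  then have "n \<le> card (set (cols A))" using V.rank_card_indpt[OF A S] rk by simp
  then show ?thesis using A card_length[of "cols A"] by (intro card_distinct) auto
qed

lemma full_column_rank_iff:
  assumes A: "A \<in> carrier_mat m n"
  shows "full_column_rank A \<longleftrightarrow> (\<forall>v\<in>carrier_vec n. A *\<^sub>v v = 0\<^sub>v m \<longrightarrow> v = 0\<^sub>v n)"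
proof -
  interpret V: vec_space "TYPE('a)" m .
  have fcr: "full_column_rank A \<longleftrightarrow> V.rank A = n"
    using A by (simp add: full_column_rank_def mat_rank_def)
  show ?thesis
  proof
    assume "full_column_rank A"
    then have rk: "V.rank A = n" by (simp add: fcr)
    have "distinct (cols A)" by (rule full_column_rank_distinct[OF A \<open>full_column_rank A\<close>])
    with V.full_rank_lin_indpt[OF A rk this] V.lin_depI[OF A]
    show "\<forall>v\<in>carrier_vec n. A *\<^sub>v v = 0\<^sub>v m \<longrightarrow> v = 0\<^sub>v n" by blast
  next
    assume inj: "\<forall>v\<in>carrier_vec n. A *\<^sub>v v = 0\<^sub>v m \<longrightarrow> v = 0\<^sub>v n"
    have dist: "distinct (cols A)"
      unfolding distinct_conv_nth
    proof (intro allI impI notI)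
      fix i j assume ij: "i < length (cols A)" "j < length (cols A)" "i \<noteq> j" "cols A ! i = cols A ! j"
      then have l: "i < n" "j < n" and eq: "col A i = col A j" using A by auto
      \<comment> \<open>Two equal columns put the difference of two unit vectors into the
        kernel.\<close>
      define v where "v = (unit_vec n i - unit_vec n j :: 'a vec)"
      have "A *\<^sub>v v = A *\<^sub>v unit_vec n i - A *\<^sub>v unit_vec n j"
        unfolding v_def using A by (intro mult_minus_distrib_mat_vec) auto
      also have "A *\<^sub>v unit_vec n i = col A i" using A l by (intro eq_vecI) auto
      also have "A *\<^sub>v unit_vec n j = col A i" unfolding eq using A l by (intro eq_vecI) auto
      finally have "A *\<^sub>v v = 0\<^sub>v m" using A by auto
      then have "v = 0\<^sub>v n" using inj by (simp add: v_def)
      then have "v $ i = 0" using l by simp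
      then show False using l ij(3) by (simp add: v_def)
    qed
    have "V.lin_indpt (set (cols A))" using V.lin_depE[OF A _ dist] inj by blast
    then show "full_column_rank A" unfolding fcr by (rule V.lin_indpt_full_rank[OF A dist])
  qed
qed

lemma full_column_rank_mult_cancel:
  assumes A: "A \<in> carrier_mat m n" and full: "full_column_rank A"
    and X: "X \<in> carrier_mat n k" and Y: "Y \<in> carrier_mat n k" and eq: "A * X = A * Y"
  shows "X = Y"
proof (rule mat_col_eqI)
  fix j assume "j < dim_col Y"
  then have j: "j < k" using Y by simp
  have "A *\<^sub>v (col X j - col Y j) = A *\<^sub>v col X j - A *\<^sub>v col Y j"
    using A X Y by (intro mult_minus_distrib_mat_vec) auto
  also have "A *\<^sub>v col X j = A *\<^sub>v col Y j"
    unfolding col_mult2[OF A X j, symmetric] col_mult2[OF A Y j, symmetric] eq ..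
  finally have "A *\<^sub>v (col X j - col Y j) = 0\<^sub>v m" using A Y by auto
  moreover have "col X j - col Y j \<in> carrier_vec n"
    using X Y by (intro minus_carrier_vec) (auto intro: col_carrier_vec)
  ultimately have "col X j - col Y j = 0\<^sub>v n"
    using full unfolding full_column_rank_iff[OF A] by blast
  then have "(col X j - col Y j) $ i = 0" if "i < n" for i using that by simp
  then show "col X j = col Y j" using X Y by (intro eq_vecI) auto
qed (use X Y in auto)

lemma full_column_rank_mult:
  assumes A: "A \<in> carrier_mat m n" and X: "X \<in> carrier_mat n k"
    and "full_column_rank A" "full_column_rank X"
  shows "full_column_rank (A * X)"
proof -
  have AX: "A * X \<in> carrier_mat m k" using A X by simp
  show ?thesis unfolding full_column_rank_iff[OF AX]
  proof (intro ballI impI)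
    fix v assume v: "v \<in> carrier_vec k" "A * X *\<^sub>v v = 0\<^sub>v m"
    then have "A *\<^sub>v (X *\<^sub>v v) = 0\<^sub>v m" using A X by (simp add: assoc_mult_mat_vec[of _ m n _ k])
    moreover have "X *\<^sub>v v \<in> carrier_vec n" using X v by simp
    ultimately have "X *\<^sub>v v = 0\<^sub>v n" using assms(3) unfolding full_column_rank_iff[OF A] by blast
    then show "v = 0\<^sub>v k" using assms(4) v unfolding full_column_rank_iff[OF X] by blast
  qed
qed

lemma full_column_rank_left_inverse:
  assumes X: "X \<in> carrier_mat n k" and Y: "Y \<in> carrier_mat k n" and "Y * X = 1\<^sub>m k"
  shows "full_column_rank X"
  unfolding full_column_rank_iff[OF X]
proof (intro ballI impI)
  fix v assume v: "v \<in> carrier_vec k" "X *\<^sub>v v = 0\<^sub>v n"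
  have "v = Y * X *\<^sub>v v" using assms(3) v by simp
  also have "\<dots> = Y *\<^sub>v (X *\<^sub>v v)" using X Y v by (intro assoc_mult_mat_vec)
  also have "\<dots> = 0\<^sub>v k" unfolding v(2) using Y by (intro eq_vecI) auto
  finally show "v = 0\<^sub>v k" .
qed

section \<open>Bases of kernels in terms of matrices\<close>

lemma kernel_basis_factor:
  assumes A: "A \<in> carrier_mat n n" and X: "X \<in> carrier_mat n k" and Y: "Y \<in> carrier_mat n l"
    and span: "\<And>v. v \<in> carrier_vec n \<Longrightarrow> A *\<^sub>v v = 0\<^sub>v n \<Longrightarrow> \<exists>w\<in>carrier_vec k. v = X *\<^sub>v w"
    and AY: "A * Y = 0\<^sub>m n l"
  shows "\<exists>W\<in>carrier_mat k l. Y = X * W"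
proof -
  have "\<exists>w\<in>carrier_vec k. col Y j = X *\<^sub>v w" if "j < l" for j
  proof (rule span)
    show "col Y j \<in> carrier_vec n" using Y by (auto intro: col_carrier_vec)
    have "A *\<^sub>v col Y j = col (A * Y) j" by (rule col_mult2[OF A Y that, symmetric])
    then show "A *\<^sub>v col Y j = 0\<^sub>v n" unfolding AY using that by simp
  qed
  then obtain w where w: "\<And>j. j < l \<Longrightarrow> w j \<in> carrier_vec k" "\<And>j. j < l \<Longrightarrow> col Y j = X *\<^sub>v w j"
    by metis
  define W where "W = mat k l (\<lambda>(i, j). w j $ i)"
  have W: "W \<in> carrier_mat k l" by (simp add: W_def)
  have colW: "col W j = w j" if "j < l" for j using w(1)[OF that] that by (intro eq_vecI) (auto simp: W_def)
  have "Y = X * W"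
  proof (rule mat_col_eqI)
    fix j assume "j < dim_col (X * W)"
    then have j: "j < l" using W by simp
    show "col Y j = col (X * W) j"
      unfolding col_mult2[OF X W j] colW[OF j] by (rule w(2)[OF j])
  qed (use X Y W in auto)
  with W show ?thesis by blast
qed

text \<open>With its converse \<open>kernel_basisD\<close>, this trades a basis of the kernel as a
  vector space for three matrix facts: \<open>A * X = 0\<close>, full column rank, and solvability
  of \<open>v = X w\<close> for every \<open>v\<close> in the kernel. Span and independence do not
  change between the kernel and the ambient space.\<close>

lemma kernel_basisI:
  assumes A: "A \<in> carrier_mat n n" and X: "X \<in> carrier_mat n k"
    and AX: "A * X = 0\<^sub>m n k" and full: "full_column_rank X"
    and span: "\<And>v. v \<in> carrier_vec n \<Longrightarrow> A *\<^sub>v v = 0\<^sub>v n \<Longrightarrow> \<exists>w\<in>carrier_vec k. v = X *\<^sub>v w"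
  shows "distinct (cols X)" "kernel.basis n A (set (cols X))"
proof -
  interpret K: kernel n n A by unfold_locales (rule A)
  have rk: "K.NC.rank X = n \<longleftrightarrow> n = k" for n using full X unfolding full_column_rank_def mat_rank_def by auto
  have Xker: "set (cols X) \<subseteq> mat_kernel A"
  proof
    fix v assume "v \<in> set (cols X)"
    then obtain j where j: "j < k" "v = col X j" using X by (auto simp: cols_def)
    have "A *\<^sub>v v = col (A * X) j" unfolding j(2) by (rule col_mult2[OF A X j(1), symmetric])
    then show "v \<in> mat_kernel A" using AX j X by (intro mat_kernelI[OF A]) auto
  qed
  show dist: "distinct (cols X)" by (rule full_column_rank_distinct[OF X full])
  have "K.lin_indpt (set (cols X))"
    unfolding K.lindep_same[OF Xker] using K.NC.full_rank_lin_indpt[OF X _ dist] rk by auto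
  moreover have "K.span (set (cols X)) = mat_kernel A"
  proof -
    have "K.span (set (cols X)) = K.NC.col_space X"
      unfolding K.span_same[OF Xker] K.NC.col_space_def ..
    also have "\<dots> = mat_kernel A"
      unfolding K.NC.col_space_eq[OF X]
    proof (intro subset_antisym subsetI)
      fix v assume "v \<in> {y \<in> carrier_vec (dim_row X). \<exists>x\<in>carrier_vec (dim_col X). X *\<^sub>v x = y}"
      then obtain w where w: "w \<in> carrier_vec k" "v = X *\<^sub>v w" using X by auto
      then have "A *\<^sub>v v = A * X *\<^sub>v w" using A X by (simp add: assoc_mult_mat_vec[of _ n n _ k])
      then show "v \<in> mat_kernel A" using w X by (intro mat_kernelI[OF A]) (auto simp: AX)
    next
      fix v assume "v \<in> mat_kernel A"
      from mat_kernelD[OF A this] span X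
      show "v \<in> {y \<in> carrier_vec (dim_row X). \<exists>x\<in>carrier_vec (dim_col X). X *\<^sub>v x = y}"
        by (metis (mono_tags, lifting) carrier_matD mem_Collect_eq)
    qed
    finally show ?thesis .
  qed
  ultimately show "K.basis (set (cols X))" unfolding K.Ker.basis_def using Xker by auto
qed

lemma kernel_basisD:
  assumes A: "A \<in> carrier_mat n n" and X: "X \<in> carrier_mat n k"
    and dist: "distinct (cols X)" and basis: "kernel.basis n A (set (cols X))"
  shows "A * X = 0\<^sub>m n k" "full_column_rank X"
    "\<And>v. v \<in> carrier_vec n \<Longrightarrow> A *\<^sub>v v = 0\<^sub>v n \<Longrightarrow> \<exists>w\<in>carrier_vec k. v = X *\<^sub>v w"
proof -
  interpret K: kernel n n A by unfold_locales (rule A)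
  have Xker: "set (cols X) \<subseteq> mat_kernel A" and li: "K.lin_indpt (set (cols X))"
    and gen: "K.span (set (cols X)) = mat_kernel A"
    using basis unfolding K.Ker.basis_def by auto
  show "A * X = 0\<^sub>m n k"
  proof (rule mat_col_eqI)
    fix j assume "j < dim_col (0\<^sub>m n k :: 'a mat)"
    then have j: "j < k" by simp
    then have "col X j \<in> mat_kernel A"
      using Xker X by (metis carrier_matD(2) cols_length cols_nth nth_mem subsetD)
    then show "col (A * X) j = col (0\<^sub>m n k) j"
      unfolding col_mult2[OF A X j] using mat_kernelD[OF A] j by simp
  qed (use A X in auto)
  have "K.NC.lin_indpt (set (cols X))" using li unfolding K.lindep_same[OF Xker] .
  from K.NC.lin_indpt_full_rank[OF X dist this] show "full_column_rank X"
    using X unfolding full_column_rank_def mat_rank_def by simp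
  fix v assume "v \<in> carrier_vec n" "A *\<^sub>v v = 0\<^sub>v n"
  then have "v \<in> mat_kernel A" by (rule mat_kernelI[OF A])
  then have "v \<in> K.NC.col_space X"
    unfolding K.NC.col_space_def K.span_same[OF Xker, symmetric] gen .
  then show "\<exists>w\<in>carrier_vec k. v = X *\<^sub>v w"
    unfolding K.NC.col_space_eq[OF X] using X by auto
qed

lemma kernel_basis_matrix_exists:
  assumes A: "A \<in> carrier_mat n n"
  shows "\<exists>X \<in> carrier_mat n (kernel_dim A).
    distinct (cols X) \<and> kernel.basis n A (set (cols X))"
proof -
  interpret K: kernel n n A by unfold_locales (rule A)
  obtain B where fin: "finite B" and B: "K.basis B" using kernel_basis_exists[OF A] by blast
  obtain xs where xs: "set xs = B" "distinct xs" using finite_distinct_list[OF fin] by blast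
  have Bker: "B \<subseteq> mat_kernel A" using B unfolding K.Ker.basis_def by auto
  have len: "length xs = kernel_dim A"
    using K.Ker.dim_basis[OF fin B] xs distinct_card[OF xs(2)] by simp
  have sub: "set xs \<subseteq> carrier_vec n" using Bker xs mat_kernel[OF A] by auto
  show ?thesis
  proof (intro bexI conjI)
    show "mat_of_cols n xs \<in> carrier_mat n (kernel_dim A)" unfolding len[symmetric] by simp
  qed (simp_all only: cols_mat_of_cols[OF sub] xs B)
qed

text \<open>Compare the traces of the two products.\<close>

lemma two_sided_inverse_imp_square:
  fixes S :: "'a::{field, ring_char_0} mat"
  assumes S: "S \<in> carrier_mat n m" and Z: "Z \<in> carrier_mat m n"
    and SZ: "S * Z = 1\<^sub>m n" and ZS: "Z * S = 1\<^sub>m m"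
  shows "n = m"
proof -
  have "(of_nat n :: 'a) = (\<Sum>i<n. (S * Z) $$ (i, i))" by (simp add: SZ)
  also have "\<dots> = (\<Sum>i<n. \<Sum>j<m. S $$ (i, j) * Z $$ (j, i))"
    using S Z by (intro sum.cong) (auto simp: scalar_prod_def lessThan_atLeast0)
  also have "\<dots> = (\<Sum>j<m. \<Sum>i<n. Z $$ (j, i) * S $$ (i, j))"
    by (subst sum.swap) (simp add: mult.commute)
  also have "\<dots> = (\<Sum>j<m. (Z * S) $$ (j, j))"
    using S Z by (intro sum.cong) (auto simp: scalar_prod_def lessThan_atLeast0)
  also have "\<dots> = of_nat m" by (simp add: ZS)
  finally show ?thesis by (simp only: of_nat_eq_iff)
qed

section \<open>Primary decompositions\<close>

text \<open>The result has \<open>offset L R\<close> columns. When bases of the primary components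
  are put side by side, it is not yet known that this number is \<open>d\<close>.\<close>

lemma block_columns_exist:
  assumes X: "\<And>r. r < R \<Longrightarrow> X r \<in> carrier_mat d (L r)"
  shows "\<exists>S \<in> carrier_mat d (offset L R).
    \<forall>r<R. S * block_embed (offset L R) L r = (X r :: 'a::semiring_1 mat)"
proof -
  define S where "S = mat d (offset L R) (\<lambda>(i, j).
    let r = (THE r. r < R \<and> j \<in> block_range L r) in X r $$ (i, j - offset L r))"
  have S: "S \<in> carrier_mat d (offset L R)" by (simp add: S_def)
  have "S * block_embed (offset L R) L r = X r" if r: "r < R" for r
  proof (rule eq_matI)
    fix i j assume "i < dim_row (X r)" "j < dim_col (X r)"
    then have i: "i < d" and j: "j < L r" using X[OF r] by auto
    have "(THE s. s < R \<and> offset L r + j \<in> block_range L s) = r"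
    proof (rule the_equality)
      show "r < R \<and> offset L r + j \<in> block_range L r" using r j by (simp add: block_range_def)
      fix s assume s: "s < R \<and> offset L r + j \<in> block_range L s"
      then show "s = r"
        using offset_add_inj(1)[of L s "offset L r + j - offset L s" r j] j by (auto simp: block_range_def)
    qed
    then show "(S * block_embed (offset L R) L r) $$ (i, j) = X r $$ (i, j)"
      unfolding mult_block_embed_index[OF S r i j]
      using i offset_add_less[of r R j L, OF r j] by (simp add: S_def)
  qed (use S X[OF r] in auto)
  with S show ?thesis by blast
qed

lemma poly_mat_eq_one:
  assumes M: "M \<in> carrier_mat n n" and "poly_mat p M = 0\<^sub>m n n" "p dvd f - 1"
  shows "poly_mat f M = 1\<^sub>m n"
proof -
  have "poly_mat f M = poly_mat (f - 1) M + poly_mat 1 M"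
    using poly_mat_add[OF M, of "f - 1" 1] by simp
  then show ?thesis using poly_mat_dvd_zero[OF M assms(3,2)] M by simp
qed

text \<open>Restates a primary decomposition through the block columns \<open>S * P_r\<close> and
  the block rows \<open>P_r^T * inv_mat S\<close>, where \<open>P_r\<close> is the inclusion. That
  the primary factor annihilates \<open>T r\<close> follows by cancelling \<open>S * P_r\<close>,
  which has a left inverse, from the intertwining relation.\<close>

lemma primary_decompositionD:
  assumes M: "(M :: 'a::field mat) \<in> carrier_mat d d" and pd: "primary_decomposition M R p \<mu> L S T"
  shows "S \<in> carrier_mat d d" "invertible_mat S" "offset L R = d"
    "\<And>r. r < R \<Longrightarrow> T r \<in> carrier_mat (L r) (L r)"
    "\<And>r. r < R \<Longrightarrow> col_block S L r = S * block_embed d L r"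
    "\<And>r. r < R \<Longrightarrow> M * (S * block_embed d L r) = S * block_embed d L r * T r"
    "\<And>r. r < R \<Longrightarrow> transpose_mat (block_embed d L r) * inv_mat S * (S * block_embed d L r) = 1\<^sub>m (L r)"
    "\<And>r. r < R \<Longrightarrow> poly_mat (p r ^ \<mu> r) (T r) = 0\<^sub>m (L r) (L r)"
    "\<And>r. r < R \<Longrightarrow> distinct (cols (S * block_embed d L r))"
    "\<And>r. r < R \<Longrightarrow> kernel.basis d (poly_mat (p r ^ \<mu> r) M) (set (cols (S * block_embed d L r)))"
proof -
  show S: "S \<in> carrier_mat d d" and inv: "invertible_mat S" and off: "offset L R = d"
    and T: "\<And>r. r < R \<Longrightarrow> T r \<in> carrier_mat (L r) (L r)"
    using pd M unfolding primary_decomposition_def offset_def by auto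
  fix r assume r: "r < R"
  let ?P = "block_embed d L r :: 'a mat"
  show cb: "col_block S L r = S * ?P" using col_block_eq[of S d L R r] S r off by simp
  show MU: "M * (S * ?P) = S * ?P * T r"
    using pd r unfolding primary_decomposition_def cb[symmetric] by blast
  note i = inv_mat[OF S inv]
  have P: "?P \<in> carrier_mat d (L r)" by simp
  have "transpose_mat ?P * inv_mat S * (S * ?P) = transpose_mat ?P * (inv_mat S * (S * ?P))"
    using i S P by (intro assoc_mult_mat[of _ "L r" d _ d _ "L r"]) auto
  also have "inv_mat S * (S * ?P) = inv_mat S * S * ?P"
    using i S P by (intro assoc_mult_mat[symmetric]) auto
  also have "transpose_mat ?P * \<dots> = 1\<^sub>m (L r)"
    using block_embed_orthogonal[of r R r L] r off P i by simp
  finally show VU: "transpose_mat ?P * inv_mat S * (S * ?P) = 1\<^sub>m (L r)" .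
  have U: "S * ?P \<in> carrier_mat d (L r)" using S by simp
  have full: "full_column_rank (S * ?P)"
    using i by (intro full_column_rank_left_inverse[OF U _ VU]) auto
  have "distinct (cols (S * ?P)) \<and>
      kernel.basis d (poly_mat (p r) M ^\<^sub>m \<mu> r) (set (cols (S * ?P)))"
    using pd r M unfolding primary_decomposition_def cb[symmetric] carrier_mat_def by blast
  then show dist: "distinct (cols (S * ?P))"
    and basis: "kernel.basis d (poly_mat (p r ^ \<mu> r) M) (set (cols (S * ?P)))"
    by (simp_all only: poly_mat_power[OF M])
  have "S * ?P * poly_mat (p r ^ \<mu> r) (T r) = S * ?P * 0\<^sub>m (L r) (L r)"
    unfolding poly_mat_intertwine[OF M T[OF r] U MU, symmetric] right_mult_zero_mat[OF U]
    by (rule kernel_basisD(1)[OF poly_mat_carrier[OF M] U dist basis])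
  then show "poly_mat (p r ^ \<mu> r) (T r) = 0\<^sub>m (L r) (L r)"
    by (rule full_column_rank_mult_cancel[OF U full poly_mat_carrier[OF T[OF r]] zero_carrier_mat])
qed

text \<open>It suffices to compare both sides on the columns of each block \<open>s\<close>. There
  \<open>f(M)\<close> acts as \<open>f(T s)\<close>, which is \<open>1\<close> for
  \<open>s = r\<close> and \<open>0\<close> otherwise because the \<open>s\<close>th primary factor
  annihilates \<open>T s\<close>; on the other side the inclusions are orthogonal.\<close>

lemma primary_decomposition_projection:
  assumes M: "(M :: 'a::field mat) \<in> carrier_mat d d" and pd: "primary_decomposition M R p \<mu> L S T"
    and r: "r < R" and f1: "p r ^ \<mu> r dvd f - 1"
    and f0: "\<And>s. s < R \<Longrightarrow> r \<noteq> s \<Longrightarrow> p s ^ \<mu> s dvd f"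
  shows "poly_mat f M = S * block_embed d L r * (transpose_mat (block_embed d L r) * inv_mat S)"
proof -
  note D = primary_decompositionD[OF M pd]
  note i = inv_mat[OF D(1,2)]
  let ?P = "\<lambda>s. block_embed d L s :: 'a mat"
  let ?U = "S * ?P r" and ?V = "transpose_mat (?P r) * inv_mat S"
  have car: "?U \<in> carrier_mat d (L r)" "?V \<in> carrier_mat (L r) d"
    "?P s \<in> carrier_mat d (L s)" "transpose_mat (?P r) \<in> carrier_mat (L r) d" for s
    using D(1) i by auto
  note fM = poly_mat_carrier[OF M, of f]
  have "poly_mat f M * S = ?U * ?V * S"
  proof (rule eq_mat_blocksI[where L = L and R = R and m = d])
    fix s assume s: "s < R"
    have US: "S * ?P s \<in> carrier_mat d (L s)" using D(1) by simp
    have "poly_mat f M * S * ?P s = poly_mat f M * (S * ?P s)"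
      using fM D(1) car by (intro assoc_mult_mat) auto
    also have "\<dots> = S * ?P s * poly_mat f (T s)"
      by (rule poly_mat_intertwine[OF M D(4)[OF s] US D(6)[OF s]])
    also have "poly_mat f (T s) = (if r = s then 1\<^sub>m (L s) else 0\<^sub>m (L s) (L s))"
      using poly_mat_eq_one[OF D(4)[OF s] D(8)[OF s], of f] poly_mat_dvd_zero[OF D(4)[OF s] _ D(8)[OF s], of f]
        f0[OF s] f1 by auto
    \<comment> \<open>For \<open>r \<noteq> s\<close> both products vanish; the right-hand one has
      the shape in which the orthogonality of the inclusions applies.\<close>
    also have "S * ?P s * \<dots> = ?U * (if r = s then 1\<^sub>m (L s) else 0\<^sub>m (L r) (L s))"
      using US car(1) by auto
    also have "\<dots> = ?U * (transpose_mat (?P r) * ?P s)"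
      by (simp only: block_embed_orthogonal[OF r s, of L, unfolded D(3)])
    also have "transpose_mat (?P r) * ?P s = ?V * S * ?P s"
      by (simp only: assoc_mult_mat[OF car(4) i(1) D(1)] i(3) right_mult_one_mat[OF car(4)])
    also have "?U * (?V * S * ?P s) = ?U * (?V * S) * ?P s"
      using car D(1) by (intro assoc_mult_mat[symmetric, of _ d "L r" _ d]) auto
    also have "?U * (?V * S) = ?U * ?V * S"
      using car D(1) by (intro assoc_mult_mat[symmetric]) auto
    finally show "poly_mat f M * S * block_embed (offset L R) L s = ?U * ?V * S * block_embed (offset L R) L s"
      using D(3) by simp
  qed (use fM D(1,3) car in auto)
  then have "poly_mat f M * S * inv_mat S = ?U * ?V * S * inv_mat S" by simp
  moreover have "Y * S * inv_mat S = Y" if "Y \<in> carrier_mat d d" for Y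
    using that i D(1) by (simp add: assoc_mult_mat[of _ d d _ d])
  moreover have "?U * ?V \<in> carrier_mat d d" using car by simp
  ultimately show ?thesis using fM by simp
qed

text \<open>If \<open>g\<close> annihilates \<open>T r\<close>, then \<open>g * f r\<close>
  annihilates \<open>M\<close>, because \<open>f r(M)\<close> projects onto the \<open>r\<close>th
  component. Hence the \<open>r\<close>th primary factor divides \<open>g * f r\<close>, and as
  \<open>f r\<close> is \<open>1\<close> modulo that factor, it divides \<open>g\<close>.\<close>

lemma primary_decomposition_minimal_polynomial:
  assumes M: "(M :: 'a::field mat) \<in> carrier_mat d d" and pd: "primary_decomposition M R p \<mu> L S T"
    and q: "minimal_polynomial M q" and fac: "irreducible_factorization q R p \<mu>" and r: "r < R"
  shows "minimal_polynomial (T r) (p r ^ \<mu> r)"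
proof -
  note D = primary_decompositionD[OF M pd]
  note i = inv_mat[OF D(1,2)]
  obtain f where f: "\<And>r. r < R \<Longrightarrow> p r ^ \<mu> r dvd f r - 1"
    "\<And>r s. r < R \<Longrightarrow> s < R \<Longrightarrow> r \<noteq> s \<Longrightarrow> p s ^ \<mu> s dvd f r"
    by (rule irreducible_factorization_idempotents[OF fac]) (rule that)
  let ?U = "S * block_embed d L r" and ?V = "transpose_mat (block_embed d L r) * inv_mat S"
  have U: "?U \<in> carrier_mat d (L r)" and V: "?V \<in> carrier_mat (L r) d" using D(1) i by auto
  show ?thesis
  proof (rule minimal_polynomialI[OF D(4)[OF r] _ D(8)[OF r]])
    show "lead_coeff (p r ^ \<mu> r) = 1"
      using fac r unfolding irreducible_factorization_def by (simp add: lead_coeff_power)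
    fix g assume g: "poly_mat g (T r) = 0\<^sub>m (L r) (L r)"
    have "poly_mat (g * f r) M = poly_mat g M * (?U * ?V)"
      unfolding poly_mat_mult[OF M]
      using primary_decomposition_projection[OF M pd r f(1)[OF r] f(2)[OF r]] by simp
    also have "\<dots> = poly_mat g M * ?U * ?V"
      using poly_mat_carrier[OF M] U V by (intro assoc_mult_mat[symmetric])
    also have "poly_mat g M * ?U = 0\<^sub>m d (L r)"
      unfolding poly_mat_intertwine[OF M D(4)[OF r] U D(6)[OF r]] g by (rule right_mult_zero_mat[OF U])
    also have "0\<^sub>m d (L r) * ?V = 0\<^sub>m d d" by (rule left_mult_zero_mat[OF V])
    finally have "poly_mat (g * f r) M = 0\<^sub>m d d" .
    then have "q dvd g * f r" by (rule minimal_polynomialD(3)[OF M q])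
    moreover have "p r ^ \<mu> r dvd q"
      using fac r unfolding irreducible_factorization_def by (auto intro: dvd_prodI)
    ultimately have "p r ^ \<mu> r dvd g * f r" by (metis dvd_trans)
    moreover have "p r ^ \<mu> r dvd g * (f r - 1)" using f(1)[OF r] by simp
    ultimately have "p r ^ \<mu> r dvd g * f r - g * (f r - 1)" by (rule dvd_diff)
    then show "p r ^ \<mu> r dvd g" by (simp add: algebra_simps)
  qed
qed

text \<open>The columns of \<open>S\<close> are bases \<open>X r\<close> of the primary kernels. Its
  inverse is explicit: stack the coordinate matrices \<open>W r\<close> of the projections
  \<open>f r(M) = X r * W r\<close>. Once both products with \<open>S\<close> are identities,
  \<open>S\<close> is square, so the dimensions of the components add up without a separate
  dimension count.\<close>

lemma primary_decomposition_exists: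
  assumes M: "(M :: 'a::{field, ring_char_0} mat) \<in> carrier_mat d d"
    and q: "minimal_polynomial M q" and fac: "irreducible_factorization q R p \<mu>"
    and L: "\<And>r. r < R \<Longrightarrow> L r = kernel_dim (poly_mat (p r) M ^\<^sub>m \<mu> r)"
  shows "\<exists>S T. primary_decomposition M R p \<mu> L S T"
proof -
  define k where "k r = p r ^ \<mu> r" for r
  have kM: "poly_mat (p r) M ^\<^sub>m \<mu> r = poly_mat (k r) M" for r
    by (simp add: k_def poly_mat_power[OF M])
  note car = poly_mat_carrier[OF M]
  obtain f where f: "\<And>r. r < R \<Longrightarrow> k r dvd f r - 1"
    "\<And>r s. r < R \<Longrightarrow> s < R \<Longrightarrow> r \<noteq> s \<Longrightarrow> k s dvd f r" and fsum: "q dvd (\<Sum>r<R. f r) - 1"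
    by (rule irreducible_factorization_idempotents[OF fac, folded k_def]) (rule that)
  have "\<exists>X\<in>carrier_mat d (L r). distinct (cols X) \<and> kernel.basis d (poly_mat (k r) M) (set (cols X))"
    if "r < R" for r
    using kernel_basis_matrix_exists[OF car, of "k r"] L[OF that] unfolding kM by simp
  then obtain X where X: "\<And>r. r < R \<Longrightarrow> X r \<in> carrier_mat d (L r)"
    and dist: "\<And>r. r < R \<Longrightarrow> distinct (cols (X r))"
    and basis: "\<And>r. r < R \<Longrightarrow> kernel.basis d (poly_mat (k r) M) (set (cols (X r)))" by metis
  note XD = kernel_basisD[OF car X dist basis]
  \<comment> \<open>\<open>M\<close> commutes with \<open>k r(M)\<close>, so the kernel is
    invariant, and \<open>T r\<close> holds the coordinates of \<open>M * X r\<close>.\<close>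
  have "\<exists>T\<in>carrier_mat (L r) (L r). M * X r = X r * T" if r: "r < R" for r
  proof (rule kernel_basis_factor[OF car X[OF r] _ XD(3)[OF r r r]])
    show "M * X r \<in> carrier_mat d (L r)" using M X[OF r] by simp
    have "poly_mat (k r) M * (M * X r) = poly_mat (k r) M * M * X r"
      by (rule assoc_mult_mat[OF car M X[OF r], symmetric])
    also have "\<dots> = M * (poly_mat (k r) M * X r)"
      unfolding poly_mat_commute[OF M] by (rule assoc_mult_mat[OF M car X[OF r]])
    finally show "poly_mat (k r) M * (M * X r) = 0\<^sub>m d (L r)" using XD(1)[OF r r r] M by simp
  qed
  then obtain T where T: "\<And>r. r < R \<Longrightarrow> T r \<in> carrier_mat (L r) (L r)"
    and MX: "\<And>r. r < R \<Longrightarrow> M * X r = X r * T r" by metis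
  \<comment> \<open>Every primary factor divides \<open>k r * f r\<close>, hence so does
    \<open>q\<close>, and the columns of \<open>f r(M)\<close> lie in the \<open>r\<close>th
    kernel.\<close>
  have "\<exists>W\<in>carrier_mat (L r) d. poly_mat (f r) M = X r * W" if r: "r < R" for r
  proof (rule kernel_basis_factor[OF car X[OF r] car XD(3)[OF r r r]])
    have "q dvd k r * f r"
    proof -
      have "(\<Prod>s<R. k s) dvd k r * f r"
      proof (rule comaximal_prod_dvd)
        fix s t assume "s \<in> {..<R}" "t \<in> {..<R}" "s \<noteq> t"
        then show "comaximal (k s) (k t)"
          using irreducible_factorization_comaximal[OF fac] unfolding k_def by auto
      next
        fix s assume "s \<in> {..<R}"
        then show "k s dvd k r * f r" using f(2)[OF r, of s] by (cases "s = r") auto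
      qed simp
      then show ?thesis using fac unfolding irreducible_factorization_def k_def by simp
    qed
    then have "poly_mat (k r * f r) M = 0\<^sub>m d d"
      using poly_mat_dvd_zero[OF M _ minimal_polynomialD(1)[OF M q]] by blast
    then show "poly_mat (k r) M * poly_mat (f r) M = 0\<^sub>m d d" by (simp add: poly_mat_mult[OF M])
  qed
  then obtain W where W: "\<And>r. r < R \<Longrightarrow> W r \<in> carrier_mat (L r) d"
    and fW: "\<And>r. r < R \<Longrightarrow> poly_mat (f r) M = X r * W r" by metis
  let ?n = "offset L R"
  let ?P = "\<lambda>r. block_embed ?n L r :: 'a mat"
  obtain S where S: "S \<in> carrier_mat d ?n" and SP: "\<And>r. r < R \<Longrightarrow> S * ?P r = X r"
    using block_columns_exist[of R X d L] X by blast
  \<comment> \<open>Transposing turns the assembly of block columns into a stacking of the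
    \<open>W r\<close> as block rows.\<close>
  obtain Z' where Z': "Z' \<in> carrier_mat d ?n" "\<And>r. r < R \<Longrightarrow> Z' * ?P r = transpose_mat (W r)"
    using block_columns_exist[of R "\<lambda>r. transpose_mat (W r)" d L] W by (metis transpose_carrier_mat)
  define Z where "Z = transpose_mat Z'"
  have Z: "Z \<in> carrier_mat ?n d" using Z' by (simp add: Z_def)
  have PZ: "transpose_mat (?P r) * Z = W r" if "r < R" for r
    using Z' that transpose_mult[of Z' d ?n "?P r" "L r"] by (simp add: Z_def)
  have WX: "W s * X r = (if s = r then 1\<^sub>m (L r) else 0\<^sub>m (L s) (L r))" if rs: "r < R" "s < R" for r s
  proof (rule full_column_rank_mult_cancel[OF X[OF rs(2)] XD(2)[OF rs(2) rs(2) rs(2)]])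
    have "X r * poly_mat (k r) (T r) = X r * 0\<^sub>m (L r) (L r)"
      unfolding poly_mat_intertwine[OF M T[OF rs(1)] X[OF rs(1)] MX[OF rs(1)], symmetric]
        XD(1)[OF rs(1) rs(1) rs(1)] by (rule right_mult_zero_mat[OF X[OF rs(1)], symmetric])
    then have kT: "poly_mat (k r) (T r) = 0\<^sub>m (L r) (L r)"
      by (rule full_column_rank_mult_cancel[OF X[OF rs(1)] XD(2)[OF rs(1) rs(1) rs(1)]
          poly_mat_carrier[OF T[OF rs(1)]] zero_carrier_mat])
    have "X s * (W s * X r) = poly_mat (f s) M * X r"
      unfolding fW[OF rs(2)] by (rule assoc_mult_mat[OF X W X, symmetric]) (use rs in auto)
    also have "\<dots> = X r * poly_mat (f s) (T r)"
      by (rule poly_mat_intertwine[OF M T X MX]) (use rs in auto)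
    also have "poly_mat (f s) (T r) = (if s = r then 1\<^sub>m (L r) else 0\<^sub>m (L r) (L r))"
      using poly_mat_eq_one[OF T[OF rs(1)] kT, of "f s"] poly_mat_dvd_zero[OF T[OF rs(1)] _ kT, of "f s"] f rs by auto
    also have "X r * \<dots> = X s * (if s = r then 1\<^sub>m (L r) else 0\<^sub>m (L s) (L r))"
      using X[OF rs(1)] X[OF rs(2)] by auto
    finally show "X s * (W s * X r) = X s * (if s = r then 1\<^sub>m (L r) else 0\<^sub>m (L s) (L r))" .
  qed (use W[OF rs(2)] X[OF rs(1)] in auto)
  have "Z * S = 1\<^sub>m ?n"
  proof (rule eq_mat_blocksI)
    show ZS: "Z * S \<in> carrier_mat ?n ?n" using Z S by simp
    fix r assume r: "r < R"
    \<comment> \<open>Within block column \<open>r\<close> the comparison goes by block rows, which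
      become block columns after transposing.\<close>
    have "transpose_mat (Z * S * ?P r) = transpose_mat (1\<^sub>m ?n * ?P r)"
    proof (rule eq_mat_blocksI)
      show "transpose_mat (Z * S * ?P r) \<in> carrier_mat (L r) ?n" using ZS by simp
      show "transpose_mat (1\<^sub>m ?n * ?P r) \<in> carrier_mat (L r) ?n" by simp
      fix s assume s: "s < R"
      have "transpose_mat (?P s) * (Z * S * ?P r) = transpose_mat (?P s) * Z * (S * ?P r)"
        unfolding assoc_mult_mat[OF Z S block_embed_carrier]
        using Z S by (intro assoc_mult_mat[symmetric]) auto
      also have "\<dots> = transpose_mat (?P s) * (1\<^sub>m ?n * ?P r)"
        by (simp only: PZ[OF s] SP[OF r] WX[OF r s] left_mult_one_mat[OF block_embed_carrier]
            block_embed_orthogonal[OF s r])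
      finally have eq: "transpose_mat (?P s) * (Z * S * ?P r) = transpose_mat (?P s) * (1\<^sub>m ?n * ?P r)" .
      have tr: "transpose_mat Y * ?P s = transpose_mat (transpose_mat (?P s) * Y)"
        if "Y \<in> carrier_mat ?n (L r)" for Y
        using transpose_mult[of "transpose_mat (?P s)" "L s" ?n Y "L r"] that by simp
      show "transpose_mat (Z * S * ?P r) * ?P s = transpose_mat (1\<^sub>m ?n * ?P r) * ?P s"
        by (simp only: tr[of "Z * S * ?P r", OF mult_carrier_mat[OF ZS block_embed_carrier]]
            tr[of "1\<^sub>m ?n * ?P r", OF mult_carrier_mat[OF one_carrier_mat block_embed_carrier]] eq)
    qed
    then show "Z * S * ?P r = 1\<^sub>m ?n * ?P r" by (metis transpose_transpose)
  qed simp
  have SZ: "S * Z \<in> carrier_mat d d" using S Z by simp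
  have SZX: "S * Z * X r = X r" if r: "r < R" for r
  proof -
    have "S * Z * X r = S * Z * S * ?P r"
      unfolding SP[OF r, symmetric] by (rule assoc_mult_mat[OF SZ S block_embed_carrier, symmetric])
    also have "S * Z * S = S"
      by (simp only: assoc_mult_mat[OF S Z S] \<open>Z * S = 1\<^sub>m ?n\<close> right_mult_one_mat[OF S])
    finally show ?thesis by (simp only: SP[OF r])
  qed
  \<comment> \<open>\<open>S * Z\<close> fixes every \<open>X r\<close>, hence every
    \<open>f r(M) = X r * W r\<close>, and these projections sum to the identity.\<close>
  have SZf: "S * Z * poly_mat (\<Sum>r<m. f r) M = poly_mat (\<Sum>r<m. f r) M" if "m \<le> R" for m
    using that
  proof (induction m)
    case 0
    then show ?case using right_mult_zero_mat[OF SZ] M by simp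
  next
    case (Suc m)
    have "S * Z * poly_mat (f m) M = poly_mat (f m) M"
      using Suc.prems
      by (simp only: fW Suc_le_eq SZX assoc_mult_mat[OF SZ X W, symmetric])
    then show ?case
      using Suc by (simp add: poly_mat_add[OF M] mult_add_distrib_mat[OF SZ car car])
  qed
  have "poly_mat (\<Sum>r<R. f r) M = 1\<^sub>m d"
    by (rule poly_mat_eq_one[OF M minimal_polynomialD(1)[OF M q] fsum])
  then have "S * Z = 1\<^sub>m d" using SZf[of R] right_mult_one_mat[OF SZ] by simp
  have d: "?n = d"
    by (rule two_sided_inverse_imp_square[OF S Z \<open>S * Z = 1\<^sub>m d\<close> \<open>Z * S = 1\<^sub>m ?n\<close>, symmetric])
  have S': "S \<in> carrier_mat d d" and Z': "Z \<in> carrier_mat d d" using S Z d by auto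
  have inv: "invertible_mat S"
    using \<open>S * Z = 1\<^sub>m d\<close> \<open>Z * S = 1\<^sub>m ?n\<close> d by (intro invertible_matI[OF S' Z']) auto
  note i = inv_mat[OF S' inv]
  let ?D = "diag_block_mat (map T [0..<R])"
  have D: "?D \<in> carrier_mat ?n ?n" using T by (rule diag_block_mat_carrier)
  have "M * S = S * ?D"
  proof (rule eq_mat_blocksI)
    fix r assume r: "r < R"
    have "M * S * ?P r = X r * T r"
      by (simp only: assoc_mult_mat[OF M S block_embed_carrier] SP[OF r] MX[OF r])
    also have "\<dots> = S * (?P r * T r)"
      unfolding SP[OF r, symmetric] using S T[OF r] by (intro assoc_mult_mat) auto
    also have "?P r * T r = ?D * ?P r" using diag_block_mat_mult_embed[of R T L r] T r by simp
    also have "S * \<dots> = S * ?D * ?P r" using S D by (intro assoc_mult_mat[symmetric]) auto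
    finally show "M * S * ?P r = S * ?D * ?P r" .
  qed (use M S D in auto)
  then have "S * ?D * inv_mat S = M"
    by (simp only: assoc_mult_mat[OF M S' i(1)] i(2) right_mult_one_mat[OF M] flip: \<open>M * S = S * ?D\<close>)
  then have decomp: "M = S * ?D * inv_mat S" by (rule sym)
  have cb: "col_block S L r = X r" if "r < R" for r
    using col_block_eq[of S d L R r] S that SP by simp
  have "primary_decomposition M R p \<mu> L S T"
    unfolding primary_decomposition_def
    using M S' inv d T MX dist basis by (intro conjI decomp) (auto simp: kM cb offset_def)
  then show ?thesis by blast
qed

text \<open>\<open>Q * M = M' * Q\<close>, so \<open>Q\<close> maps the primary components of
  \<open>M\<close> onto those of \<open>M'\<close> with inverse \<open>P\<close>. Carrying the basis
  along leaves its coordinates alone, which is why \<open>T\<close> stays the same.\<close>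

lemma primary_decomposition_similar:
  assumes M: "(M :: 'a::field mat) \<in> carrier_mat d d" and pd: "primary_decomposition M R p \<mu> L S T"
    and wit: "similar_mat_wit M M' P Q"
  shows "primary_decomposition M' R p \<mu> L (Q * S) T"
proof -
  note w = similar_mat_witD2[OF M wit]
  have M': "M' \<in> carrier_mat d d" and P: "P \<in> carrier_mat d d" and Q: "Q \<in> carrier_mat d d"
    and PQ: "P * Q = 1\<^sub>m d" "Q * P = 1\<^sub>m d" and eq: "M = P * M' * Q" using w by auto
  note D = primary_decompositionD[OF M pd]
  note i = inv_mat[OF D(1,2)]
  have MP: "M * P = P * M'"
    unfolding eq using P Q M' PQ by (simp add: assoc_mult_mat[of _ d d _ d _ d])
  have QM: "Q * M = M' * Q"
    unfolding eq using Q P M'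
    by (simp only: assoc_mult_mat[OF Q mult_carrier_mat[OF P M'] Q, symmetric]
        assoc_mult_mat[OF Q P M', symmetric] PQ left_mult_one_mat[OF M'])
  have S': "Q * S \<in> carrier_mat d d" using Q D(1) by simp
  have inv1: "Q * S * (inv_mat S * P) = 1\<^sub>m d"
  proof -
    have "Q * S * (inv_mat S * P) = Q * (S * inv_mat S) * P"
      using Q D(1) i(1) P by (simp add: assoc_mult_mat[of _ d d _ d _ d])
    then show ?thesis using i Q PQ by simp
  qed
  have inv2: "inv_mat S * P * (Q * S) = 1\<^sub>m d"
  proof -
    have "inv_mat S * P * (Q * S) = inv_mat S * (P * Q) * S"
      using Q D(1) i(1) P by (simp add: assoc_mult_mat[of _ d d _ d _ d])
    then show ?thesis using i D(1) PQ by simp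
  qed
  have inv: "invertible_mat (Q * S)"
    using i P by (intro invertible_matI[OF S' _ inv1 inv2]) auto
  note i' = inv_mat[OF S' inv]
  have "inv_mat (Q * S) = inv_mat (Q * S) * (Q * S * (inv_mat S * P))"
    unfolding inv1 using i' by simp
  also have "\<dots> = inv_mat (Q * S) * (Q * S) * (inv_mat S * P)"
    using i' S' i(1) P by (intro assoc_mult_mat[symmetric]) auto
  also have "\<dots> = inv_mat S * P" using i' i P by simp
  finally have inv_eq: "inv_mat (Q * S) = inv_mat S * P" .
  let ?D = "diag_block_mat (map T [0..<R])"
  have Dc: "?D \<in> carrier_mat d d" using diag_block_mat_carrier[of R T L, OF D(4)] D(3) by simp
  have "M' = Q * P * M' * (Q * P)" using M' PQ by simp
  also have "\<dots> = Q * M * P" unfolding eq using M' P Q by (simp add: assoc_mult_mat[of _ d d _ d _ d])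
  also have "M = S * ?D * inv_mat S" using pd unfolding primary_decomposition_def by simp
  also have "Q * (S * ?D * inv_mat S) * P = Q * S * ?D * inv_mat (Q * S)"
    unfolding inv_eq using Q P D(1) Dc i(1) by (simp add: assoc_mult_mat[of _ d d _ d _ d])
  finally have decomp: "M' = Q * S * ?D * inv_mat (Q * S)" .
  have blocks: "M' * col_block (Q * S) L r = col_block (Q * S) L r * T r \<and>
      distinct (cols (col_block (Q * S) L r)) \<and>
      kernel.basis d (poly_mat (p r) M' ^\<^sub>m \<mu> r) (set (cols (col_block (Q * S) L r)))"
    if r: "r < R" for r
  proof -
    let ?U = "S * block_embed d L r" and ?N = "poly_mat (p r ^ \<mu> r)"
    have U: "?U \<in> carrier_mat d (L r)" using D(1) by simp
    have cb: "col_block (Q * S) L r = Q * ?U"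
      using col_block_eq[of "Q * S" d L R r] S' r Q D(1,3) by (simp add: assoc_mult_mat[OF Q D(1) block_embed_carrier])
    have MU: "M' * (Q * ?U) = Q * ?U * T r"
    proof -
      have "M' * (Q * ?U) = Q * M * ?U"
        unfolding QM by (rule assoc_mult_mat[OF M' Q U, symmetric])
      also have "\<dots> = Q * (?U * T r)"
        unfolding D(6)[OF r, symmetric] by (rule assoc_mult_mat[OF Q M U])
      also have "\<dots> = Q * ?U * T r" by (rule assoc_mult_mat[OF Q U D(4)[OF r], symmetric])
      finally show ?thesis .
    qed
    note KD = kernel_basisD[OF poly_mat_carrier[OF M] U D(9)[OF r] D(10)[OF r]]
    note N = poly_mat_carrier[OF M, of "p r ^ \<mu> r"] and N' = poly_mat_carrier[OF M', of "p r ^ \<mu> r"]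
    have NQ: "?N M' * Q = Q * ?N M" by (rule poly_mat_intertwine[OF M' M Q QM[symmetric]])
    have NP: "?N M * P = P * ?N M'" by (rule poly_mat_intertwine[OF M M' P MP])
    have QU: "Q * ?U \<in> carrier_mat d (L r)" using Q U by simp
    have "?N M' * (Q * ?U) = Q * (?N M * ?U)"
      by (simp only: assoc_mult_mat[OF N' Q U, symmetric] NQ assoc_mult_mat[OF Q N U])
    then have 1: "?N M' * (Q * ?U) = 0\<^sub>m d (L r)" unfolding KD(1) right_mult_zero_mat[OF Q] .
    have 2: "full_column_rank (Q * ?U)"
      by (rule full_column_rank_mult[OF Q U full_column_rank_left_inverse[OF Q P PQ(1)] KD(2)])
    have 3: "\<exists>w\<in>carrier_vec (L r). v = Q * ?U *\<^sub>v w" if v: "v \<in> carrier_vec d" "?N M' *\<^sub>v v = 0\<^sub>v d" for v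
    proof -
      have "?N M *\<^sub>v (P *\<^sub>v v) = ?N M * P *\<^sub>v v" by (rule assoc_mult_mat_vec[OF N P v(1), symmetric])
      also have "\<dots> = P *\<^sub>v (?N M' *\<^sub>v v)" unfolding NP by (rule assoc_mult_mat_vec[OF P N' v(1)])
      also have "\<dots> = 0\<^sub>v d" unfolding v(2) using P by (intro eq_vecI) auto
      finally have "?N M *\<^sub>v (P *\<^sub>v v) = 0\<^sub>v d" .
      moreover have "P *\<^sub>v v \<in> carrier_vec d" using P v by simp
      ultimately obtain w where w: "w \<in> carrier_vec (L r)" "P *\<^sub>v v = ?U *\<^sub>v w" using KD(3) by blast
      have "v = Q * P *\<^sub>v v" using v PQ by simp
      also have "\<dots> = Q *\<^sub>v (?U *\<^sub>v w)" using assoc_mult_mat_vec[OF Q P v(1)] w by simp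
      also have "\<dots> = Q * ?U *\<^sub>v w" by (rule assoc_mult_mat_vec[OF Q U w(1), symmetric])
      finally show ?thesis using w by blast
    qed
    show ?thesis
      unfolding cb poly_mat_power[OF M', symmetric]
      using MU kernel_basisI[OF N' QU 1 2 3] by blast
  qed
  show ?thesis
    unfolding primary_decomposition_def
    using M' S' inv D(3,4) blocks by (intro conjI decomp) (auto simp: offset_def)
qed

text \<open>The block lengths of two similar matrices are known to agree only for
  \<open>r < R\<close>, so they cannot be replaced as functions.\<close>

lemma primary_decomposition_cong:
  assumes "\<And>r. r < R \<Longrightarrow> L r = L' r"
  shows "primary_decomposition M R p \<mu> L S T \<longleftrightarrow> primary_decomposition M R p \<mu> L' S T"
proof -
  have "offset L r = offset L' r" if "r < R" for r
    unfolding offset_def using assms that by (intro sum.cong) auto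
  then have "col_block S L r = col_block S L' r" if "r < R" for r
    using that assms by (simp add: col_block_def)
  moreover have "(\<Sum>r<R. L r) = (\<Sum>r<R. L' r)" using assms by (intro sum.cong) auto
  ultimately show ?thesis unfolding primary_decomposition_def using assms by auto
qed

lemma kernel_dim_poly_mat_similar:
  assumes M: "(M :: 'a::field mat) \<in> carrier_mat d d" and wit: "similar_mat_wit M M' P Q"
  shows "kernel_dim (poly_mat f M) = kernel_dim (poly_mat f M')"
proof -
  note w = similar_mat_witD2[OF M wit]
  have M': "M' \<in> carrier_mat d d" and P: "P \<in> carrier_mat d d" and Q: "Q \<in> carrier_mat d d"
    and PQ: "P * Q = 1\<^sub>m d" "Q * P = 1\<^sub>m d" and eq: "M = P * M' * Q" using w by auto
  note N = poly_mat_carrier[OF M, of f] and N' = poly_mat_carrier[OF M', of f]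
  have MP: "M * P = P * M'"
    unfolding eq using P Q M' PQ by (simp add: assoc_mult_mat[of _ d d _ d _ d])
  have "poly_mat f M = poly_mat f M * P * Q"
    using N P Q PQ by (simp add: assoc_mult_mat[of _ d d _ d _ d])
  then have "poly_mat f M = P * poly_mat f M' * Q" by (simp add: poly_mat_intertwine[OF M M' P MP])
  then have "similar_mat_wit (poly_mat f M) (poly_mat f M') P Q"
    using P Q PQ N N' unfolding similar_mat_wit_def by (auto simp: Let_def)
  from similar_mat_wit_kernel_dim[OF N this] show ?thesis
    using N N' unfolding kernel_dim_def by simp
qed

text \<open>Write \<open>q = c + x g\<close>, so that \<open>M g(M) = - c\<close>. If
  \<open>c\<close> is nonzero, this gives the inverse; if \<open>c = 0\<close> and \<open>M\<close>
  is invertible, then \<open>g\<close> annihilates \<open>M\<close> in smaller degree. Matrices with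
  a common minimal polynomial are thus invertible together, which links the \<open>T n r\<close> for
  different \<open>n\<close>.\<close>

lemma invertible_mat_iff_minimal_polynomial:
  assumes M: "(M :: 'a::field mat) \<in> carrier_mat n n" and q: "minimal_polynomial M q"
  shows "invertible_mat M \<longleftrightarrow> coeff q 0 \<noteq> 0"
proof -
  note D = minimal_polynomialD[OF M q]
  obtain c g where qc: "q = pCons c g" by (cases q) auto
  note G = poly_mat_carrier[OF M, of g]
  have zero: "c \<cdot>\<^sub>m 1\<^sub>m n + M * poly_mat g M = 0\<^sub>m n n" using D(1) by (simp add: qc poly_mat_pCons[OF M])
  show ?thesis
  proof
    assume inv: "invertible_mat M"
    note i = inv_mat[OF M inv]
    show "coeff q 0 \<noteq> 0"
    proof
      assume "coeff q 0 = 0"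
      then have c: "c = 0" by (simp add: qc)
      have "0 \<cdot>\<^sub>m 1\<^sub>m n + M * poly_mat g M = M * poly_mat g M" using M G by (intro eq_matI) auto
      then have "M * poly_mat g M = 0\<^sub>m n n" using zero c by simp
      then have "inv_mat M * M * poly_mat g M = inv_mat M * 0\<^sub>m n n"
        by (simp only: assoc_mult_mat[OF i(1) M G])
      then have "poly_mat g M = 0\<^sub>m n n"
        unfolding i(3) left_mult_one_mat[OF G] right_mult_zero_mat[OF i(1)] .
      then have "q dvd g" by (rule D(3))
      moreover have "g \<noteq> 0" using D(2) qc c by auto
      ultimately have "degree q \<le> degree g" by (rule dvd_imp_degree_le)
      then show False using qc \<open>g \<noteq> 0\<close> by simp
    qed
  next
    assume "coeff q 0 \<noteq> 0"
    then have c: "c \<noteq> 0" by (simp add: qc)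
    define Y where "Y = (- inverse c) \<cdot>\<^sub>m poly_mat g M"
    have Y: "Y \<in> carrier_mat n n" using G by (simp add: Y_def)
    have MG: "M * poly_mat g M = (- c) \<cdot>\<^sub>m 1\<^sub>m n"
    proof (rule eq_matI)
      fix i j assume "i < dim_row ((- c) \<cdot>\<^sub>m 1\<^sub>m n :: 'a mat)" "j < dim_col ((- c) \<cdot>\<^sub>m 1\<^sub>m n :: 'a mat)"
      then have ij: "i < n" "j < n" by auto
      have "(c \<cdot>\<^sub>m 1\<^sub>m n) $$ (i, j) + (M * poly_mat g M) $$ (i, j) = 0"
        using arg_cong[OF zero, of "\<lambda>Z. Z $$ (i, j)"] ij M G by simp
      then show "(M * poly_mat g M) $$ (i, j) = ((- c) \<cdot>\<^sub>m 1\<^sub>m n) $$ (i, j)"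
        using ij by (simp add: add_eq_0_iff del: index_mult_mat(1))
    qed (use M G in auto)
    have "M * Y = 1\<^sub>m n"
      unfolding Y_def mult_smult_distrib[OF M G] MG using c by (intro eq_matI) auto
    moreover have "Y * M = 1\<^sub>m n"
      unfolding Y_def mult_smult_assoc_mat[OF G M] poly_mat_commute[OF M] MG
      using c by (intro eq_matI) auto
    ultimately show "invertible_mat M" by (rule invertible_matI[OF M Y])
  qed
qed

section \<open>Tensors that are coupled by matrices\<close>

lemma poly_mat_sum_index:
  fixes R :: nat
  assumes M: "M \<in> carrier_mat n n" and ij: "i < n" "j < n"
  shows "poly_mat (\<Sum>r<R. f r) M $$ (i, j) = (\<Sum>r<R. poly_mat (f r) M $$ (i, j))"
proof (induction R)
  case 0
  then show ?case using M ij by simp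
next
  case (Suc R)
  have "dim_row (poly_mat (f R) M) = n" "dim_col (poly_mat (f R) M) = n"
    using poly_mat_carrier[OF M, of "f R"] by auto
  then show ?case using Suc ij by (simp add: poly_mat_add[OF M])
qed

lemma tensor_sum_mode_prod_poly_mat:
  fixes A :: "'a::comm_ring_1 tensor"
  assumes n: "n < length (dims A)" and M: "M \<in> carrier_mat (dims A ! n) (dims A ! n)"
  shows "tensor_sum (dims A) R (\<lambda>r. mode_prod n A (transpose_mat (poly_mat (f r) M))) =
    mode_prod n A (transpose_mat (poly_mat (\<Sum>r<R. f r) M))"
proof (rule tensor_eqI)
  have dims: "(dims A)[n := dim_row (transpose_mat (poly_mat g M))] = dims A" for g
    using poly_mat_carrier[OF M, of g] by simp
  show "dims (tensor_sum (dims A) R (\<lambda>r. mode_prod n A (transpose_mat (poly_mat (f r) M)))) =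
      dims (mode_prod n A (transpose_mat (poly_mat (\<Sum>r<R. f r) M)))"
    by (simp only: tensor_sum_def dims_tensor dims_mode_prod dims)
  fix ix assume "ix \<in> tensor_indices (dims (mode_prod n A (transpose_mat (poly_mat (\<Sum>r<R. f r) M))))"
  then have ix: "ix \<in> tensor_indices (dims A)" by (simp only: dims_mode_prod dims)
  then have ixn: "ix ! n < dims A ! n" using n by (simp add: tensor_indices_def)
  have e: "entry (mode_prod n A (transpose_mat (poly_mat g M))) ix =
      (\<Sum>l<dims A ! n. poly_mat g M $$ (l, ix ! n) * entry A (ix[n := l]))" for g
  proof -
    have "entry (mode_prod n A (transpose_mat (poly_mat g M))) ix =
      (\<Sum>l<dims A ! n. transpose_mat (poly_mat g M) $$ (ix ! n, l) * entry A (ix[n := l]))"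
      by (rule entry_mode_prod) (simp only: dims ix)
    then show ?thesis using ixn poly_mat_carrier[OF M, of g] by simp
  qed
  have "entry (tensor_sum (dims A) R (\<lambda>r. mode_prod n A (transpose_mat (poly_mat (f r) M)))) ix =
      (\<Sum>l<dims A ! n. \<Sum>r<R. poly_mat (f r) M $$ (l, ix ! n) * entry A (ix[n := l]))"
    using ix by (subst sum.swap) (simp add: tensor_sum_def e)
  also have "\<dots> = entry (mode_prod n A (transpose_mat (poly_mat (\<Sum>r<R. f r) M))) ix"
    using ixn unfolding e by (intro sum.cong) (auto simp: poly_mat_sum_index[OF M] sum_distrib_right)
  finally show "entry (tensor_sum (dims A) R (\<lambda>r. mode_prod n A (transpose_mat (poly_mat (f r) M)))) ix =
      entry (mode_prod n A (transpose_mat (poly_mat (\<Sum>r<R. f r) M))) ix" .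
qed

lemma tensor_sum_cong:
  "(\<And>r. r < R \<Longrightarrow> F r = G r) \<Longrightarrow> tensor_sum ds R F = tensor_sum ds R G"
  unfolding tensor_sum_def by simp

section \<open>Coordinate projections onto a block\<close>

lemma block_embed_projection_index:
  assumes "i < d" "j < d"
  shows "(block_embed d L r * transpose_mat (block_embed d L r)) $$ (i, j) =
    (if i = j \<and> i \<in> block_range L r then 1 else 0 :: 'a::semiring_1)"
proof -
  have "(block_embed d L r * transpose_mat (block_embed d L r)) $$ (i, j) =
      (\<Sum>k\<in>{0..<L r}. (if i = offset L r + k then 1 else 0) * (if j = offset L r + k then 1 else 0 :: 'a))"
    using assms by (simp add: block_embed_def scalar_prod_def)
  also have "\<dots> = (\<Sum>k\<in>{0..<L r}. if k = i - offset L r then (if i = j \<and> offset L r \<le> i then 1 else 0) else 0)"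
    by (intro sum.cong) auto
  also have "\<dots> = (if i = j \<and> i \<in> block_range L r then 1 else 0)"
    by (auto simp: block_range_def)
  finally show ?thesis .
qed

lemma entry_mode_prod_projection:
  fixes D :: "'a::comm_semiring_1 tensor"
  assumes n: "n < length (dims D)" and ix: "ix \<in> tensor_indices (dims D)"
  shows "entry (mode_prod n D (block_embed (dims D ! n) L r * transpose_mat (block_embed (dims D ! n) L r))) ix =
    (if ix ! n \<in> block_range L r then entry D ix else 0)"
proof -
  have ixn: "ix ! n < dims D ! n" using n ix by (auto simp: tensor_indices_def)
  have "entry (mode_prod n D (block_embed (dims D ! n) L r * transpose_mat (block_embed (dims D ! n) L r))) ix =
    (\<Sum>l<dims D ! n. (block_embed (dims D ! n) L r * transpose_mat (block_embed (dims D ! n) L r)) $$ (ix ! n, l)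
      * entry D (ix[n := l]))"
    using ix by (intro entry_mode_prod) simp
  also have "\<dots> = (\<Sum>l<dims D ! n. if l = ix ! n then (if ix ! n \<in> block_range L r then entry D ix else 0) else 0)"
    using ixn by (intro sum.cong) (auto simp: block_embed_projection_index simp del: index_mult_mat(1))
  also have "\<dots> = (if ix ! n \<in> block_range L r then entry D ix else 0)" using ixn by simp
  finally show ?thesis .
qed

section \<open>Consequences of the coupling alone: minimal polynomials and slices\<close>

locale coupled_tensors =
  fixes A B :: "'a::field tensor" and I :: "nat list" and K :: nat and M :: "nat \<Rightarrow> 'a mat"
  assumes K: "0 < K" "K \<le> length I"
    and dims_A [simp]: "dims A = I" and dims_B [simp]: "dims B = I"
    and full: "\<And>n. n < K \<Longrightarrow> full_column_rank (mode_mat n A)"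
    and M: "\<And>n. n < K \<Longrightarrow> M n \<in> carrier_mat (I ! n) (I ! n)"
    and mode_mat_B: "\<And>n. n < K \<Longrightarrow> mode_mat n B = mode_mat n A * M n"
begin

lemma B_eq: "n < K \<Longrightarrow> B = mode_prod n A (transpose_mat (M n))"
  using K M mode_mat_B by (subst mode_prod_eq_iff_mode_mat) auto

lemma mode_prod_poly:
  assumes "m < K" "n < K"
  shows "mode_prod m A (transpose_mat (poly_mat f (M m))) = mode_prod n A (transpose_mat (poly_mat f (M n)))"
proof (cases "m = n")
  case False
  then show ?thesis
    using assms K M B_eq[OF assms(1)] B_eq[OF assms(2)] by (intro mode_prod_poly_mat_eq) auto
qed simp

text \<open>\<open>B\<close> is itself \<open>A\<close> multiplied by \<open>M n\<close>, so
  applying \<open>f\<close> to \<open>B\<close> means applying \<open>x f\<close>, that is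
  \<open>pCons 0 f\<close>, to \<open>A\<close>. In this way the terms of \<open>B\<close> are also
  obtained from \<open>A\<close>.\<close>

lemma mode_prod_poly_B:
  assumes "n < K"
  shows "mode_prod n B (transpose_mat (poly_mat f (M n))) =
    mode_prod n A (transpose_mat (poly_mat (pCons 0 f) (M n)))"
proof -
  have "0 \<cdot>\<^sub>m 1\<^sub>m (I ! n) + M n * poly_mat f (M n) = M n * poly_mat f (M n)"
    using M[OF assms] poly_mat_carrier[OF M[OF assms], of f] by (intro eq_matI) auto
  then show ?thesis
    unfolding B_eq[OF assms] poly_mat_pCons[OF M[OF assms]]
    using K assms M poly_mat_carrier[OF M[OF assms]]
    by (subst mode_prod_transpose_mult) auto
qed

lemma mode_mat_carrier:
  "n < K \<Longrightarrow> dims Z = I \<Longrightarrow> mode_mat n Z \<in> carrier_mat (\<Prod>k\<in>{..<length I} - {n}. I ! k) (I ! n)"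
  by (simp add: mode_mat_def)

lemma mode_mat_mode_prod':
  assumes "n < K" "dims Z = I" "X \<in> carrier_mat (I ! n) k"
  shows "mode_mat n (mode_prod n Z (transpose_mat X)) = mode_mat n Z * X"
  using mode_mat_mode_prod[of n Z "transpose_mat X" k] assms K by simp

text \<open>In the mode-\<open>n\<close> matrix representation the hypothesis reads
  \<open>A_(n) X = A_(n) Y\<close>, and full column rank cancels \<open>A_(n)\<close>.\<close>

lemma mode_prod_inj:
  assumes "n < K" "X \<in> carrier_mat (I ! n) k" "Y \<in> carrier_mat (I ! n) k"
    "mode_prod n A (transpose_mat X) = mode_prod n A (transpose_mat Y)"
  shows "X = Y"
  using full_column_rank_mult_cancel[OF mode_mat_carrier[OF assms(1) dims_A] full[OF assms(1)] assms(2,3)]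
    mode_mat_mode_prod'[OF assms(1) dims_A assms(2)] mode_mat_mode_prod'[OF assms(1) dims_A assms(3)] assms(4)
  by simp

text \<open>The product of \<open>A\<close> with the zero matrix is also independent of the mode,
  being the value of the zero polynomial. So the vanishing of \<open>f(M m)\<close> is passed on as
  an equality of tensors and recovered in mode \<open>n\<close> by cancellation.\<close>

lemma poly_mat_zero_iff:
  assumes "m < K" "n < K"
  shows "poly_mat f (M m) = 0\<^sub>m (I ! m) (I ! m) \<longleftrightarrow> poly_mat f (M n) = 0\<^sub>m (I ! n) (I ! n)"
proof -
  have "poly_mat f (M n) = poly_mat 0 (M n)" if "poly_mat f (M m) = poly_mat 0 (M m)" "m < K" "n < K" for m n
    using that mode_prod_poly[of m n f] mode_prod_poly[of m n 0]
    by (intro mode_prod_inj[OF \<open>n < K\<close> poly_mat_carrier poly_mat_carrier]) (auto simp: M)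
  then show ?thesis using assms M by (metis poly_mat_0 carrier_matD(1))
qed

lemma minimal_polynomial_iff:
  assumes "m < K" "n < K"
  shows "minimal_polynomial (M m) q \<longleftrightarrow> minimal_polynomial (M n) q"
  unfolding minimal_polynomial_def using M[OF assms(1)] M[OF assms(2)] poly_mat_zero_iff[OF assms] by auto

text \<open>Both sides are the same combination of slices of \<open>B\<close>. Expressed through
  mode \<open>i\<close>, a slice of \<open>B\<close> is a slice of \<open>A\<close> multiplied by
  the transpose of \<open>M i\<close> from the left; through mode \<open>j\<close>, it is multiplied
  by \<open>M j\<close> from the right.\<close>

lemma slice_combination_intertwine:
  assumes i: "i < K" and j: "j < K" and "i \<noteq> j"
  shows "transpose_mat (M i) * slice_combination i j c A = slice_combination i j c A * M j"
proof (rule eq_matI)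
  let ?C = "slice_combination i j c A"
  have C: "?C \<in> carrier_mat (I ! i) (I ! j)" by (simp add: slice_combination_def)
  let ?J = "{ix \<in> tensor_indices I. ix ! i = 0 \<and> ix ! j = 0}"
  fix a b assume "a < dim_row (?C * M j)" "b < dim_col (?C * M j)"
  then have ab: "a < I ! i" "b < I ! j" using C M[OF j] by auto
  have il: "i < length I" "j < length I" using i j K by auto
  have Cab: "?C $$ (a, b) = (\<Sum>ix\<in>?J. c ix * entry A (ix[i := a, j := b]))"
    if "a < I ! i" "b < I ! j" for a b
    using that by (simp add: slice_combination_def slice_def)
  have ent: "(\<Sum>l<I ! i. M i $$ (l, a) * entry A (ix[i := l, j := b])) =
      (\<Sum>l<I ! j. M j $$ (l, b) * entry A (ix[i := a, j := l]))" if ix: "ix \<in> ?J" for ix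
  proof -
    have ixab: "ix[i := a, j := b] \<in> tensor_indices I"
      using ix ab il tensor_indices_update[of ix I i a "I ! i"]
        tensor_indices_update[of "ix[i := a]" I j b "I ! j"] by simp
    have len: "length ix = length I" using ix by (simp add: tensor_indices_def)
    have "(\<Sum>l<I ! i. M i $$ (l, a) * entry A (ix[i := l, j := b])) =
        entry (mode_prod i A (transpose_mat (M i))) (ix[i := a, j := b])"
      using M[OF i] ixab ab il len \<open>i \<noteq> j\<close>
      by (subst entry_mode_prod) (auto simp: list_update_swap[of j i] nth_list_update)
    also have "\<dots> = entry (mode_prod j A (transpose_mat (M j))) (ix[i := a, j := b])"
      using B_eq[OF i] B_eq[OF j] by simp
    also have "\<dots> = (\<Sum>l<I ! j. M j $$ (l, b) * entry A (ix[i := a, j := l]))"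
      using M[OF j] ixab ab il len by (subst entry_mode_prod) auto
    finally show ?thesis .
  qed
  have "(transpose_mat (M i) * ?C) $$ (a, b) = (\<Sum>l<I ! i. M i $$ (l, a) * ?C $$ (l, b))"
    using M[OF i] C ab by (simp add: scalar_prod_def lessThan_atLeast0)
  also have "\<dots> = (\<Sum>l<I ! i. \<Sum>ix\<in>?J. c ix * (M i $$ (l, a) * entry A (ix[i := l, j := b])))"
    using ab by (intro sum.cong) (auto simp: Cab sum_distrib_left mult.left_commute)
  also have "\<dots> = (\<Sum>ix\<in>?J. c ix * (\<Sum>l<I ! i. M i $$ (l, a) * entry A (ix[i := l, j := b])))"
    by (subst sum.swap) (simp add: sum_distrib_left)
  also have "\<dots> = (\<Sum>ix\<in>?J. c ix * (\<Sum>l<I ! j. M j $$ (l, b) * entry A (ix[i := a, j := l])))"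
    by (intro sum.cong refl) (simp only: ent)
  also have "\<dots> = (\<Sum>l<I ! j. \<Sum>ix\<in>?J. c ix * (M j $$ (l, b) * entry A (ix[i := a, j := l])))"
    by (subst sum.swap) (simp add: sum_distrib_left)
  also have "\<dots> = (\<Sum>l<I ! j. ?C $$ (a, l) * M j $$ (l, b))"
    using ab by (intro sum.cong) (auto simp: Cab sum_distrib_left sum_distrib_right ac_simps)
  also have "\<dots> = (?C * M j) $$ (a, b)"
    using M[OF j] C ab by (simp add: scalar_prod_def lessThan_atLeast0)
  finally show "(transpose_mat (M i) * ?C) $$ (a, b) = (?C * M j) $$ (a, b)" .
qed (use M[OF i] M[OF j] in \<open>auto simp: slice_combination_def\<close>)

end

text \<open>The polynomials \<open>f r\<close> are fixed once for all modes: the projections in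
  different modes can be compared because they are values of the same polynomial.\<close>

locale primary_coupled_tensors = coupled_tensors A B I K M
  for A B :: "'a::field tensor" and I :: "nat list" and K :: nat and M :: "nat \<Rightarrow> 'a mat" +
  fixes q :: "'a poly" and R :: nat and p :: "nat \<Rightarrow> 'a poly" and \<mu> :: "nat \<Rightarrow> nat"
    and L :: "nat \<Rightarrow> nat \<Rightarrow> nat" and S :: "nat \<Rightarrow> 'a mat" and T :: "nat \<Rightarrow> nat \<Rightarrow> 'a mat"
    and f :: "nat \<Rightarrow> 'a poly"
  assumes min: "\<And>n. n < K \<Longrightarrow> minimal_polynomial (M n) q"
    and pd: "\<And>n. n < K \<Longrightarrow> primary_decomposition (M n) R p \<mu> (L n) (S n) (T n)"
    and f1: "\<And>r. r < R \<Longrightarrow> p r ^ \<mu> r dvd f r - 1"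
    and f0: "\<And>r s. r < R \<Longrightarrow> s < R \<Longrightarrow> r \<noteq> s \<Longrightarrow> p s ^ \<mu> s dvd f r"
    and fsum: "q dvd (\<Sum>r<R. f r) - 1"
begin

text \<open>In every mode, the blocks \<open>S\<^sub>n\<^sub>r\<close> and \<open>X\<^sup>(\<^sup>n\<^sup>)\<^sub>r\<^sup>T\<close> of the primary decomposition are a basis
  of the \<open>r\<close>th component and the coordinates with respect to it.\<close>

definition U :: "nat \<Rightarrow> nat \<Rightarrow> 'a mat" where
  "U r n = S n * block_embed (I ! n) (L n) r"

definition V :: "nat \<Rightarrow> nat \<Rightarrow> 'a mat" where
  "V r n = transpose_mat (block_embed (I ! n) (L n) r) * inv_mat (S n)"

text \<open>Parametrised by the tensor, so that \<open>B\<close> can be treated with the same bases: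
  \<open>core A r\<close> is the block \<open>D_r\<close>, while \<open>core B r\<close> turns out
  to be \<open>D_r\<close> multiplied by the transpose of \<open>T n r\<close> in any mode
  \<open>n\<close>.\<close>

definition core :: "'a tensor \<Rightarrow> nat \<Rightarrow> 'a tensor" where
  "core Z r = diagonal_block K L r (mode_prods K Z (\<lambda>n. transpose_mat (S n)))"

definition component :: "'a tensor \<Rightarrow> nat \<Rightarrow> 'a tensor" where
  "component Z r = mode_prods K (core Z r) (\<lambda>n. col_block (transpose_mat (inv_mat (S n))) (L n) r)"

lemmas pdD = primary_decompositionD[OF M pd]

lemma inv_S:
  assumes "n < K"
  shows "inv_mat (S n) \<in> carrier_mat (I ! n) (I ! n)" "S n * inv_mat (S n) = 1\<^sub>m (I ! n)"
    "inv_mat (S n) * S n = 1\<^sub>m (I ! n)"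
  using inv_mat[OF pdD(1)[OF assms assms] pdD(2)[OF assms assms]] .

lemma UV:
  assumes "n < K" "r < R"
  shows "U r n \<in> carrier_mat (I ! n) (L n r)" "V r n \<in> carrier_mat (L n r) (I ! n)"
    "V r n * U r n = 1\<^sub>m (L n r)" "M n * U r n = U r n * T n r"
  using pdD(1)[OF assms(1,1)] inv_S[OF assms(1)] pdD(6,7)[OF assms(1,1,2)]
  by (auto simp: U_def V_def)

lemma T_carrier: "n < K \<Longrightarrow> r < R \<Longrightarrow> T n r \<in> carrier_mat (L n r) (L n r)"
  using pdD(4) by blast

lemma col_block_X:
  assumes "n < K" "r < R"
  shows "col_block (transpose_mat (inv_mat (S n))) (L n) r = transpose_mat (V r n)"
proof -
  have "col_block (transpose_mat (inv_mat (S n))) (L n) r =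
      transpose_mat (inv_mat (S n)) * block_embed (I ! n) (L n) r"
    using col_block_eq[of "transpose_mat (inv_mat (S n))" "I ! n" "L n" R r]
      inv_S(1)[OF assms(1)] pdD(3)[OF assms(1,1)] assms(2) by simp
  then show ?thesis
    using transpose_mult[of "transpose_mat (block_embed (I ! n) (L n) r)" "L n r" "I ! n" "inv_mat (S n)" "I ! n"]
      inv_S(1)[OF assms(1)] by (simp add: V_def)
qed

lemma core_eq:
  assumes Z: "dims Z = I" and r: "r < R"
  shows "core Z r = mode_prods K Z (\<lambda>n. transpose_mat (U r n))"
proof -
  let ?D = "mode_prods K Z (\<lambda>n. transpose_mat (S n))"
  have dD: "dims ?D ! n = I ! n" if "n < K" for n
    using that K Z pdD(1)[OF that that] by (simp add: dims_mode_prods)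
  have "core Z r = mode_prods K ?D (\<lambda>n. transpose_mat (block_embed (dims ?D ! n) (L n) r))"
    unfolding core_def using K Z r pdD(3) dD
    by (intro diagonal_block_eq_mode_prods[where R = R]) auto
  also have "\<dots> = mode_prods K ?D (\<lambda>n. transpose_mat (block_embed (I ! n) (L n) r))"
    by (rule mode_prods_cong) (simp add: dD)
  also have "\<dots> = mode_prods K Z (\<lambda>n. transpose_mat (block_embed (I ! n) (L n) r) * transpose_mat (S n))"
    using K Z by (intro mode_prods_mode_prods) (simp_all add: carrier_matD[OF pdD(1)])
  also have "\<dots> = mode_prods K Z (\<lambda>n. transpose_mat (U r n))"
    unfolding U_def using pdD(1)
    by (intro mode_prods_cong transpose_mult[symmetric, of _ "I ! _" "I ! _" _ "L _ r"]) auto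
  finally show ?thesis .
qed

text \<open>From \<open>M m * U r m = U r m * T m r\<close>, the factor \<open>T m r\<close> behind
  the block is a factor \<open>M m\<close> in front of it, where it turns \<open>A\<close> into
  \<open>B\<close>. The right-hand side no longer mentions \<open>m\<close>, so the products of
  \<open>D_r\<close> in all modes agree.\<close>

lemma mode_prod_core:
  assumes "m < K" "r < R"
  shows "mode_prod m (core A r) (transpose_mat (T m r)) = core B r"
proof -
  have "mode_prod m (core A r) (transpose_mat (T m r)) =
      mode_prods K A ((\<lambda>n. transpose_mat (U r n))(m := transpose_mat (T m r) * transpose_mat (U r m)))"
    unfolding core_eq[OF dims_A assms(2)]
    using assms K UV(1)[OF assms] T_carrier[OF assms] by (intro mode_prod_mode_prods) auto
  also have "transpose_mat (T m r) * transpose_mat (U r m) = transpose_mat (U r m) * transpose_mat (M m)"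
    using UV(1,4)[OF assms] T_carrier[OF assms] M[OF assms(1)]
    by (metis transpose_mult)
  also have "mode_prods K A ((\<lambda>n. transpose_mat (U r n))(m := transpose_mat (U r m) * transpose_mat (M m))) =
      mode_prods K (mode_prod m A (transpose_mat (M m))) (\<lambda>n. transpose_mat (U r n))"
    using assms K UV(1)[OF assms] M[OF assms(1)] by (intro mode_prods_mode_prod[symmetric]) auto
  also have "\<dots> = core B r"
    unfolding B_eq[OF assms(1), symmetric] core_eq[OF dims_B assms(2)] ..
  finally show ?thesis .
qed

lemma component_eq_projections:
  assumes Z: "dims Z = I" and r: "r < R"
  shows "component Z r = mode_prods K Z (\<lambda>n. transpose_mat (U r n * V r n))"
proof -
  have "component Z r = mode_prods K (core Z r) (\<lambda>n. transpose_mat (V r n))"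
    unfolding component_def using r by (intro mode_prods_cong) (simp add: col_block_X)
  also have "\<dots> = mode_prods K Z (\<lambda>n. transpose_mat (V r n) * transpose_mat (U r n))"
    unfolding core_eq[OF Z r] using K Z
    by (intro mode_prods_mode_prods) (simp_all add: carrier_matD[OF UV(1)] carrier_matD[OF UV(2)] r)
  also have "\<dots> = mode_prods K Z (\<lambda>n. transpose_mat (U r n * V r n))"
    using UV(1,2)[OF _ r] by (intro mode_prods_cong transpose_mult[symmetric])
  finally show ?thesis .
qed

lemma dims_core:
  assumes "r < R"
  shows "core A r \<in> carrier_tensor (map (\<lambda>n. if n < K then L n r else I ! n) [0..<length I])"
  unfolding carrier_tensor_def core_def diagonal_block_def
  using K by (auto simp: dims_mode_prods intro!: nth_equalityI)

lemma projection_eq: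
  assumes "n < K" "r < R"
  shows "poly_mat (f r) (M n) = U r n * V r n"
  unfolding U_def V_def
  by (rule primary_decomposition_projection[OF M[OF assms(1)] pd[OF assms(1)] assms(2) f1[OF assms(2)] f0[OF assms(2)]])

text \<open>\<open>component Z r\<close> carries the projection in every mode; since
  \<open>V r m * U r m = 1\<close> makes the projections idempotent, one mode suffices. The
  assumption \<open>eq\<close> leaves \<open>Z\<close> open so that the result covers both
  \<open>A\<close> and \<open>B\<close>.\<close>

lemma component_eq:
  assumes Z: "dims Z = I" and r: "r < R" and n: "n < K"
    and eq: "\<And>m n. m < K \<Longrightarrow> n < K \<Longrightarrow>
      mode_prod m Z (transpose_mat (poly_mat (f r) (M m))) = mode_prod n Z (transpose_mat (poly_mat (f r) (M n)))"
  shows "component Z r = mode_prod n Z (transpose_mat (poly_mat (f r) (M n)))"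
proof -
  have "component Z r = mode_prods K Z (\<lambda>n. transpose_mat (poly_mat (f r) (M n)))"
    unfolding component_eq_projections[OF Z r]
    by (rule mode_prods_cong) (simp only: projection_eq[OF _ r])
  also have "\<dots> = mode_prod n Z (transpose_mat (poly_mat (f r) (M n)))"
  proof (rule mode_prods_idempotent[OF K(1) _ _ _ eq n])
    fix m assume m: "m < K"
    note UV = UV[OF m r]
    show "poly_mat (f r) (M m) \<in> carrier_mat (dims Z ! m) (dims Z ! m)"
      unfolding Z by (rule poly_mat_carrier[OF M[OF m]])
    have "U r m * V r m * (U r m * V r m) = U r m * (V r m * (U r m * V r m))"
      using UV by (intro assoc_mult_mat) auto
    also have "V r m * (U r m * V r m) = V r m"
      by (simp only: assoc_mult_mat[OF UV(2,1,2), symmetric] UV(3) left_mult_one_mat[OF UV(2)])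
    finally show "poly_mat (f r) (M m) * poly_mat (f r) (M m) = poly_mat (f r) (M m)"
      by (simp only: projection_eq[OF m r])
  qed (use K Z in auto)
  finally show ?thesis .
qed

lemma component_A:
  assumes "n < K" "r < R"
  shows "component A r = mode_prod n A (transpose_mat (poly_mat (f r) (M n)))"
  using assms by (intro component_eq mode_prod_poly) auto

lemma component_B:
  assumes "n < K" "r < R"
  shows "component B r = mode_prod n A (transpose_mat (poly_mat (pCons 0 (f r)) (M n)))"
  unfolding mode_prod_poly_B[OF assms(1), symmetric]
proof (rule component_eq[OF dims_B assms(2,1)])
  fix m n assume "m < K" "n < K"
  then show "mode_prod m B (transpose_mat (poly_mat (f r) (M m))) =
      mode_prod n B (transpose_mat (poly_mat (f r) (M n)))"
    using mode_prod_poly_B[of m "f r"] mode_prod_poly_B[of n "f r"] mode_prod_poly[of m n "pCons 0 (f r)"]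
    by metis
qed

lemma poly_mat_pCons_projection:
  assumes "n < K" "r < R"
  shows "poly_mat (pCons 0 (f r)) (M n) = U r n * (T n r * V r n)"
proof -
  note UV = UV[OF assms]
  have "poly_mat (pCons 0 (f r)) (M n) = M n * (U r n * V r n)"
    unfolding poly_mat_pCons[OF M[OF assms(1)]] projection_eq[OF assms]
    using M[OF assms(1)] UV by (intro eq_matI) auto
  also have "\<dots> = U r n * T n r * V r n"
    by (simp only: assoc_mult_mat[OF M[OF assms(1)] UV(1,2), symmetric] UV(4))
  also have "\<dots> = U r n * (T n r * V r n)"
    by (rule assoc_mult_mat[OF UV(1) T_carrier[OF assms] UV(2)])
  finally show ?thesis .
qed

lemma sum_component_A: "A = tensor_sum I R (component A)"
proof -
  have 0: "0 < length I" "0 < K" using K by auto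
  have "tensor_sum I R (component A) =
      tensor_sum (dims A) R (\<lambda>r. mode_prod 0 A (transpose_mat (poly_mat (f r) (M 0))))"
    using component_A[OF 0(2)] by (auto intro: tensor_sum_cong)
  also have "\<dots> = mode_prod 0 A (transpose_mat (poly_mat (\<Sum>r<R. f r) (M 0)))"
    using 0 M[OF 0(2)] by (intro tensor_sum_mode_prod_poly_mat) auto
  also have "poly_mat (\<Sum>r<R. f r) (M 0) = 1\<^sub>m (I ! 0)"
    by (rule poly_mat_eq_one[OF M[OF 0(2)] minimal_polynomialD(1)[OF M[OF 0(2)] min[OF 0(2)]] fsum])
  also have "mode_prod 0 A (transpose_mat (1\<^sub>m (I ! 0))) = A"
    using mode_prod_one[of 0 A] 0 by simp
  finally show ?thesis by simp
qed

lemma sum_component_B: "B = tensor_sum I R (component B)"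
proof -
  have 0: "0 < length I" "0 < K" using K by auto
  have "tensor_sum I R (component B) =
      tensor_sum (dims B) R (\<lambda>r. mode_prod 0 B (transpose_mat (poly_mat (f r) (M 0))))"
    using component_B[OF 0(2)] 0 by (auto intro: tensor_sum_cong simp: mode_prod_poly_B)
  also have "\<dots> = mode_prod 0 B (transpose_mat (poly_mat (\<Sum>r<R. f r) (M 0)))"
    using 0 M[OF 0(2)] by (intro tensor_sum_mode_prod_poly_mat) auto
  also have "poly_mat (\<Sum>r<R. f r) (M 0) = 1\<^sub>m (I ! 0)"
    by (rule poly_mat_eq_one[OF M[OF 0(2)] minimal_polynomialD(1)[OF M[OF 0(2)] min[OF 0(2)]] fsum])
  also have "mode_prod 0 B (transpose_mat (1\<^sub>m (I ! 0))) = B"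
    using mode_prod_one[of 0 B] 0 by simp
  finally show ?thesis by simp
qed

lemma dims_component:
  assumes "r < R"
  shows "dims (component A r) = I" "dims (component B r) = I"
  using component_A[OF K(1) assms] component_B[OF K(1) assms]
    poly_mat_carrier[OF M[OF K(1)], of "f r"] poly_mat_carrier[OF M[OF K(1)], of "pCons 0 (f r)"]
  by auto

text \<open>All mode matrices factor through \<open>?G\<close>, which has full column rank
  \<open>L n r\<close>. For \<open>A\<close> the other factor is \<open>V r n\<close>, undone from
  the right by \<open>U r n\<close>, so no rank is lost. For \<open>B\<close> it is
  \<open>T n r * V r n\<close>, which can be undone when \<open>T n r\<close> is invertible.\<close>

lemma mat_rank_component:
  assumes n: "n < K" and r: "r < R"
  shows "mat_rank (mode_mat n (component A r)) = L n r"
    "mat_rank (mode_mat n (component B r)) \<le> L n r"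
    "invertible_mat (T n r) \<Longrightarrow> mat_rank (mode_mat n (component B r)) = L n r"
proof -
  note UV = UV[OF n r] and T = T_carrier[OF n r]
  note mm = mode_mat_carrier[OF n dims_A]
  let ?G = "mode_mat n A * U r n"
  have G: "?G \<in> carrier_mat (\<Prod>k\<in>{..<length I} - {n}. I ! k) (L n r)" using mm UV by simp
  have "full_column_rank ?G"
    by (rule full_column_rank_mult[OF mm UV(1) full[OF n] full_column_rank_left_inverse[OF UV(1,2,3)]])
  then have rG: "mat_rank ?G = L n r" unfolding full_column_rank_def carrier_matD(2)[OF G] .
  have A: "mode_mat n (component A r) = ?G * V r n"
    unfolding component_A[OF n r] projection_eq[OF n r]
      mode_mat_mode_prod'[OF n dims_A mult_carrier_mat[OF UV(1,2)]]
    by (rule assoc_mult_mat[OF mm UV(1,2), symmetric])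
  have TV: "T n r * V r n \<in> carrier_mat (L n r) (I ! n)" using T UV by simp
  have B: "mode_mat n (component B r) = ?G * (T n r * V r n)"
    unfolding component_B[OF n r] poly_mat_pCons_projection[OF n r]
      mode_mat_mode_prod'[OF n dims_A mult_carrier_mat[OF UV(1) TV]]
    by (rule assoc_mult_mat[OF mm UV(1) TV, symmetric])
  have GVU: "?G * V r n * U r n = ?G"
    by (simp only: assoc_mult_mat[OF G UV(2,1)] UV(3) right_mult_one_mat[OF G])
  have GV: "?G * V r n \<in> carrier_mat (\<Prod>k\<in>{..<length I} - {n}. I ! k) (I ! n)" using G UV by simp
  show "mat_rank (mode_mat n (component A r)) = L n r"
    using mat_rank_mult_le[OF G UV(2)] mat_rank_mult_le[OF GV UV(1)] GVU rG A by simp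
  show le: "mat_rank (mode_mat n (component B r)) \<le> L n r"
    using mat_rank_mult_le[OF G TV] rG B by simp
  assume inv: "invertible_mat (T n r)"
  note i = inv_mat[OF T inv]
  \<comment> \<open>\<open>U r n * inv_mat (T n r)\<close> is a right inverse of
    \<open>T n r * V r n\<close>.\<close>
  have "?G * (T n r * V r n) * (U r n * inv_mat (T n r)) = ?G"
  proof -
    have Ui: "U r n * inv_mat (T n r) \<in> carrier_mat (I ! n) (L n r)" using UV i by simp
    have "?G * (T n r * V r n) * (U r n * inv_mat (T n r)) =
        ?G * (T n r * V r n * (U r n * inv_mat (T n r)))"
      by (rule assoc_mult_mat[OF G TV Ui])
    also have "T n r * V r n * (U r n * inv_mat (T n r)) = T n r * (V r n * (U r n * inv_mat (T n r)))"
      by (rule assoc_mult_mat[OF T UV(2) Ui])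
    also have "V r n * (U r n * inv_mat (T n r)) = inv_mat (T n r)"
      by (simp only: assoc_mult_mat[OF UV(2,1) i(1), symmetric] UV(3) left_mult_one_mat[OF i(1)])
    finally show ?thesis by (simp only: i(2) right_mult_one_mat[OF G])
  qed
  moreover have "mat_rank (?G * (T n r * V r n) * (U r n * inv_mat (T n r))) \<le> mat_rank (?G * (T n r * V r n))"
    using G TV UV i by (intro mat_rank_mult_le[of _ _ "I ! n" _ "L n r"]) auto
  ultimately show "mat_rank (mode_mat n (component B r)) = L n r" using le rG B by simp
qed

lemma component_B_smult:
  assumes n: "n < K" and r: "r < R" and T: "T n r = c \<cdot>\<^sub>m 1\<^sub>m (L n r)"
  shows "component B r = smult_tensor c (component A r)"
proof -
  note UV = UV[OF n r]
  have "U r n * (T n r * V r n) = c \<cdot>\<^sub>m (U r n * V r n)"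
    unfolding T using UV
    by (simp add: mult_smult_assoc_mat[of _ "L n r" "L n r"] mult_smult_distrib[of _ "I ! n" "L n r"])
  then have "transpose_mat (poly_mat (pCons 0 (f r)) (M n)) = c \<cdot>\<^sub>m transpose_mat (poly_mat (f r) (M n))"
    unfolding poly_mat_pCons_projection[OF n r] projection_eq[OF n r] by (auto intro!: eq_matI)
  then show ?thesis
    unfolding component_A[OF n r] component_B[OF n r]
    using n K poly_mat_carrier[OF M[OF n], of "f r"] by (simp add: mode_prod_smult)
qed

text \<open>After the products with the \<open>S n\<close>, the projection \<open>f r(M n)\<close>
  becomes the coordinate projection onto block \<open>r\<close> of mode \<open>n\<close>. As
  \<open>f r(M n)\<close> acts on \<open>A\<close> independently of \<open>n\<close>, restricting to
  block \<open>r\<close> gives the same tensor in every mode.\<close>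

lemma block_diagonal_core: "block_diagonal K R L (mode_prods K A (\<lambda>n. transpose_mat (S n)))"
proof -
  let ?D = "mode_prods K A (\<lambda>n. transpose_mat (S n))"
  have dD: "dims ?D ! n = I ! n" if "n < K" for n
    using that K pdD(1)[OF that that] by (simp add: dims_mode_prods)
  let ?E = "\<lambda>r n. block_embed (I ! n) (L n) r * transpose_mat (block_embed (I ! n) (L n) r) :: 'a mat"
  have proj: "mode_prod n ?D (?E r n) =
      mode_prods K (mode_prod n A (transpose_mat (poly_mat (f r) (M n)))) (\<lambda>n. transpose_mat (S n))"
    if n: "n < K" and r: "r < R" for n r
  proof -
    note S = pdD(1)[OF n n] and i = inv_S[OF n] and F = poly_mat_carrier[OF M[OF n], of "f r"]
    let ?P = "block_embed (I ! n) (L n) r :: 'a mat"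
    have P: "?P \<in> carrier_mat (I ! n) (L n r)" "transpose_mat ?P \<in> carrier_mat (L n r) (I ! n)" by auto
    have E: "?E r n \<in> carrier_mat (I ! n) (I ! n)" by (rule mult_carrier_mat[OF P])
    have ET: "transpose_mat (?E r n) = ?E r n"
      using transpose_mult[OF P] by simp
    have "poly_mat (f r) (M n) * S n = U r n * (V r n * S n)"
      unfolding projection_eq[OF n r] by (rule assoc_mult_mat[OF UV(1,2)[OF n r] S])
    also have "V r n * S n = transpose_mat ?P"
      unfolding V_def by (simp only: assoc_mult_mat[OF P(2) i(1) S] i(3) right_mult_one_mat[OF P(2)])
    also have "U r n * transpose_mat ?P = S n * ?E r n"
      unfolding U_def by (rule assoc_mult_mat[OF S P])
    finally have FS: "poly_mat (f r) (M n) * S n = S n * ?E r n" .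
    \<comment> \<open>\<open>?E r n\<close> is symmetric, so the transpose of \<open>FS\<close>
      carries the projection from behind the product with \<open>S n\<close> to the front.\<close>
    have "?E r n * transpose_mat (S n) = transpose_mat (S n) * transpose_mat (poly_mat (f r) (M n))"
      using transpose_mult[OF S E] transpose_mult[OF F S] unfolding FS ET by simp
    moreover have "mode_prod n ?D (?E r n) =
        mode_prods K A ((\<lambda>n. transpose_mat (S n))(n := ?E r n * transpose_mat (S n)))"
      using n K S E by (intro mode_prod_mode_prods) auto
    moreover have "mode_prods K (mode_prod n A (transpose_mat (poly_mat (f r) (M n)))) (\<lambda>n. transpose_mat (S n)) =
        mode_prods K A ((\<lambda>n. transpose_mat (S n))(n := transpose_mat (S n) * transpose_mat (poly_mat (f r) (M n))))"
      using n K S F by (intro mode_prods_mode_prod) auto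
    ultimately show ?thesis by simp
  qed
  show ?thesis
    unfolding block_diagonal_def
  proof (intro conjI allI impI ballI)
    fix n assume "n < K"
    then show "(\<Sum>r<R. L n r) = dims ?D ! n" using dD pdD(3) by (simp add: offset_def)
  next
    fix ix assume ix: "ix \<in> tensor_indices (dims ?D)"
      and none: "\<nexists>r. r < R \<and> (\<forall>n<K. ix ! n \<in> block_range (L n) r)"
    have "ix ! 0 < dims ?D ! 0" using ix K unfolding tensor_indices_def by fastforce
    then have "ix ! 0 < offset (L 0) R" using dD[OF K(1)] pdD(3)[OF K(1) K(1)] by simp
    \<comment> \<open>Take the block of the first index; some other index \<open>n\<close> then lies
      outside it.\<close>
    then obtain r where r: "r < R" "ix ! 0 \<in> block_range (L 0) r"
      unfolding block_range_def by (elim offset_add_exists) auto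
    then obtain n where n: "n < K" "ix ! n \<notin> block_range (L n) r" using none by blast
    have ent: "entry (mode_prod n ?D (?E r n)) ix = (if ix ! n \<in> block_range (L n) r then entry ?D ix else 0)"
      if "n < K" for n
      using entry_mode_prod_projection[of n ?D ix "L n" r] that K ix dD[OF that] by simp
    \<comment> \<open>At \<open>ix\<close> the left-hand tensor keeps the entry of
      \<open>?D\<close>, while the right-hand one clears it.\<close>
    have "mode_prod 0 ?D (?E r 0) = mode_prod n ?D (?E r n)"
      unfolding proj[OF K(1) r(1)] proj[OF n(1) r(1)] mode_prod_poly[OF K(1) n(1)] ..
    then show "entry ?D ix = 0" using ent[OF K(1)] ent[OF n(1)] r(2) n(2) by simp
  qed
qed

end

text \<open>The rank of \<open>Br r\<close> is stated in two parts since it drops when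
  \<open>T n r\<close> is singular; invertibility in one mode gives the exact rank in all modes. The
  clause on similar matrices admits \<open>i = j\<close>, so it also shows that primary
  decompositions as in the preceding clause exist.\<close>

theorem theorem4p3:
  fixes A B :: "'a::real_or_complex tensor"
    and I :: "nat list" and N K :: nat
    and M :: "nat \<Rightarrow> 'a mat"
  assumes "3 \<le> N" and "2 \<le> K" and "K \<le> N"
    and "length I = N" and "\<forall>n<N. 0 < I ! n"
    and "A \<in> carrier_tensor I" and "B \<in> carrier_tensor I"
    and "\<forall>n<K. full_column_rank (mode_mat n A)"
    and "\<forall>n<K. M n \<in> carrier_mat (I ! n) (I ! n) \<and> mode_mat n B = mode_mat n A * M n"
  shows
    "(\<exists>q. \<forall>n<K. minimal_polynomial (M n) q) \<and>
     (\<forall>q R p \<mu> L.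
        (\<forall>n<K. minimal_polynomial (M n) q) \<and> irreducible_factorization q R p \<mu> \<and>
        (\<forall>n<K. \<forall>r<R. L n r = kernel_dim (poly_mat (p r) (M n) ^\<^sub>m \<mu> r)) \<longrightarrow>
        (\<forall>S T.
           (\<forall>n<K. primary_decomposition (M n) R p \<mu> (L n) (S n) (T n)) \<and>
           (\<forall>n<K. \<forall>r<R. minimal_polynomial (T n r) (p r ^ \<mu> r)) \<longrightarrow>
           (let D = mode_prods K A (\<lambda>n. transpose_mat (S n));
                Dr = (\<lambda>r. diagonal_block K L r D);
                X = (\<lambda>n. transpose_mat (inv_mat (S n)));
                Xr = (\<lambda>r n. col_block (X n) (L n) r);
                Ar = (\<lambda>r. mode_prods K (Dr r) (Xr r));
                Br = (\<lambda>r. mode_prods K (mode_prod 0 (Dr r) (transpose_mat (T 0 r))) (Xr r))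
            in block_diagonal K R L D \<and>
               (\<forall>r<R. Dr r \<in> carrier_tensor (map (\<lambda>n. if n < K then L n r else I ! n) [0..<N])) \<and>
               (\<forall>r<R. \<forall>m<K. \<forall>n<K.
                  mode_prod m (Dr r) (transpose_mat (T m r)) = mode_prod n (Dr r) (transpose_mat (T n r))) \<and>
               (\<forall>r<R. Ar r \<in> carrier_tensor I \<and> Br r \<in> carrier_tensor I) \<and>
               A = tensor_sum I R Ar \<and> B = tensor_sum I R Br \<and>
               (\<forall>r<R. has_ml_rank K (\<lambda>n. L n r) (Ar r)) \<and>
               (\<forall>r<R. (\<exists>n<K. invertible_mat (T n r)) \<longrightarrow> has_ml_rank K (\<lambda>n. L n r) (Br r)) \<and>
               (\<forall>r<R. \<forall>n<K. mat_rank (mode_mat n (Br r)) \<le> L n r) \<and>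
               (\<forall>r<R. \<forall>n<K. \<forall>c. T n r = c \<cdot>\<^sub>m 1\<^sub>m (L n r) \<longrightarrow> Br r = smult_tensor c (Ar r)) \<and>
               (\<forall>c. (\<forall>r<R. \<exists>n<K. T n r = c r \<cdot>\<^sub>m 1\<^sub>m (L n r)) \<longrightarrow>
                  A = tensor_sum I R Ar \<and> B = tensor_sum I R (\<lambda>r. smult_tensor (c r) (Ar r)) \<and>
                  (\<forall>r<R. has_ml_rank K (\<lambda>n. L n r) (Ar r))))) \<and>
        (\<forall>i<K. \<forall>j<K. similar_mat (M i) (M j) \<longrightarrow>
           (\<forall>r<R. L i r = L j r) \<and>
           (\<exists>S T. (\<forall>n<K. primary_decomposition (M n) R p \<mu> (L n) (S n) (T n)) \<and>
                  (\<forall>n<K. \<forall>r<R. minimal_polynomial (T n r) (p r ^ \<mu> r)) \<and>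
                  (\<forall>r<R. T i r = T j r)))) \<and>
     (\<forall>i<K. \<forall>j<K. i \<noteq> j \<and> I ! i = I ! j \<and> (\<exists>c. invertible_mat (slice_combination i j c A)) \<longrightarrow>
        similar_mat (M i) (M j))"
proof (intro conjI)
  have K0: "0 < K" using \<open>2 \<le> K\<close> by simp
  interpret coupled_tensors A B I K M
    using assms K0 by unfold_locales (auto simp: carrier_tensor_def)
  note Mc = M
  obtain q where "minimal_polynomial (M 0) q" using minimal_polynomial_exists[OF Mc[OF K0]] by blast
  then show "\<exists>q. \<forall>n<K. minimal_polynomial (M n) q" using minimal_polynomial_iff[OF K0] by blast
  show "\<forall>i<K. \<forall>j<K. i \<noteq> j \<and> I ! i = I ! j \<and> (\<exists>c. invertible_mat (slice_combination i j c A)) \<longrightarrow>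
      similar_mat (M i) (M j)"
  proof (intro allI impI, elim conjE exE)
    fix i j c assume ij: "i < K" "j < K" "i \<noteq> j" "I ! i = I ! j"
      and inv: "invertible_mat (slice_combination i j c A)"
    \<comment> \<open>The nonsingular combination of slices intertwines the transpose of
      \<open>M i\<close> with \<open>M j\<close>.\<close>
    have "similar_mat (transpose_mat (M i)) (M j)"
      using Mc[OF ij(1)] Mc[OF ij(2)] ij(4) inv slice_combination_intertwine[OF ij(1-3), of c]
      by (intro similar_mat_intertwine[of _ "I ! j" _ "slice_combination i j c A"])
        (auto simp: slice_combination_def)
    then show "similar_mat (M i) (M j)"
      using similar_mat_transpose_self[OF Mc[OF ij(1)]] similar_mat_sym similar_mat_trans by blast
  qed
  show "\<forall>q R p \<mu> L.
        (\<forall>n<K. minimal_polynomial (M n) q) \<and> irreducible_factorization q R p \<mu> \<and>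
        (\<forall>n<K. \<forall>r<R. L n r = kernel_dim (poly_mat (p r) (M n) ^\<^sub>m \<mu> r)) \<longrightarrow>
        ((\<forall>S T.
           (\<forall>n<K. primary_decomposition (M n) R p \<mu> (L n) (S n) (T n)) \<and>
           (\<forall>n<K. \<forall>r<R. minimal_polynomial (T n r) (p r ^ \<mu> r)) \<longrightarrow>
           (let D = mode_prods K A (\<lambda>n. transpose_mat (S n));
                Dr = (\<lambda>r. diagonal_block K L r D);
                X = (\<lambda>n. transpose_mat (inv_mat (S n)));
                Xr = (\<lambda>r n. col_block (X n) (L n) r);
                Ar = (\<lambda>r. mode_prods K (Dr r) (Xr r));
                Br = (\<lambda>r. mode_prods K (mode_prod 0 (Dr r) (transpose_mat (T 0 r))) (Xr r))
            in block_diagonal K R L D \<and>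
               (\<forall>r<R. Dr r \<in> carrier_tensor (map (\<lambda>n. if n < K then L n r else I ! n) [0..<N])) \<and>
               (\<forall>r<R. \<forall>m<K. \<forall>n<K.
                  mode_prod m (Dr r) (transpose_mat (T m r)) = mode_prod n (Dr r) (transpose_mat (T n r))) \<and>
               (\<forall>r<R. Ar r \<in> carrier_tensor I \<and> Br r \<in> carrier_tensor I) \<and>
               A = tensor_sum I R Ar \<and> B = tensor_sum I R Br \<and>
               (\<forall>r<R. has_ml_rank K (\<lambda>n. L n r) (Ar r)) \<and>
               (\<forall>r<R. (\<exists>n<K. invertible_mat (T n r)) \<longrightarrow> has_ml_rank K (\<lambda>n. L n r) (Br r)) \<and>
               (\<forall>r<R. \<forall>n<K. mat_rank (mode_mat n (Br r)) \<le> L n r) \<and>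
               (\<forall>r<R. \<forall>n<K. \<forall>c. T n r = c \<cdot>\<^sub>m 1\<^sub>m (L n r) \<longrightarrow> Br r = smult_tensor c (Ar r)) \<and>
               (\<forall>c. (\<forall>r<R. \<exists>n<K. T n r = c r \<cdot>\<^sub>m 1\<^sub>m (L n r)) \<longrightarrow>
                  A = tensor_sum I R Ar \<and> B = tensor_sum I R (\<lambda>r. smult_tensor (c r) (Ar r)) \<and>
                  (\<forall>r<R. has_ml_rank K (\<lambda>n. L n r) (Ar r))))) \<and>
        (\<forall>i<K. \<forall>j<K. similar_mat (M i) (M j) \<longrightarrow>
           (\<forall>r<R. L i r = L j r) \<and>
           (\<exists>S T. (\<forall>n<K. primary_decomposition (M n) R p \<mu> (L n) (S n) (T n)) \<and>
                  (\<forall>n<K. \<forall>r<R. minimal_polynomial (T n r) (p r ^ \<mu> r)) \<and>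
                  (\<forall>r<R. T i r = T j r))))"
  proof (intro allI impI, elim conjE)
    fix q R p \<mu> L
    assume min: "\<forall>n<K. minimal_polynomial (M n) q" and fac: "irreducible_factorization q R p \<mu>"
      and L: "\<forall>n<K. \<forall>r<R. L n r = kernel_dim (poly_mat (p r) (M n) ^\<^sub>m \<mu> r)"
    have ex: "\<exists>S T. primary_decomposition (M n) R p \<mu> (L n) S T" if "n < K" for n
      using min fac L that by (intro primary_decomposition_exists[OF Mc[OF that]]) auto
    obtain f where f: "\<And>r. r < R \<Longrightarrow> p r ^ \<mu> r dvd f r - 1"
      "\<And>r s. r < R \<Longrightarrow> s < R \<Longrightarrow> r \<noteq> s \<Longrightarrow> p s ^ \<mu> s dvd f r" "q dvd (\<Sum>r<R. f r) - 1"
      by (rule irreducible_factorization_idempotents[OF fac]) (rule that)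
    show "((\<forall>S T.
           (\<forall>n<K. primary_decomposition (M n) R p \<mu> (L n) (S n) (T n)) \<and>
           (\<forall>n<K. \<forall>r<R. minimal_polynomial (T n r) (p r ^ \<mu> r)) \<longrightarrow>
           (let D = mode_prods K A (\<lambda>n. transpose_mat (S n));
                Dr = (\<lambda>r. diagonal_block K L r D);
                X = (\<lambda>n. transpose_mat (inv_mat (S n)));
                Xr = (\<lambda>r n. col_block (X n) (L n) r);
                Ar = (\<lambda>r. mode_prods K (Dr r) (Xr r));
                Br = (\<lambda>r. mode_prods K (mode_prod 0 (Dr r) (transpose_mat (T 0 r))) (Xr r))
            in block_diagonal K R L D \<and>
               (\<forall>r<R. Dr r \<in> carrier_tensor (map (\<lambda>n. if n < K then L n r else I ! n) [0..<N])) \<and>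
               (\<forall>r<R. \<forall>m<K. \<forall>n<K.
                  mode_prod m (Dr r) (transpose_mat (T m r)) = mode_prod n (Dr r) (transpose_mat (T n r))) \<and>
               (\<forall>r<R. Ar r \<in> carrier_tensor I \<and> Br r \<in> carrier_tensor I) \<and>
               A = tensor_sum I R Ar \<and> B = tensor_sum I R Br \<and>
               (\<forall>r<R. has_ml_rank K (\<lambda>n. L n r) (Ar r)) \<and>
               (\<forall>r<R. (\<exists>n<K. invertible_mat (T n r)) \<longrightarrow> has_ml_rank K (\<lambda>n. L n r) (Br r)) \<and>
               (\<forall>r<R. \<forall>n<K. mat_rank (mode_mat n (Br r)) \<le> L n r) \<and>
               (\<forall>r<R. \<forall>n<K. \<forall>c. T n r = c \<cdot>\<^sub>m 1\<^sub>m (L n r) \<longrightarrow> Br r = smult_tensor c (Ar r)) \<and>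
               (\<forall>c. (\<forall>r<R. \<exists>n<K. T n r = c r \<cdot>\<^sub>m 1\<^sub>m (L n r)) \<longrightarrow>
                  A = tensor_sum I R Ar \<and> B = tensor_sum I R (\<lambda>r. smult_tensor (c r) (Ar r)) \<and>
                  (\<forall>r<R. has_ml_rank K (\<lambda>n. L n r) (Ar r))))) \<and>
        (\<forall>i<K. \<forall>j<K. similar_mat (M i) (M j) \<longrightarrow>
           (\<forall>r<R. L i r = L j r) \<and>
           (\<exists>S T. (\<forall>n<K. primary_decomposition (M n) R p \<mu> (L n) (S n) (T n)) \<and>
                  (\<forall>n<K. \<forall>r<R. minimal_polynomial (T n r) (p r ^ \<mu> r)) \<and>
                  (\<forall>r<R. T i r = T j r))))"
    proof (intro conjI)
      show "\<forall>S T.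
           (\<forall>n<K. primary_decomposition (M n) R p \<mu> (L n) (S n) (T n)) \<and>
           (\<forall>n<K. \<forall>r<R. minimal_polynomial (T n r) (p r ^ \<mu> r)) \<longrightarrow>
           (let D = mode_prods K A (\<lambda>n. transpose_mat (S n));
                Dr = (\<lambda>r. diagonal_block K L r D);
                X = (\<lambda>n. transpose_mat (inv_mat (S n)));
                Xr = (\<lambda>r n. col_block (X n) (L n) r);
                Ar = (\<lambda>r. mode_prods K (Dr r) (Xr r));
                Br = (\<lambda>r. mode_prods K (mode_prod 0 (Dr r) (transpose_mat (T 0 r))) (Xr r))
            in block_diagonal K R L D \<and>
               (\<forall>r<R. Dr r \<in> carrier_tensor (map (\<lambda>n. if n < K then L n r else I ! n) [0..<N])) \<and>
               (\<forall>r<R. \<forall>m<K. \<forall>n<K.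
                  mode_prod m (Dr r) (transpose_mat (T m r)) = mode_prod n (Dr r) (transpose_mat (T n r))) \<and>
               (\<forall>r<R. Ar r \<in> carrier_tensor I \<and> Br r \<in> carrier_tensor I) \<and>
               A = tensor_sum I R Ar \<and> B = tensor_sum I R Br \<and>
               (\<forall>r<R. has_ml_rank K (\<lambda>n. L n r) (Ar r)) \<and>
               (\<forall>r<R. (\<exists>n<K. invertible_mat (T n r)) \<longrightarrow> has_ml_rank K (\<lambda>n. L n r) (Br r)) \<and>
               (\<forall>r<R. \<forall>n<K. mat_rank (mode_mat n (Br r)) \<le> L n r) \<and>
               (\<forall>r<R. \<forall>n<K. \<forall>c. T n r = c \<cdot>\<^sub>m 1\<^sub>m (L n r) \<longrightarrow> Br r = smult_tensor c (Ar r)) \<and>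
               (\<forall>c. (\<forall>r<R. \<exists>n<K. T n r = c r \<cdot>\<^sub>m 1\<^sub>m (L n r)) \<longrightarrow>
                  A = tensor_sum I R Ar \<and> B = tensor_sum I R (\<lambda>r. smult_tensor (c r) (Ar r)) \<and>
                  (\<forall>r<R. has_ml_rank K (\<lambda>n. L n r) (Ar r))))"
      proof (intro allI impI, elim conjE)
        fix S T
        assume pd: "\<forall>n<K. primary_decomposition (M n) R p \<mu> (L n) (S n) (T n)"
          and minT: "\<forall>n<K. \<forall>r<R. minimal_polynomial (T n r) (p r ^ \<mu> r)"
        interpret primary_coupled_tensors A B I K M q R p \<mu> L S T f
          using min pd f by unfold_locales auto
        note comp_sums = sum_component_A sum_component_B
        have B_smult: "component B r = smult_tensor c (component A r)"
          if "r < R" "n < K" "T n r = c \<cdot>\<^sub>m 1\<^sub>m (L n r)" for r n c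
          using component_B_smult[OF that(2,1,3)] .
        have ml_B: "has_ml_rank K (\<lambda>n. L n r) (component B r)"
          if "r < R" "n < K" "invertible_mat (T n r)" for r n
          unfolding has_ml_rank_def
        proof (intro allI impI)
          fix m assume "m < K"
          \<comment> \<open>\<open>T m r\<close> and \<open>T n r\<close> have the same minimal
            polynomial, whose constant term decides invertibility.\<close>
          have "invertible_mat (T m r)"
            using that \<open>m < K\<close> minT invertible_mat_iff_minimal_polynomial[OF T_carrier] by blast
          then show "mat_rank (mode_mat m (component B r)) = L m r"
            by (rule mat_rank_component(3)[OF \<open>m < K\<close> \<open>r < R\<close>])
        qed
        have coreB: "mode_prod m (core A r) (transpose_mat (T m r)) = core B r" if "m < K" "r < R" for m r
          using that by (rule mode_prod_core)
        have Br: "mode_prods K (mode_prod 0 (core A r) (transpose_mat (T 0 r)))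
            (\<lambda>n. col_block (transpose_mat (inv_mat (S n))) (L n) r) = component B r" if "r < R" for r
          unfolding coreB[OF K0 that] component_def ..
        \<comment> \<open>Stated for any \<open>BR\<close> that agrees with
          \<open>component B\<close> below \<open>R\<close>, since the expression for
          \<open>Br\<close> in the theorem is identified with \<open>component B r\<close> for
          \<open>r < R\<close> only.\<close>
        have goal: "block_diagonal K R L (mode_prods K A (\<lambda>n. transpose_mat (S n))) \<and>
          (\<forall>r<R. core A r \<in> carrier_tensor (map (\<lambda>n. if n < K then L n r else I ! n) [0..<N])) \<and>
          (\<forall>r<R. \<forall>m<K. \<forall>n<K. mode_prod m (core A r) (transpose_mat (T m r)) =
            mode_prod n (core A r) (transpose_mat (T n r))) \<and>
          (\<forall>r<R. component A r \<in> carrier_tensor I \<and> BR r \<in> carrier_tensor I) \<and>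
          A = tensor_sum I R (component A) \<and> B = tensor_sum I R BR \<and>
          (\<forall>r<R. has_ml_rank K (\<lambda>n. L n r) (component A r)) \<and>
          (\<forall>r<R. (\<exists>n<K. invertible_mat (T n r)) \<longrightarrow> has_ml_rank K (\<lambda>n. L n r) (BR r)) \<and>
          (\<forall>r<R. \<forall>n<K. mat_rank (mode_mat n (BR r)) \<le> L n r) \<and>
          (\<forall>r<R. \<forall>n<K. \<forall>c. T n r = c \<cdot>\<^sub>m 1\<^sub>m (L n r) \<longrightarrow> BR r = smult_tensor c (component A r)) \<and>
          (\<forall>c. (\<forall>r<R. \<exists>n<K. T n r = c r \<cdot>\<^sub>m 1\<^sub>m (L n r)) \<longrightarrow>
            A = tensor_sum I R (component A) \<and> B = tensor_sum I R (\<lambda>r. smult_tensor (c r) (component A r)) \<and>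
            (\<forall>r<R. has_ml_rank K (\<lambda>n. L n r) (component A r)))"
          if BR: "\<And>r. r < R \<Longrightarrow> BR r = component B r" for BR
        proof (intro conjI allI impI)
          show "block_diagonal K R L (mode_prods K A (\<lambda>n. transpose_mat (S n)))"
            by (rule block_diagonal_core)
          show "A = tensor_sum I R (component A)" "A = tensor_sum I R (component A)" by (rule comp_sums(1))+
          have "tensor_sum I R BR = tensor_sum I R (component B)" by (rule tensor_sum_cong) (rule BR)
          then show "B = tensor_sum I R BR" using comp_sums(2) by simp
          show "core A r \<in> carrier_tensor (map (\<lambda>n. if n < K then L n r else I ! n) [0..<N])" if "r < R" for r
            using dims_core[OF that] \<open>length I = N\<close> by simp
          show "mode_prod m (core A r) (transpose_mat (T m r)) = mode_prod n (core A r) (transpose_mat (T n r))"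
            if "r < R" "m < K" "n < K" for r m n
            using that by (simp only: coreB)
          show "component A r \<in> carrier_tensor I" "BR r \<in> carrier_tensor I" if "r < R" for r
            using dims_component[OF that] BR[OF that] by (simp_all add: carrier_tensor_def)
          show "has_ml_rank K (\<lambda>n. L n r) (component A r)" "has_ml_rank K (\<lambda>n. L n r) (component A r)"
            if "r < R" for r
            using mat_rank_component(1)[OF _ that] by (simp_all add: has_ml_rank_def)
          show "has_ml_rank K (\<lambda>n. L n r) (BR r)" if "r < R" "\<exists>n<K. invertible_mat (T n r)" for r
            using ml_B that BR by auto
          show "mat_rank (mode_mat n (BR r)) \<le> L n r" if "r < R" "n < K" for r n
            using mat_rank_component(2)[OF that(2,1)] BR[OF that(1)] by simp
          show "BR r = smult_tensor c (component A r)" if "r < R" "n < K" "T n r = c \<cdot>\<^sub>m 1\<^sub>m (L n r)" for r n c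
            using B_smult[OF that] BR[OF that(1)] by simp
          fix c assume c: "\<forall>r<R. \<exists>n<K. T n r = c r \<cdot>\<^sub>m 1\<^sub>m (L n r)"
          have "tensor_sum I R (\<lambda>r. smult_tensor (c r) (component A r)) = tensor_sum I R (component B)"
            using c B_smult by (intro tensor_sum_cong) metis
          then show "B = tensor_sum I R (\<lambda>r. smult_tensor (c r) (component A r))" using comp_sums(2) by simp
        qed
        show "(let D = mode_prods K A (\<lambda>n. transpose_mat (S n));
                Dr = (\<lambda>r. diagonal_block K L r D);
                X = (\<lambda>n. transpose_mat (inv_mat (S n)));
                Xr = (\<lambda>r n. col_block (X n) (L n) r);
                Ar = (\<lambda>r. mode_prods K (Dr r) (Xr r));
                Br = (\<lambda>r. mode_prods K (mode_prod 0 (Dr r) (transpose_mat (T 0 r))) (Xr r))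
            in block_diagonal K R L D \<and>
               (\<forall>r<R. Dr r \<in> carrier_tensor (map (\<lambda>n. if n < K then L n r else I ! n) [0..<N])) \<and>
               (\<forall>r<R. \<forall>m<K. \<forall>n<K.
                  mode_prod m (Dr r) (transpose_mat (T m r)) = mode_prod n (Dr r) (transpose_mat (T n r))) \<and>
               (\<forall>r<R. Ar r \<in> carrier_tensor I \<and> Br r \<in> carrier_tensor I) \<and>
               A = tensor_sum I R Ar \<and> B = tensor_sum I R Br \<and>
               (\<forall>r<R. has_ml_rank K (\<lambda>n. L n r) (Ar r)) \<and>
               (\<forall>r<R. (\<exists>n<K. invertible_mat (T n r)) \<longrightarrow> has_ml_rank K (\<lambda>n. L n r) (Br r)) \<and>
               (\<forall>r<R. \<forall>n<K. mat_rank (mode_mat n (Br r)) \<le> L n r) \<and>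
               (\<forall>r<R. \<forall>n<K. \<forall>c. T n r = c \<cdot>\<^sub>m 1\<^sub>m (L n r) \<longrightarrow> Br r = smult_tensor c (Ar r)) \<and>
               (\<forall>c. (\<forall>r<R. \<exists>n<K. T n r = c r \<cdot>\<^sub>m 1\<^sub>m (L n r)) \<longrightarrow>
                  A = tensor_sum I R Ar \<and> B = tensor_sum I R (\<lambda>r. smult_tensor (c r) (Ar r)) \<and>
                  (\<forall>r<R. has_ml_rank K (\<lambda>n. L n r) (Ar r))))"
          unfolding Let_def using goal[OF Br] unfolding component_def core_def .
      qed
      show "(\<forall>i<K. \<forall>j<K. similar_mat (M i) (M j) \<longrightarrow>
           (\<forall>r<R. L i r = L j r) \<and>
           (\<exists>S T. (\<forall>n<K. primary_decomposition (M n) R p \<mu> (L n) (S n) (T n)) \<and>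
                  (\<forall>n<K. \<forall>r<R. minimal_polynomial (T n r) (p r ^ \<mu> r)) \<and>
                  (\<forall>r<R. T i r = T j r)))"
      proof (intro allI impI)
        fix i j assume i: "i < K" and j: "j < K" and "similar_mat (M i) (M j)"
        then obtain P Q where wit: "similar_mat_wit (M i) (M j) P Q" unfolding similar_mat_def by blast
        have Lij: "L i r = L j r" if "r < R" for r
        proof -
          have "kernel_dim (poly_mat (p r ^ \<mu> r) (M i)) = kernel_dim (poly_mat (p r ^ \<mu> r) (M j))"
            by (rule kernel_dim_poly_mat_similar[OF Mc[OF i] wit])
          then show ?thesis
            using L i j that by (simp add: poly_mat_power[OF Mc[OF i]] poly_mat_power[OF Mc[OF j]])
        qed
        obtain S T where ST: "\<And>n. n < K \<Longrightarrow> primary_decomposition (M n) R p \<mu> (L n) (S n) (T n)"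
          using ex by metis
        \<comment> \<open>Choose decompositions in all modes and replace the one of
          \<open>M j\<close> by the one carried over from \<open>M i\<close>. For
          \<open>i = j\<close> this still is a valid choice.\<close>
        define S' where "S' = S(j := Q * S i)"
        define T' where "T' = T(j := T i)"
        have "primary_decomposition (M j) R p \<mu> (L i) (Q * S i) (T i)"
          by (rule primary_decomposition_similar[OF Mc[OF i] ST[OF i] wit])
        then have "primary_decomposition (M j) R p \<mu> (L j) (Q * S i) (T i)"
          using primary_decomposition_cong[of R "L i" "L j"] Lij by blast
        then have pd: "primary_decomposition (M n) R p \<mu> (L n) (S' n) (T' n)" if "n < K" for n
          using ST[OF that] by (simp add: S'_def T'_def)
        moreover have "minimal_polynomial (T' n r) (p r ^ \<mu> r)" if "n < K" "r < R" for n r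
          using min that
          by (intro primary_decomposition_minimal_polynomial[OF Mc[OF that(1)] pd[OF that(1)] _ fac]) auto
        moreover have "T' i r = T' j r" for r by (simp add: T'_def)
        ultimately show "(\<forall>r<R. L i r = L j r) \<and>
           (\<exists>S T. (\<forall>n<K. primary_decomposition (M n) R p \<mu> (L n) (S n) (T n)) \<and>
                  (\<forall>n<K. \<forall>r<R. minimal_polynomial (T n r) (p r ^ \<mu> r)) \<and>
                  (\<forall>r<R. T i r = T j r))"
          using Lij by blast
      qed
    qed
  qed
qed

end
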